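(* Let $I\subset\mathbb{R}$ be an open interval, $(F_i,g_{F_i})$ pseudo-Riemannian manifolds, $b_i:I\to(0,\infty)$ smooth ($i=1,\dots,m$), and let $M=I\times_{b_1}F_1\times_{b_2}F_2\cdots\times_{b_m}F_m$ be the multiply warped product with metric $g=-dt^2\oplus b_1^2g_{F_1}\oplus b_2^2g_{F_2}\cdots\oplus b_m^2g_{F_m}$. Let $\lambda_1,\lambda_2$ be nonzero real constants, $P=\frac{\partial}{\partial t}$, and let $\overline\nabla$ be the quarter-symmetric connection on $M$ determined by $P,\lambda_1,\lambda_2$. If $(M,\overline\nabla)$ has constant scalar curvature $\overline S$, then each $(F_i,\nabla^{F_i})$ has constant scalar curvature $S^{F_i}$.
   Context: On a pseudo-Riemannian manifold $(M,g)$ with Levi-Civita connection $\nabla$, a vector field $P$, the 1-form $\pi(X)=g(X,P)$ and nonzero real constants $\lambda_1,\lambda_2$, the quarter-symmetric connection is $\overline\nabla_XY=\nabla_XY+\lambda_1\pi(Y)X-\lambda_2g(X,Y)P$. Its curvature is $\overline R(X,Y)=\overline\nabla_X\overline\nabla_Y-\overline\nabla_Y\overline\nabla_X-\overline\nabla_{[X,Y]}$, its Ricci tensor is $\overline{Ric}(X,Y)=\sum_k\varepsilon_k\,g(\overline R(X,E_k)Y,E_k)$ and its scalar curvature is $\overline S=\sum_k\varepsilon_k\overline{Ric}(E_k,E_k)$, where $(E_k)$ is a local orthonormal frame with $g(E_k,E_k)=\varepsilon_k=\pm1$ (note the sign convention). $S^{F_i}$ is the scalar curvature of the Levi-Civita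 connection $\nabla^{F_i}$ of $(F_i,g_{F_i})$, with the same convention. *)

theory Defs
  imports "HOL-Analysis.Analysis"
begin

section \<open>Smooth functions on open subsets of a finite-dimensional coordinate space\<close>

text \<open>
  Coordinate space is \<open>\<real>\<^sup>K\<close> for a finite index set \<open>K\<close>: the functions in \<open>K \<rightarrow>\<^sub>E UNIV\<close> with the
  topology \<open>powertop_real K\<close>.  Dimensions of different manifolds can thus vary inside one statement,
  and the coordinates of a product are indexed by the disjoint union of the index sets.
\<close>

definition partial_deriv :: "'k \<Rightarrow> (('k \<Rightarrow> real) \<Rightarrow> real) \<Rightarrow> ('k \<Rightarrow> real) \<Rightarrow> real" where
  "partial_deriv k f x = deriv (\<lambda>s. f (x(k := s))) (x k)"

text \<open>\<open>V\<close> is meant to be open in \<open>powertop_real K\<close>, so that only the values of \<open>f\<close> on \<open>V\<close> matter.\<close>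

fun C_diff :: "'k set \<Rightarrow> nat \<Rightarrow> ('k \<Rightarrow> real) set \<Rightarrow> (('k \<Rightarrow> real) \<Rightarrow> real) \<Rightarrow> bool" where
  "C_diff K 0 V f \<longleftrightarrow> continuous_map (subtopology (powertop_real K) V) euclideanreal f"
| "C_diff K (Suc r) V f \<longleftrightarrow>
     continuous_map (subtopology (powertop_real K) V) euclideanreal f \<and>
     (\<forall>k\<in>K. (\<forall>x\<in>V. (\<lambda>s. f (x(k := s))) differentiable (at (x k))) \<and>
             C_diff K r V (partial_deriv k f))"

definition C_infinity :: "'k set \<Rightarrow> ('k \<Rightarrow> real) set \<Rightarrow> (('k \<Rightarrow> real) \<Rightarrow> real) \<Rightarrow> bool" where
  "C_infinity K V f \<longleftrightarrow> (\<forall>r. C_diff K r V f)"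

section \<open>Smooth manifolds\<close>

text \<open>
  The dimension is the cardinality of the index set \<open>mindex M\<close>.  The atlas need not be maximal.
\<close>

record ('a, 'k) manifold =
  mtop :: "'a topology"
  mindex :: "'k set"
  matlas :: "('a set \<times> ('a \<Rightarrow> 'k \<Rightarrow> real)) set"

definition smooth_manifold :: "('a, 'k) manifold \<Rightarrow> bool" where
  "smooth_manifold M \<longleftrightarrow>
     topspace (mtop M) \<noteq> {} \<and> Hausdorff_space (mtop M) \<and> second_countable (mtop M) \<and>
     finite (mindex M) \<and>
     (\<forall>(U, \<phi>)\<in>matlas M.
        openin (mtop M) U \<and> openin (powertop_real (mindex M)) (\<phi> ` U) \<and>
        homeomorphic_map (subtopology (mtop M) U)
          (subtopology (powertop_real (mindex M)) (\<phi> ` U)) \<phi>) \<and>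
     (\<Union>(U, \<phi>)\<in>matlas M. U) = topspace (mtop M) \<and>
     (\<forall>(U, \<phi>)\<in>matlas M. \<forall>(V, \<psi>)\<in>matlas M. \<forall>k\<in>mindex M.
        C_infinity (mindex M) (\<phi> ` (U \<inter> V)) (\<lambda>x. \<psi> (inv_into U \<phi> x) k))"

definition smooth_fun :: "('a, 'k) manifold \<Rightarrow> 'a set \<Rightarrow> ('a \<Rightarrow> real) \<Rightarrow> bool" where
  "smooth_fun M U f \<longleftrightarrow>
     (\<forall>(V, \<phi>)\<in>matlas M. C_infinity (mindex M) (\<phi> ` (U \<inter> V)) (\<lambda>x. f (inv_into V \<phi> x)))"

definition smooth_at :: "('a, 'k) manifold \<Rightarrow> 'a \<Rightarrow> ('a \<Rightarrow> real) \<Rightarrow> bool" where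
  "smooth_at M p f \<longleftrightarrow> (\<exists>U. openin (mtop M) U \<and> p \<in> U \<and> smooth_fun M U f)"

section \<open>Tangent vectors and vector fields\<close>

text \<open>
  A tangent vector at \<open>p\<close> is a derivation on germs at \<open>p\<close> of smooth functions.  The value \<open>0\<close> on
  functions not smooth near \<open>p\<close> is a convention that makes the representing functional unique;
  the zero vector is \<open>\<lambda>f. 0\<close>.
\<close>

type_synonym 'a tvec = "('a \<Rightarrow> real) \<Rightarrow> real"
type_synonym 'a vfield = "'a \<Rightarrow> 'a tvec"
type_synonym 'a metric_field = "'a \<Rightarrow> 'a tvec \<Rightarrow> 'a tvec \<Rightarrow> real"
type_synonym 'a connection = "'a vfield \<Rightarrow> 'a vfield \<Rightarrow> 'a vfield"

definition tangent_space :: "('a, 'k) manifold \<Rightarrow> 'a \<Rightarrow> 'a tvec set" where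
  "tangent_space M p = {v.
     (\<forall>f. \<not> smooth_at M p f \<longrightarrow> v f = 0) \<and>
     (\<forall>f h. smooth_at M p f \<and> smooth_at M p h \<and>
        (\<exists>U. openin (mtop M) U \<and> p \<in> U \<and> (\<forall>q\<in>U. f q = h q)) \<longrightarrow> v f = v h) \<and>
     (\<forall>f h a c. smooth_at M p f \<and> smooth_at M p h \<longrightarrow>
        v (\<lambda>q. a * f q + c * h q) = a * v f + c * v h) \<and>
     (\<forall>f h. smooth_at M p f \<and> smooth_at M p h \<longrightarrow>
        v (\<lambda>q. f q * h q) = v f * h p + f p * v h)}"

text \<open>
  The smooth vector fields on an open set \<open>U\<close>, as total functions with arbitrary values off \<open>U\<close>.
\<close>

definition vector_fields :: "('a, 'k) manifold \<Rightarrow> 'a set \<Rightarrow> 'a vfield set" where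
  "vector_fields M U = {X.
     (\<forall>p\<in>U. X p \<in> tangent_space M p) \<and>
     (\<forall>V f. openin (mtop M) V \<and> V \<subseteq> U \<and> smooth_fun M V f \<longrightarrow> smooth_fun M V (\<lambda>p. X p f))}"

definition vf_add :: "'a vfield \<Rightarrow> 'a vfield \<Rightarrow> 'a vfield" where
  "vf_add X Y = (\<lambda>p f. X p f + Y p f)"

definition vf_scale :: "('a \<Rightarrow> real) \<Rightarrow> 'a vfield \<Rightarrow> 'a vfield" where
  "vf_scale h X = (\<lambda>p f. h p * X p f)"

definition lie_bracket :: "('a, 'k) manifold \<Rightarrow> 'a vfield \<Rightarrow> 'a vfield \<Rightarrow> 'a vfield" where
  "lie_bracket M X Y = (\<lambda>p f. if smooth_at M p f
     then X p (\<lambda>q. Y q f) - Y p (\<lambda>q. X q f) else 0)"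

section \<open>Pseudo-Riemannian metrics and connections\<close>

definition pseudo_riemannian :: "('a, 'k) manifold \<Rightarrow> 'a metric_field \<Rightarrow> bool" where
  "pseudo_riemannian M g \<longleftrightarrow> smooth_manifold M \<and>
     (\<forall>p\<in>topspace (mtop M).
        (\<forall>u\<in>tangent_space M p. \<forall>v\<in>tangent_space M p. g p u v = g p v u) \<and>
        (\<forall>u\<in>tangent_space M p. \<forall>v\<in>tangent_space M p. \<forall>w\<in>tangent_space M p. \<forall>a c.
           g p (\<lambda>f. a * u f + c * v f) w = a * g p u w + c * g p v w) \<and>
        (\<forall>u\<in>tangent_space M p. (\<forall>v\<in>tangent_space M p. g p u v = 0) \<longrightarrow> u = (\<lambda>f. 0))) \<and>
     (\<forall>U. openin (mtop M) U \<longrightarrow>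
        (\<forall>X\<in>vector_fields M U. \<forall>Y\<in>vector_fields M U. smooth_fun M U (\<lambda>p. g p (X p) (Y p))))"

text \<open>
  A connection acts on vector fields over arbitrary open sets, compatibly with restriction (first
  conjunct), so that it can be applied to local frames.  Nothing is said about the values of \<open>D X Y\<close>
  at points near which \<open>X\<close> or \<open>Y\<close> is not smooth.
\<close>

definition affine_connection :: "('a, 'k) manifold \<Rightarrow> 'a connection \<Rightarrow> bool" where
  "affine_connection M D \<longleftrightarrow> (\<forall>U. openin (mtop M) U \<longrightarrow>
     (\<forall>X\<in>vector_fields M U. \<forall>Y\<in>vector_fields M U.
      \<forall>X'\<in>vector_fields M U. \<forall>Y'\<in>vector_fields M U.
        (\<forall>p\<in>U. X p = X' p \<and> Y p = Y' p) \<longrightarrow> (\<forall>p\<in>U. D X Y p = D X' Y' p)) \<and>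
     (\<forall>X\<in>vector_fields M U. \<forall>Y\<in>vector_fields M U. D X Y \<in> vector_fields M U) \<and>
     (\<forall>X\<in>vector_fields M U. \<forall>Y\<in>vector_fields M U. \<forall>Z\<in>vector_fields M U. \<forall>p\<in>U. \<forall>f.
        D (vf_add X Y) Z p f = D X Z p f + D Y Z p f \<and>
        D X (vf_add Y Z) p f = D X Y p f + D X Z p f) \<and>
     (\<forall>h. \<forall>X\<in>vector_fields M U. \<forall>Y\<in>vector_fields M U. smooth_fun M U h \<longrightarrow> (\<forall>p\<in>U. \<forall>f.
        D (vf_scale h X) Y p f = h p * D X Y p f \<and>
        D X (vf_scale h Y) p f = X p h * Y p f + h p * D X Y p f)))"

definition levi_civita :: "('a, 'k) manifold \<Rightarrow> 'a metric_field \<Rightarrow> 'a connection \<Rightarrow> bool" where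
  "levi_civita M g D \<longleftrightarrow> affine_connection M D \<and> (\<forall>U. openin (mtop M) U \<longrightarrow>
     (\<forall>X\<in>vector_fields M U. \<forall>Y\<in>vector_fields M U. \<forall>p\<in>U. \<forall>f.
        D X Y p f - D Y X p f = lie_bracket M X Y p f) \<and>
     (\<forall>X\<in>vector_fields M U. \<forall>Y\<in>vector_fields M U. \<forall>Z\<in>vector_fields M U. \<forall>p\<in>U.
        X p (\<lambda>q. g q (Y q) (Z q)) = g p (D X Y p) (Z p) + g p (Y p) (D X Z p)))"

definition quarter_symmetric ::
    "'a metric_field \<Rightarrow> 'a connection \<Rightarrow> 'a vfield \<Rightarrow> real \<Rightarrow> real \<Rightarrow> 'a connection" where
  "quarter_symmetric g D P l1 l2 X Y =
     (\<lambda>p f. D X Y p f + l1 * g p (Y p) (P p) * X p f - l2 * g p (X p) (Y p) * P p f)"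

section \<open>Curvature\<close>

definition curvature ::
    "('a, 'k) manifold \<Rightarrow> 'a connection \<Rightarrow> 'a vfield \<Rightarrow> 'a vfield \<Rightarrow> 'a vfield \<Rightarrow> 'a vfield" where
  "curvature M D X Y Z =
     (\<lambda>p f. D X (D Y Z) p f - D Y (D X Z) p f - D (lie_bracket M X Y) Z p f)"

text \<open>
  Frames are indexed by the coordinate index set, so they have exactly \<open>dim M\<close> members; being
  orthonormal they are then pointwise bases.
\<close>

definition orthonormal_frame ::
    "('a, 'k) manifold \<Rightarrow> 'a metric_field \<Rightarrow> 'a set \<Rightarrow> ('k \<Rightarrow> 'a vfield) \<Rightarrow> bool" where
  "orthonormal_frame M g U E \<longleftrightarrow> (\<forall>k\<in>mindex M. E k \<in> vector_fields M U) \<and>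
     (\<exists>\<epsilon>. (\<forall>k\<in>mindex M. \<epsilon> k = 1 \<or> \<epsilon> k = - 1) \<and>
        (\<forall>p\<in>U. \<forall>k\<in>mindex M. \<forall>l\<in>mindex M.
           g p (E k p) (E l p) = (if k = l then \<epsilon> k else 0)))"

text \<open>
  Some local orthonormal frame around \<open>p\<close>; the traces below do not depend on the choice.
\<close>

definition frame_around ::
    "('a, 'k) manifold \<Rightarrow> 'a metric_field \<Rightarrow> 'a \<Rightarrow> 'k \<Rightarrow> 'a vfield" where
  "frame_around M g p =
     (SOME E. \<exists>U. openin (mtop M) U \<and> p \<in> U \<and> orthonormal_frame M g U E)"

definition ricci ::
    "('a, 'k) manifold \<Rightarrow> 'a metric_field \<Rightarrow> 'a connection \<Rightarrow> 'a vfield \<Rightarrow> 'a vfield \<Rightarrow> 'a \<Rightarrow> real" where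
  "ricci M g D X Y p = (let E = frame_around M g p in
     \<Sum>k\<in>mindex M. g p (E k p) (E k p) * g p (curvature M D X (E k) Y p) (E k p))"

definition scalar_curvature ::
    "('a, 'k) manifold \<Rightarrow> 'a metric_field \<Rightarrow> 'a connection \<Rightarrow> 'a \<Rightarrow> real" where
  "scalar_curvature M g D p = (let E = frame_around M g p in
     \<Sum>k\<in>mindex M. g p (E k p) (E k p) * ricci M g D (E k) (E k) p)"

definition constant_scalar_curvature ::
    "('a, 'k) manifold \<Rightarrow> 'a metric_field \<Rightarrow> 'a connection \<Rightarrow> bool" where
  "constant_scalar_curvature M g D \<longleftrightarrow>
     (\<exists>c. \<forall>p\<in>topspace (mtop M). scalar_curvature M g D p = c)"

section \<open>Multiply warped products\<close>

text \<open>
  Points of \<open>I \<times> F 1 \<times> \<dots> \<times> F m\<close> are pairs \<open>(t, x)\<close> with \<open>x\<close> in the dependent product of the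
  factors over \<open>{1..m}\<close>.  The coordinate index \<open>None\<close> belongs to \<open>t\<close>, and \<open>Some (i, k)\<close> to the
  \<open>k\<close>-th coordinate of the factor \<open>F i\<close>.
\<close>

definition product_manifold ::
    "real set \<Rightarrow> nat \<Rightarrow> (nat \<Rightarrow> ('a, 'k) manifold) \<Rightarrow> (real \<times> (nat \<Rightarrow> 'a), (nat \<times> 'k) option) manifold" where
  "product_manifold I m F = \<lparr>
     mtop = prod_topology (top_of_set I) (product_topology (\<lambda>i. mtop (F i)) {1..m}),
     mindex = insert None (Some ` (SIGMA i:{1..m}. mindex (F i))),
     matlas = {(I \<times> (\<Pi>\<^sub>E i\<in>{1..m}. U i),
                \<lambda>(t, x). \<lambda>j\<in>insert None (Some ` (SIGMA i:{1..m}. mindex (F i))).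
                   case j of None \<Rightarrow> t | Some (i, k) \<Rightarrow> \<phi> i (x i) k)
               | U \<phi>. \<forall>i\<in>{1..m}. (U i, \<phi> i) \<in> matlas (F i)}\<rparr>"

text \<open>The differential at \<open>p\<close> of a map \<open>\<pi>\<close> into \<open>N\<close>.\<close>

definition pushforward ::
    "('b, 'l) manifold \<Rightarrow> ('a \<Rightarrow> 'b) \<Rightarrow> 'a \<Rightarrow> 'a tvec \<Rightarrow> 'b tvec" where
  "pushforward N \<pi> p v = (\<lambda>f. if smooth_at N (\<pi> p) f then v (\<lambda>q. f (\<pi> q)) else 0)"

text \<open>\<open>u fst\<close> is the derivative of the coordinate function \<open>t\<close> along \<open>u\<close>, that is, \<open>dt(u)\<close>.\<close>

definition warped_metric ::
    "nat \<Rightarrow> (nat \<Rightarrow> ('a, 'k) manifold) \<Rightarrow> (nat \<Rightarrow> 'a metric_field) \<Rightarrow> (nat \<Rightarrow> real \<Rightarrow> real) \<Rightarrow>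
     (real \<times> (nat \<Rightarrow> 'a)) metric_field" where
  "warped_metric m F gF b p u v =
     - (u fst * v fst) +
     (\<Sum>i=1..m. (b i (fst p))\<^sup>2 *
        gF i (snd p i) (pushforward (F i) (\<lambda>q. snd q i) p u) (pushforward (F i) (\<lambda>q. snd q i) p v))"

definition d_dt ::
    "real set \<Rightarrow> nat \<Rightarrow> (nat \<Rightarrow> ('a, 'k) manifold) \<Rightarrow> (real \<times> (nat \<Rightarrow> 'a)) vfield" where
  "d_dt I m F = (\<lambda>p f. if smooth_at (product_manifold I m F) p f
     then deriv (\<lambda>s. f (s, snd p)) (fst p) else 0)"

definition smooth_on_interval :: "real set \<Rightarrow> (real \<Rightarrow> real) \<Rightarrow> bool" where
  "smooth_on_interval I h \<longleftrightarrow> (\<forall>n. \<forall>t\<in>I. (deriv ^^ n) h differentiable (at t))"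

end

theory Submission
  imports Defs "HOL-Library.Function_Algebras"
begin

text \<open>
  Around any point, lift local orthonormal frames \<open>e\<^sub>i\<^sub>k\<close> of the factors to the product and add
  \<open>T = \<partial>/\<partial>t\<close>.  This frame is orthogonal, \<open>T\<close> commutes with the lifts, lifts from different factors
  commute with each other, and Koszul's formula gives, with \<open>H\<^sub>i = b\<^sub>i'/b\<^sub>i\<close>, the quarter-symmetric connection
  \<open>\<nabla>\<^sub>T T = (\<lambda>\<^sub>2 - \<lambda>\<^sub>1) T\<close>, \<open>\<nabla>\<^sub>T X = H\<^sub>i X\<close>, \<open>\<nabla>\<^sub>X T = (H\<^sub>i - \<lambda>\<^sub>1) X\<close> and
  \<open>\<nabla>\<^sub>X Y = \<nabla>\<^sup>F\<^sub>X Y + (H\<^sub>i - \<lambda>\<^sub>2) g(X, Y) T\<close> for lifts \<open>X\<close>, \<open>Y\<close> from the \<open>i\<close>-th factor.  Taking the double trace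
  of the curvature yields \<open>S(t, x) = \<Phi>(t) + (\<Sum>i. S\<^sub>i(x\<^sub>i) / b\<^sub>i(t)\<^sup>2)\<close>.  If \<open>S\<close> is constant, freezing \<open>t\<close> and all
  \<open>x\<^sub>j\<close> with \<open>j \<noteq> i\<close> shows that \<open>S\<^sub>i\<close> is constant.

  Tangent vectors being derivations, everything rests on Hadamard's lemma: a tangent vector is determined by its
  values on coordinate functions.  For the product this means that it is determined by \<open>dt\<close> and by its push-forwards
  to the factors, which also computes Lie brackets without Schwarz's theorem.
\<close>

section \<open>Calculus of \<open>C\<^sup>\<infinity>\<close> functions in coordinates\<close>

text \<open>The scalar curvature is a double trace over a frame picked by \<open>SOME\<close>, of
  which only orthonormality on some open set is known. Before any computation the trace has to be
  moved to a chosen frame. This needs the curvature to be linear over functions in all three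
  arguments for an arbitrary affine connection: the quarter-symmetric one is in general neither
  torsion-free nor metric, so the symmetries of the Riemann tensor cannot be called upon. The chosen
  frame stays orthogonal instead of orthonormal because dividing the lifts by \<open>b i\<close>
  would spoil their commuting with \<partial>/\<partial>t. Its squares become weights of the trace,
  and this is where the factor 1/b_i^2 in front of S_i comes from: the coefficients of the
  connection along one factor are those of the factor itself. The frames of the factors are built by
  Gram-Schmidt in an indefinite metric, which forces a search for non-null vectors. Coordinate space
  is a set of functions with the product topology and no norm, so differentiability means partial
  derivatives, and the chain rule is built from the mean value theorem in one variable.\<close>

lemma continuous_on_coord: "continuous_on S (\<lambda>x. x k :: real)"
  by (rule continuous_on_product_then_coordinatewise) (rule continuous_on_id)

text \<open>Members of the product space over \<open>K\<close> are all \<open>undefined\<close> off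
  \<open>K\<close>, so the remaining coordinates are constant and continuity into the full function
  space is automatic there. The identification makes \<open>continuous_on\<close> and limits
  \<open>at x within S\<close> applicable to sets of coordinate vectors.\<close>

lemma powertop_real_eq: "powertop_real K = top_of_set (Pi\<^sub>E K (\<lambda>_. UNIV))"
proof -
  let ?S = "Pi\<^sub>E K (\<lambda>_. UNIV) :: ('a \<Rightarrow> real) set"
  have 1: "continuous_map (powertop_real K) (top_of_set ?S) id"
  proof -
    have "continuous_map (powertop_real K) (powertop_real UNIV) id"
      unfolding continuous_map_componentwise_UNIV
    proof
      fix k
      show "continuous_map (powertop_real K) euclideanreal (\<lambda>x. id x k)"
      proof (cases "k \<in> K")
        case True then show ?thesis by (auto intro: continuous_map_product_projection)
      next
        case False
        then have "continuous_map (powertop_real K) euclideanreal (\<lambda>x. undefined)" by simp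
        then show ?thesis
          by (rule continuous_map_eq) (use False in \<open>auto simp: PiE_def extensional_def\<close>)
      qed
    qed
    then show ?thesis
      by (auto simp: euclidean_product_topology continuous_map_in_subtopology)
  qed
  have 2: "continuous_map (top_of_set ?S) (powertop_real K) id"
  proof (rule continuous_map_componentwise[THEN iffD2], intro conjI ballI)
    show "id ` topspace (top_of_set ?S) \<subseteq> extensional K" by (auto simp: PiE_def)
    show "continuous_map (top_of_set ?S) euclideanreal (\<lambda>x. id x k)" for k
      unfolding id_apply continuous_map_iff_continuous by (rule continuous_on_coord)
  qed
  show ?thesis
  proof (rule topology_eq[THEN iffD2], intro allI iffI)
    fix U
    assume U: "openin (powertop_real K) U"
    then have "openin (top_of_set ?S) {x \<in> topspace (top_of_set ?S). id x \<in> U}"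
      using openin_continuous_map_preimage[OF 2 U] by simp
    moreover have "{x \<in> topspace (top_of_set ?S). id x \<in> U} = U"
      using openin_subset[OF U] by auto
    ultimately show "openin (top_of_set ?S) U" by simp
  next
    fix U
    assume U: "openin (top_of_set ?S) U"
    then have "openin (powertop_real K) {x \<in> topspace (powertop_real K). id x \<in> U}"
      using openin_continuous_map_preimage[OF 1 U] by simp
    moreover have "{x \<in> topspace (powertop_real K). id x \<in> U} = U"
      using openin_subset[OF U] by auto
    ultimately show "openin (powertop_real K) U" by simp
  qed
qed

lemma openin_powertop_subset: "openin (powertop_real K) V \<Longrightarrow> V \<subseteq> Pi\<^sub>E K (\<lambda>_. UNIV)"
  using openin_subset[of "powertop_real K" V] by simp

lemma continuous_map_powertop_iff:
  assumes "openin (powertop_real K) V"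
  shows "continuous_map (subtopology (powertop_real K) V) euclidean f \<longleftrightarrow> continuous_on V f"
proof -
  have "Pi\<^sub>E K (\<lambda>_. UNIV) \<inter> V = V" using openin_powertop_subset[OF assms] by auto
  then show ?thesis
    by (simp add: powertop_real_eq subtopology_subtopology)
qed

section \<open>Neighbourhoods and partial derivatives in coordinate space\<close>

declare C_diff.simps [simp del]

lemma C_diff_0: "openin (powertop_real K) V \<Longrightarrow> C_diff K 0 V f \<longleftrightarrow> continuous_on V f"
  by (simp add: continuous_map_powertop_iff C_diff.simps)

lemma C_diff_Suc:
  "openin (powertop_real K) V \<Longrightarrow> C_diff K (Suc r) V f \<longleftrightarrow> continuous_on V f \<and>
     (\<forall>k\<in>K. (\<forall>x\<in>V. (\<lambda>s. f (x(k := s))) differentiable (at (x k))) \<and> C_diff K r V (partial_deriv k f))"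
  by (simp add: continuous_map_powertop_iff C_diff.simps)

text \<open>Cubes form a neighbourhood basis that is stable under changing one coordinate within its
  interval and under contraction towards the centre. The chain rule relies on the first property,
  Hadamard's lemma on both.\<close>

definition coord_box :: "'k set \<Rightarrow> ('k \<Rightarrow> real) \<Rightarrow> real \<Rightarrow> ('k \<Rightarrow> real) set" where
  "coord_box K x e = Pi\<^sub>E K (\<lambda>k. ball (x k) e)"

lemma coord_box_iff: "y \<in> coord_box K x e \<longleftrightarrow> y \<in> Pi\<^sub>E K (\<lambda>_. UNIV) \<and> (\<forall>k\<in>K. \<bar>y k - x k\<bar> < e)"
  by (auto simp: coord_box_def PiE_def Pi_def dist_real_def)

lemma openin_coord_box: "finite K \<Longrightarrow> openin (powertop_real K) (coord_box K x e)"
  unfolding coord_box_def by (subst openin_PiE) auto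

lemma coord_box_subset:
  assumes "finite K" "openin (powertop_real K) V" "x \<in> V"
  obtains e where "e > 0" "coord_box K x e \<subseteq> V"
proof -
  obtain U where U: "\<forall>i\<in>K. openin euclideanreal (U i)" "x \<in> Pi\<^sub>E K U" "Pi\<^sub>E K U \<subseteq> V"
    using assms(2,3) unfolding openin_product_topology_alt by meson
  have "\<exists>d>0. \<forall>y. \<bar>y - x k\<bar> < d \<longrightarrow> y \<in> U k" if "k \<in> K" for k
    using U(1,2) that by (auto simp: open_dist dist_real_def PiE_def Pi_def)
  then obtain d where d: "\<And>k. k \<in> K \<Longrightarrow> d k > 0 \<and> (\<forall>y. \<bar>y - x k\<bar> < d k \<longrightarrow> y \<in> U k)"
    by metis
  \<comment> \<open>The extra 1 covers an empty \<open>K\<close>, the coordinate index set of a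
    manifold of dimension 0.\<close>
  define e where "e = Min (insert 1 (d ` K))"
  have "e > 0" unfolding e_def using assms(1) d by auto
  moreover have "e \<le> d k" if "k \<in> K" for k unfolding e_def using assms(1) that by auto
  then have "coord_box K x e \<subseteq> V"
    using d U(3) unfolding coord_box_iff by (fastforce simp: coord_box_iff PiE_def Pi_def)
  ultimately show ?thesis using that by blast
qed

text \<open>A coordinate line stays in the open set \<open>V\<close> near its base point, so partial
  derivatives at points of \<open>V\<close> depend only on the values on \<open>V\<close>. The
  congruence rules for \<open>partial_deriv\<close> and \<open>C_diff\<close> come from
  this.\<close>

lemma coord_line:
  assumes "finite K" "openin (powertop_real K) V" "x \<in> V" "k \<in> K"
  shows "eventually (\<lambda>s. x(k := s) \<in> V) (nhds (x k))"
proof -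
  obtain e where e: "e > 0" "coord_box K x e \<subseteq> V" using coord_box_subset[OF assms(1-3)] .
  have x: "x \<in> Pi\<^sub>E K (\<lambda>_. UNIV)" using openin_powertop_subset assms(2,3) by blast
  have "x(k := s) \<in> V" if "dist s (x k) < e" for s
    using e that x assms(4) by (intro subsetD[OF e(2)]) (auto simp: coord_box_iff PiE_def extensional_def dist_real_def)
  then show ?thesis using e(1) unfolding eventually_nhds_metric by blast
qed

lemma partial_deriv_cong:
  assumes "finite K" "openin (powertop_real K) V" "x \<in> V" "k \<in> K" "\<And>y. y \<in> V \<Longrightarrow> f y = g y"
  shows "partial_deriv k f x = partial_deriv k g x"
  unfolding partial_deriv_def
  by (rule deriv_cong_ev) (use coord_line[OF assms(1-4)] assms(5) in \<open>auto elim: eventually_mono\<close>)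

lemma partial_differentiable_cong:
  fixes f g :: "('k \<Rightarrow> real) \<Rightarrow> real"
  assumes "finite K" "openin (powertop_real K) V" "x \<in> V" "k \<in> K" "\<And>y. y \<in> V \<Longrightarrow> f y = g y"
    and "(\<lambda>s. f (x(k := s))) differentiable (at (x k))"
  shows "(\<lambda>s. g (x(k := s))) differentiable (at (x k))"
proof -
  have ev: "eventually (\<lambda>s. f (x(k := s)) = g (x(k := s))) (nhds (x k))"
    using coord_line[OF assms(1-4)] assms(5) by (auto elim: eventually_mono)
  obtain D where "((\<lambda>s. f (x(k := s))) has_real_derivative D) (at (x k))"
    using assms(6) by (auto simp: real_differentiable_def)
  then have "((\<lambda>s. g (x(k := s))) has_real_derivative D) (at (x k))"
    using DERIV_cong_ev[OF refl ev refl] by auto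
  then show ?thesis by (auto simp: real_differentiable_def)
qed

section \<open>Locality and algebra of C^r functions\<close>

lemma C_diff_cong:
  assumes "finite K" "openin (powertop_real K) V" "\<And>x. x \<in> V \<Longrightarrow> f x = g x" "C_diff K r V f"
  shows "C_diff K r V g"
  using assms(3,4)
proof (induction r arbitrary: f g)
  case 0
  then show ?case using assms(2) continuous_on_cong[of V V f g] by (simp only: C_diff_0)
next
  case (Suc r)
  note f = Suc.prems(2)[unfolded C_diff_Suc[OF assms(2)]]
  have "C_diff K r V (partial_deriv k g)" if k: "k \<in> K" for k
  proof (rule Suc.IH)
    show "partial_deriv k f x = partial_deriv k g x" if "x \<in> V" for x
      by (rule partial_deriv_cong[OF assms(1,2) that k Suc.prems(1)])
    show "C_diff K r V (partial_deriv k f)" using f k by blast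
  qed
  moreover have "(\<lambda>s. g (x(k := s))) differentiable (at (x k))" if "k \<in> K" "x \<in> V" for k x
    using f that by (intro partial_differentiable_cong[OF assms(1,2) that(2,1) Suc.prems(1)]) blast+
  moreover have "continuous_on V g"
    using f continuous_on_cong[of V V f g] Suc.prems(1) by blast
  ultimately show ?case unfolding C_diff_Suc[OF assms(2)] by blast
qed

lemma C_diff_continuous: "openin (powertop_real K) V \<Longrightarrow> C_diff K r V f \<Longrightarrow> continuous_on V f"
  by (cases r) (auto simp: C_diff_0 C_diff_Suc)

text \<open>\<open>C_diff\<close> speaks of \<open>partial_deriv\<close>, hence of
  \<open>deriv\<close>. An explicit derivative formula \<open>f'\<close> agrees with it on
  \<open>V\<close>, so the inductions for products, powers and composites can work with
  formulas.\<close>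

lemma C_diff_SucI:
  assumes "finite K" "openin (powertop_real K) V" "continuous_on V f"
    "\<And>k x. k \<in> K \<Longrightarrow> x \<in> V \<Longrightarrow> ((\<lambda>s. f (x(k := s))) has_real_derivative f' k x) (at (x k))"
    "\<And>k. k \<in> K \<Longrightarrow> C_diff K r V (f' k)"
  shows "C_diff K (Suc r) V f"
proof -
  have "C_diff K r V (partial_deriv k f)" if "k \<in> K" for k
  proof (rule C_diff_cong[OF assms(1,2) _ assms(5)[OF that]])
    fix x assume "x \<in> V"
    then show "f' k x = partial_deriv k f x"
      unfolding partial_deriv_def by (metis DERIV_imp_deriv assms(4) that)
  qed
  then show ?thesis
    using assms(3,4) unfolding C_diff_Suc[OF assms(2)] real_differentiable_def by blast
qed

lemma C_diff_SucD:
  assumes "C_diff K (Suc r) V f" "k \<in> K"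
  shows "C_diff K r V (partial_deriv k f)"
    and "x \<in> V \<Longrightarrow> ((\<lambda>s. f (x(k := s))) has_real_derivative partial_deriv k f x) (at (x k))"
  using assms by (auto simp: C_diff.simps partial_deriv_def DERIV_deriv_iff_real_differentiable)

lemma C_diff_decr: "C_diff K (Suc r) V f \<Longrightarrow> C_diff K r V f"
proof (induction r arbitrary: f)
  case (Suc r)
  then show ?case unfolding C_diff.simps(2)[of K "Suc r"] C_diff.simps(2)[of K r] by blast
qed (simp add: C_diff.simps)

lemma C_diff_subset:
  assumes "openin (powertop_real K) V" "openin (powertop_real K) W" "W \<subseteq> V" "C_diff K r V f"
  shows "C_diff K r W f"
  using assms(4)
proof (induction r arbitrary: f)
  case 0
  then show ?case using assms(1-3) by (auto simp only: C_diff_0 intro: continuous_on_subset)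
next
  case (Suc r)
  then show ?case using assms(1-3)
    by (auto simp: C_diff_Suc intro: continuous_on_subset)
qed

lemma C_diff_local:
  assumes "openin (powertop_real K) V"
    and "\<And>x. x \<in> V \<Longrightarrow> \<exists>W. openin (powertop_real K) W \<and> x \<in> W \<and> W \<subseteq> V \<and> C_diff K r W f"
  shows "C_diff K r V f"
proof -
  have cont: "continuous_on V f"
    if *: "\<And>x. x \<in> V \<Longrightarrow> \<exists>W. openin (powertop_real K) W \<and> x \<in> W \<and> W \<subseteq> V \<and> continuous_on W f" for f :: "('a \<Rightarrow> real) \<Rightarrow> real"
    unfolding continuous_on_def
  proof
    fix x assume "x \<in> V"
    then obtain W where W: "openin (powertop_real K) W" "x \<in> W" "W \<subseteq> V" "continuous_on W f"
      using * by blast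
    \<comment> \<open>Open sets of the coordinate space are traces of open sets of the full function
      space, so limits within \<open>W\<close> and within \<open>V\<close> agree at
      \<open>x\<close>.\<close>
    obtain T where T: "open T" "W = Pi\<^sub>E K (\<lambda>_. UNIV) \<inter> T"
      using W(1) unfolding powertop_real_eq openin_open by blast
    have "(f \<longlongrightarrow> f x) (at x within W)" using W by (simp add: continuous_on_def)
    moreover have "at x within W = at x within V"
      by (rule at_within_nhd[of x T]) (use T W openin_powertop_subset[OF assms(1)] in auto)
    ultimately show "(f \<longlongrightarrow> f x) (at x within V)" by simp
  qed
  show ?thesis using assms(2)
  proof (induction r arbitrary: f)
    case 0
    then show ?case using cont[of f] assms(1) by (metis C_diff_0)
  next
    case (Suc r)
    have ex: "\<exists>W. openin (powertop_real K) W \<and> x \<in> W \<and> W \<subseteq> V \<and> continuous_on W f \<and>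
        (\<forall>k\<in>K. (\<lambda>s. f (x(k := s))) differentiable (at (x k)) \<and> C_diff K r W (partial_deriv k f))"
      if x: "x \<in> V" for x
    proof -
      obtain W where W: "openin (powertop_real K) W" "x \<in> W" "W \<subseteq> V" "C_diff K (Suc r) W f"
        using Suc.prems[OF x] by blast
      from W(4) show ?thesis unfolding C_diff_Suc[OF W(1)] using W(1-3) by blast
    qed
    have "continuous_on V f" by (rule cont) (use ex in blast)
    moreover have "C_diff K r V (partial_deriv k f)" if "k \<in> K" for k
      by (rule Suc.IH) (use ex that in blast)
    moreover have "(\<lambda>s. f (x(k := s))) differentiable (at (x k))" if "x \<in> V" "k \<in> K" for x k
      using ex[OF that(1)] that(2) by blast
    ultimately show ?case unfolding C_diff_Suc[OF assms(1)] by blast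
  qed
qed

lemma C_diff_const: "finite K \<Longrightarrow> openin (powertop_real K) V \<Longrightarrow> C_diff K r V (\<lambda>x. c)"
proof (induction r arbitrary: c)
  case 0 then show ?case by (simp only: C_diff_0) simp
next
  case (Suc r) then show ?case by (intro C_diff_SucI[where f' = "\<lambda>k x. 0"]) auto
qed

lemma C_diff_coord:
  assumes "finite K" "openin (powertop_real K) V"
  shows "C_diff K r V (\<lambda>x. x k)"
proof (cases r)
  case 0 then show ?thesis
    by (simp only: C_diff_0[OF assms(2)] continuous_on_coord)
next
  case (Suc r)
  have "((\<lambda>s. (x(j := s)) k) has_real_derivative (if j = k then 1 else 0)) (at (x j))" for j and x :: "'a \<Rightarrow> real"
    by (auto intro!: derivative_eq_intros)
  then have "C_diff K (Suc r) V (\<lambda>x. x k)"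
    by (intro C_diff_SucI[OF assms, where f' = "\<lambda>j x. if j = k then 1 else 0"])
       (auto intro!: C_diff_const assms continuous_on_coord simp del: fun_upd_apply)
  then show ?thesis using Suc by simp
qed

lemma C_diff_add:
  assumes "finite K" "openin (powertop_real K) V" "C_diff K r V f" "C_diff K r V g"
  shows "C_diff K r V (\<lambda>x. f x + g x)"
  using assms(3,4)
proof (induction r arbitrary: f g)
  case 0 then show ?case using assms(2) by (auto simp only: C_diff_0 intro!: continuous_intros)
next
  case (Suc r)
  show ?case
  proof (rule C_diff_SucI[OF assms(1,2), where f' = "\<lambda>k x. partial_deriv k f x + partial_deriv k g x"])
    show "continuous_on V (\<lambda>x. f x + g x)"
      using Suc.prems C_diff_continuous[OF assms(2)] by (blast intro: continuous_on_add)
    show "((\<lambda>s. f (x(k := s)) + g (x(k := s))) has_real_derivative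
        partial_deriv k f x + partial_deriv k g x) (at (x k))" if "k \<in> K" "x \<in> V" for k x
      by (rule DERIV_add[OF C_diff_SucD(2)[OF Suc.prems(1) that] C_diff_SucD(2)[OF Suc.prems(2) that]])
    show "C_diff K r V (\<lambda>x. partial_deriv k f x + partial_deriv k g x)" if "k \<in> K" for k
      using Suc.prems that by (intro Suc.IH C_diff_SucD)
  qed
qed

lemma C_diff_mult:
  assumes "finite K" "openin (powertop_real K) V" "C_diff K r V f" "C_diff K r V g"
  shows "C_diff K r V (\<lambda>x. f x * g x)"
  using assms(3,4)
proof (induction r arbitrary: f g)
  case 0 then show ?case using assms(2) by (auto simp only: C_diff_0 intro!: continuous_intros)
next
  case (Suc r)
  show ?case
  proof (rule C_diff_SucI[OF assms(1,2), where f' = "\<lambda>k x. partial_deriv k f x * g x + partial_deriv k g x * f x"])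
    show "continuous_on V (\<lambda>x. f x * g x)"
      using Suc.prems C_diff_continuous[OF assms(2)] by (blast intro: continuous_on_mult)
    show "((\<lambda>s. f (x(k := s)) * g (x(k := s))) has_real_derivative
        partial_deriv k f x * g x + partial_deriv k g x * f x) (at (x k))" if "k \<in> K" "x \<in> V" for k x
      using DERIV_mult[OF C_diff_SucD(2)[OF Suc.prems(1) that] C_diff_SucD(2)[OF Suc.prems(2) that]] by (simp add: fun_upd_def)
    show "C_diff K r V (\<lambda>x. partial_deriv k f x * g x + partial_deriv k g x * f x)" if "k \<in> K" for k
      by (intro C_diff_add assms Suc.IH C_diff_SucD(1)[OF _ that] C_diff_decr[OF Suc.prems(1)]
          C_diff_decr[OF Suc.prems(2)] Suc.prems)
  qed
qed

lemma C_diff_sum: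
  assumes "finite K" "openin (powertop_real K) V" "\<And>l. l \<in> L \<Longrightarrow> C_diff K r V (f l)"
  shows "C_diff K r V (\<lambda>x. \<Sum>l\<in>L. f l x)"
  using assms(3)
proof (induction L rule: infinite_finite_induct)
  case (insert l L)
  then show ?case using C_diff_add[OF assms(1,2), of r "f l" "\<lambda>x. \<Sum>l\<in>L. f l x"] by simp
qed (auto intro: C_diff_const assms(1,2))

text \<open>The exponent varies in the induction because differentiation lowers it by one. The
  exponents used later are -1, for reciprocals, and -1/2, for normalising frame fields.\<close>

lemma C_diff_powr:
  assumes "finite K" "openin (powertop_real K) V" "C_diff K r V f" "\<And>x. x \<in> V \<Longrightarrow> f x > 0"
  shows "C_diff K r V (\<lambda>x. f x powr a)"
  using assms(3)
proof (induction r arbitrary: a)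
  case 0
  then have "continuous_on V f" using C_diff_0[OF assms(2)] by blast
  then have "continuous_on V (\<lambda>x. f x powr a)"
    using assms(4) by (intro continuous_on_powr continuous_on_const) force+
  then show ?case using C_diff_0[OF assms(2)] by blast
next
  case (Suc r)
  show ?case
  proof (rule C_diff_SucI[OF assms(1,2), where f' = "\<lambda>k x. a * (f x powr (a - 1) * partial_deriv k f x)"])
    show "continuous_on V (\<lambda>x. f x powr a)"
      using Suc.prems C_diff_continuous[OF assms(2)] assms(4)
      by (intro continuous_on_powr continuous_on_const) force+
    show "((\<lambda>s. f (x(k := s)) powr a) has_real_derivative
        a * (f x powr (a - 1) * partial_deriv k f x)) (at (x k))" if "k \<in> K" "x \<in> V" for k x
      using DERIV_fun_powr[OF C_diff_SucD(2)[OF Suc.prems that], of a] assms(4)[OF that(2)]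
      by (simp add: algebra_simps fun_upd_def)
    show "C_diff K r V (\<lambda>x. a * (f x powr (a - 1) * partial_deriv k f x))" if "k \<in> K" for k
      by (intro C_diff_mult C_diff_const assms(1,2) Suc.IH C_diff_SucD(1)[OF Suc.prems that]
          C_diff_decr[OF Suc.prems])
  qed
qed

text \<open>The condition on all iterates \<open>(deriv ^^ n) u\<close> is the form of smoothness in
  \<open>smooth_on_interval\<close>, and it passes from \<open>u\<close> to \<open>deriv u\<close>,
  to which the induction hypothesis is applied.\<close>

lemma C_diff_compose_real:
  assumes "finite K" "openin (powertop_real K) V" "C_diff K r V f"
    and "\<And>n x. x \<in> V \<Longrightarrow> (deriv ^^ n) u differentiable (at (f x))"
  shows "C_diff K r V (\<lambda>x. u (f x))"
  using assms(3,4)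
proof (induction r arbitrary: u)
  case 0
  have "isCont u (f x)" if "x \<in> V" for x
    using 0(2)[OF that, of 0] by (simp add: differentiable_imp_continuous_within)
  then have "continuous_on (f ` V) u" by (auto intro: continuous_at_imp_continuous_on)
  then show ?case
    using 0(1) C_diff_0[OF assms(2)] continuous_on_compose2[of "f ` V" u V f] by blast
next
  case (Suc r)
  have u: "(deriv ^^ n) (deriv u) differentiable (at (f x))" if "x \<in> V" for n x
    using Suc.prems(2)[OF that, of "Suc n"] by (simp add: funpow_swap1)
  have du: "(u has_real_derivative deriv u (f x)) (at (f x))" if "x \<in> V" for x
    using Suc.prems(2)[OF that, of 0] by (simp add: DERIV_deriv_iff_real_differentiable)
  show ?case
  proof (rule C_diff_SucI[OF assms(1,2), where f' = "\<lambda>k x. deriv u (f x) * partial_deriv k f x"])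
    have "continuous_on (f ` V) u"
      using du by (auto intro!: continuous_at_imp_continuous_on DERIV_isCont)
    then show "continuous_on V (\<lambda>x. u (f x))"
      using Suc.prems(1) C_diff_continuous[OF assms(2)] continuous_on_compose2[of "f ` V" u V f] by blast
    show "((\<lambda>s. u (f (x(k := s)))) has_real_derivative
        deriv u (f x) * partial_deriv k f x) (at (x k))" if "k \<in> K" "x \<in> V" for k x
      using DERIV_chain2[OF _ C_diff_SucD(2)[OF Suc.prems(1) that], of u "deriv u (f x)"] du[OF that(2)] by (simp add: fun_upd_def)
    show "C_diff K r V (\<lambda>x. deriv u (f x) * partial_deriv k f x)" if "k \<in> K" for k
      by (rule C_diff_mult[OF assms(1,2) Suc.IH[OF C_diff_decr[OF Suc.prems(1)] u]
            C_diff_SucD(1)[OF Suc.prems(1) that]])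
  qed
qed

section \<open>The chain rule in several coordinates\<close>

lemma C_diff_near:
  assumes "finite K" "openin (powertop_real K) V" "continuous_on V h" "y \<in> V" "e > 0"
  obtains d where "d > 0" "coord_box K y d \<subseteq> V" "\<And>x. x \<in> coord_box K y d \<Longrightarrow> \<bar>h x - h y\<bar> < (e::real)"
proof -
  have "openin (top_of_set V) (V \<inter> h -` ball (h y) e)"
    by (rule continuous_openin_preimage_gen[OF assms(3)]) simp
  then have "openin (powertop_real K) (V \<inter> h -` ball (h y) e)"
    using assms(2) unfolding powertop_real_eq by (rule openin_trans)
  then obtain d where "d > 0" "coord_box K y d \<subseteq> V \<inter> h -` ball (h y) e"
    using coord_box_subset[OF assms(1), of "V \<inter> h -` ball (h y) e" y] assms(4,5) by auto
  then show ?thesis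
    by (intro that[of d]) (auto simp: dist_real_def subset_iff abs_minus_commute)
qed

text \<open>Freed from an order between \<open>u\<close> and \<open>v\<close>, since a coordinate of
  a curve may move to either side of its base value or stay there.\<close>

lemma mvt_segment:
  assumes "\<And>s. s \<in> closed_segment u v \<Longrightarrow> (g has_real_derivative g' s) (at s)"
  shows "\<exists>z\<in>closed_segment u v. g v - g u = (v - u) * g' z"
proof (cases u v rule: linorder_cases)
  case less
  then show ?thesis using MVT2[of u v g g'] assms by (force simp: closed_segment_eq_real_ivl)
next
  case equal then show ?thesis by auto
next
  case greater
  then obtain z where "z > v" "z < u" "g u - g v = (u - v) * g' z"
    using MVT2[of v u g g'] assms by (auto simp: closed_segment_eq_real_ivl)
  then have "z \<in> closed_segment u v \<and> g v - g u = (v - u) * g' z"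
    using greater by (auto simp: closed_segment_eq_real_ivl algebra_simps)
  then show ?thesis by blast
qed

text \<open>The coordinates in \<open>A\<close> are released one at a time, with the mean value theorem applied to each.\<close>

lemma C_diff_chain_curve:
  fixes c :: "real \<Rightarrow> 'l \<Rightarrow> real"
  assumes L: "finite L" "openin (powertop_real L) W" "C_diff L (Suc 0) W f" "y \<in> W"
    and c: "\<And>s. c s \<in> Pi\<^sub>E L (\<lambda>_. UNIV)" "c s0 = y"
    and d: "\<And>l. l \<in> L \<Longrightarrow> ((\<lambda>s. c s l) has_real_derivative d l) (at s0)"
  shows "((\<lambda>s. f (c s)) has_real_derivative (\<Sum>l\<in>L. partial_deriv l f y * d l)) (at s0)"
proof -
  have "((\<lambda>s. f (c s)) has_real_derivative (\<Sum>l\<in>A. partial_deriv l f y * d l)) (at s0)"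
    if "finite A" "A \<subseteq> L" "\<And>s. c s \<in> Pi\<^sub>E L (\<lambda>_. UNIV)" "c s0 = y"
      "\<And>l. l \<in> L \<Longrightarrow> ((\<lambda>s. c s l) has_real_derivative d l) (at s0) \<or> l \<notin> A"
      "\<And>l s. l \<in> L - A \<Longrightarrow> c s l = y l"
    for A and c :: "real \<Rightarrow> 'l \<Rightarrow> real"
    using that
  proof (induction A arbitrary: c rule: finite_induct)
    case empty
    have "c s = y" for s
      using empty(2)[of s] empty(2)[of s0] empty(3,5)
      by (intro PiE_ext[of _ L "\<lambda>_. UNIV"]) auto
    then show ?case by simp
  next
    case (insert a A)
    have aL: "a \<in> L" using insert.prems by blast
    define c' where "c' s = (c s)(a := y a)" for s
    have c'L: "c' s \<in> Pi\<^sub>E L (\<lambda>_. UNIV)" for s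
      using insert.prems(2)[of s] aL by (auto simp: c'_def PiE_def extensional_def)
    have 1: "((\<lambda>s. f (c' s)) has_real_derivative (\<Sum>l\<in>A. partial_deriv l f y * d l)) (at s0)"
    proof (rule insert.IH)
      show "((\<lambda>s. c' s l) has_real_derivative d l) (at s0) \<or> l \<notin> A" if "l \<in> L" for l
        using insert.prems(4)[OF that] insert.hyps(2) by (cases "l = a") (auto simp: c'_def)
      show "c' s \<in> Pi\<^sub>E L (\<lambda>_. UNIV)" for s by (rule c'L)
      show "c' s l = y l" if "l \<in> L - A" for l s
        using insert.prems(5)[of l s] that by (auto simp: c'_def)
      show "A \<subseteq> L" using insert.prems(1) by blast
      show "c' s0 = y" using insert.prems(3) by (auto simp: c'_def)
    qed
    have da: "((\<lambda>s. c s a) has_real_derivative d a) (at s0)" using insert.prems(4)[OF aL] by auto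
    have cont: "((\<lambda>s. c s l) \<longlongrightarrow> y l) (at s0)" if "l \<in> L" for l
    proof (cases "l \<in> insert a A")
      case True
      then have "isCont (\<lambda>s. c s l) s0"
        using insert.prems(4)[OF that] DERIV_isCont by blast
      then show ?thesis using insert.prems(3) by (simp add: isCont_def)
    next
      case False
      then show ?thesis using insert.prems(5)[of l] that by auto
    qed
    have cbox: "eventually (\<lambda>s. c s \<in> coord_box L y e) (at s0)" if "e > 0" for e
    proof -
      have "eventually (\<lambda>s. \<forall>l\<in>L. \<bar>c s l - y l\<bar> < e) (at s0)"
        unfolding eventually_ball_finite_distrib[OF L(1)]
        using tendstoD[OF cont that] by (simp add: dist_real_def)
      then show ?thesis
        by eventually_elim (use insert.prems(2) in \<open>auto simp: coord_box_iff\<close>)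
    qed
    obtain e0 where e0: "e0 > 0" "coord_box L y e0 \<subseteq> W" using coord_box_subset[OF L(1,2,4)] .
    have upd: "(c s)(a := u) \<in> coord_box L y e"
      if "c s \<in> coord_box L y e" "u \<in> closed_segment (y a) (c s a)" for s u e
    proof -
      have "\<bar>u - y a\<bar> \<le> \<bar>c s a - y a\<bar>" using that(2) by (auto simp: closed_segment_eq_real_ivl split: if_splits)
      then show ?thesis using that(1) aL
        by (auto simp: coord_box_iff PiE_def extensional_def intro: le_less_trans)
    qed
    \<comment> \<open>An implication for every \<open>s\<close>, so that one function
      \<open>z\<close> of intermediate points can be chosen although the mean value theorem applies
      only while the curve is inside the cube.\<close>
    have "\<exists>z. c s \<in> coord_box L y e0 \<longrightarrow> z \<in> closed_segment (y a) (c s a) \<and>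
        f (c s) - f (c' s) = (c s a - y a) * partial_deriv a f ((c s)(a := z))" for s
    proof (cases "c s \<in> coord_box L y e0")
      case True
      have "((\<lambda>u. f ((c s)(a := u))) has_real_derivative partial_deriv a f ((c s)(a := u))) (at u)"
        if "u \<in> closed_segment (y a) (c s a)" for u
        using C_diff_SucD(2)[OF L(3) aL, of "(c s)(a := u)"] upd[OF True that] e0(2) by auto
      from mvt_segment[of "y a" "c s a", OF this] show ?thesis by (auto simp: c'_def)
    qed auto
    then obtain z where z: "\<And>s. c s \<in> coord_box L y e0 \<Longrightarrow> z s \<in> closed_segment (y a) (c s a) \<and>
        f (c s) - f (c' s) = (c s a - y a) * partial_deriv a f ((c s)(a := z s))" by metis
    have lim: "((\<lambda>s. partial_deriv a f ((c s)(a := z s))) \<longlongrightarrow> partial_deriv a f y) (at s0)"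
    proof (rule tendstoI)
      fix e :: real assume "e > 0"
      have "continuous_on W (partial_deriv a f)"
        using C_diff_SucD(1)[OF L(3) aL] C_diff_0[OF L(2)] by blast
      then obtain d where d: "d > 0" "\<And>x. x \<in> coord_box L y d \<Longrightarrow> \<bar>partial_deriv a f x - partial_deriv a f y\<bar> < e"
        using C_diff_near[OF L(1,2) _ L(4) \<open>e > 0\<close>] by blast
      show "eventually (\<lambda>s. dist (partial_deriv a f ((c s)(a := z s))) (partial_deriv a f y) < e) (at s0)"
        using cbox[OF e0(1)] cbox[OF d(1)]
        by eventually_elim (use d(2) upd z in \<open>auto simp: dist_real_def\<close>)
    qed
    \<comment> \<open>The difference quotient is that of the released coordinate times the partial
      derivative at an intermediate point, which converges by continuity of the partial derivative.
      Both curves pass through \<open>y\<close> at \<open>s0\<close>, so the increment there is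
      0.\<close>
    have 2: "((\<lambda>s. f (c s) - f (c' s)) has_real_derivative d a * partial_deriv a f y) (at s0)"
    proof -
      have "((\<lambda>s. (c s a - y a) / (s - s0)) \<longlongrightarrow> d a) (at s0)"
        using da insert.prems(3) by (simp add: has_field_derivative_iff)
      then have "((\<lambda>s. ((c s a - y a) / (s - s0)) * partial_deriv a f ((c s)(a := z s))) \<longlongrightarrow> d a * partial_deriv a f y) (at s0)"
        using lim by (rule tendsto_mult)
      moreover have "eventually (\<lambda>s. ((c s a - y a) / (s - s0)) * partial_deriv a f ((c s)(a := z s)) =
          (f (c s) - f (c' s) - (f (c s0) - f (c' s0))) / (s - s0)) (at s0)"
        using cbox[OF e0(1)]
        by eventually_elim (use z insert.prems(3) in \<open>auto simp: c'_def\<close>)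
      ultimately show ?thesis
        unfolding has_field_derivative_iff by (rule Lim_transform_eventually)
    qed
    from DERIV_add[OF 1 2] insert.hyps show ?case by (simp add: algebra_simps)
  qed
  from this[of L c] show ?thesis using L(1) c d by auto
qed

lemma continuous_on_restrict_coord:
  assumes "\<And>l. l \<in> L \<Longrightarrow> continuous_on V (G l)"
  shows "continuous_on V (\<lambda>x. \<lambda>l\<in>L. (G l x :: real))"
proof (rule continuous_on_coordinatewise_then_product)
  fix l show "continuous_on V (\<lambda>x. (\<lambda>l\<in>L. G l x) l)"
    by (cases "l \<in> L") (use assms in auto)
qed

text \<open>By the chain rule each partial derivative is a sum of products of a partial derivative
  of some \<open>G l\<close> with a composite of the same shape, formed with a partial derivative of
  \<open>f\<close>; the induction on \<open>r\<close> therefore varies \<open>f\<close>. Restricting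
  the inner functions to \<open>L\<close> makes them a point of coordinate space.\<close>

lemma C_diff_compose:
  assumes K: "finite K" "openin (powertop_real K) V" and L: "finite L" "openin (powertop_real L) W"
    and G: "\<And>l. l \<in> L \<Longrightarrow> C_diff K r V (G l)" "\<And>x. x \<in> V \<Longrightarrow> (\<lambda>l\<in>L. G l x) \<in> W"
    and f: "C_diff L r W f"
  shows "C_diff K r V (\<lambda>x. f (\<lambda>l\<in>L. G l x))"
  using G(1) f
proof (induction r arbitrary: f)
  case 0
  have "continuous_on V (\<lambda>x. \<lambda>l\<in>L. G l x)"
    using 0 C_diff_0[OF K(2)] by (intro continuous_on_restrict_coord) blast
  moreover have "continuous_on W f" using 0 C_diff_0[OF L(2)] by blast
  ultimately have "continuous_on V (\<lambda>x. f (\<lambda>l\<in>L. G l x))"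
    using G(2) by (intro continuous_on_compose2[of W f V]) auto
  then show ?case using C_diff_0[OF K(2)] by blast
next
  case (Suc r)
  have f1: "C_diff L (Suc 0) W f"
    using Suc.prems(2)
  proof (induction r)
    case (Suc r) then show ?case using C_diff_decr by blast
  qed auto
  show ?case
  proof (rule C_diff_SucI[OF K, where f' = "\<lambda>k x. \<Sum>l\<in>L. partial_deriv l f (\<lambda>l\<in>L. G l x) * partial_deriv k (G l) x"])
    have "continuous_on V (\<lambda>x. \<lambda>l\<in>L. G l x)"
      using Suc.prems C_diff_continuous[OF K(2)] by (intro continuous_on_restrict_coord) blast
    moreover have "continuous_on W f" using Suc.prems C_diff_continuous[OF L(2)] by blast
    ultimately show "continuous_on V (\<lambda>x. f (\<lambda>l\<in>L. G l x))"
      using G(2) by (intro continuous_on_compose2[of W f V]) auto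
  next
    fix k x assume kx: "k \<in> K" "x \<in> V"
    show "((\<lambda>s. f (\<lambda>l\<in>L. G l (x(k := s)))) has_real_derivative
        (\<Sum>l\<in>L. partial_deriv l f (\<lambda>l\<in>L. G l x) * partial_deriv k (G l) x)) (at (x k))"
    proof (rule C_diff_chain_curve[OF L f1 G(2)[OF kx(2)]])
      show "((\<lambda>s. (\<lambda>l\<in>L. G l (x(k := s))) l) has_real_derivative partial_deriv k (G l) x) (at (x k))"
        if "l \<in> L" for l
        using C_diff_SucD(2)[OF Suc.prems(1)[OF that] kx] that by (simp add: fun_upd_def)
    qed auto
  next
    fix k assume k: "k \<in> K"
    have "C_diff K r V (\<lambda>x. partial_deriv l f (\<lambda>l\<in>L. G l x))" if "l \<in> L" for l
      by (rule Suc.IH[OF C_diff_decr[OF Suc.prems(1)] C_diff_SucD(1)[OF Suc.prems(2) that]])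
    then show "C_diff K r V (\<lambda>x. \<Sum>l\<in>L. partial_deriv l f (\<lambda>l\<in>L. G l x) * partial_deriv k (G l) x)"
      by (intro C_diff_sum C_diff_mult K C_diff_SucD(1)[OF Suc.prems(1) k])
  qed
qed

section \<open>Hadamard's lemma by integration along the segments \<open>shrink\<close>\<close>

definition shrink :: "'k set \<Rightarrow> ('k \<Rightarrow> real) \<Rightarrow> ('k \<Rightarrow> real) \<Rightarrow> real \<Rightarrow> 'k \<Rightarrow> real" where
  "shrink K a x t = (\<lambda>k\<in>K. a k + t * (x k - a k))"

lemma shrink_in_box:
  assumes "x \<in> coord_box K a e" "t \<in> {0..1}"
  shows "shrink K a x t \<in> coord_box K a e"
proof -
  have "\<bar>t * (x k - a k)\<bar> < e" if "k \<in> K" for k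
  proof -
    have "\<bar>t * (x k - a k)\<bar> \<le> 1 * \<bar>x k - a k\<bar>"
      unfolding abs_mult using assms(2) by (intro mult_right_mono) auto
    then show ?thesis using assms(1) that by (force simp: coord_box_iff)
  qed
  then show ?thesis by (auto simp: coord_box_iff shrink_def)
qed

lemma continuous_on_shrink: "continuous_on S (\<lambda>(x, t). shrink K a x t)"
  unfolding shrink_def split_beta
  by (intro continuous_on_restrict_coord continuous_intros
      continuous_on_product_then_coordinatewise)

text \<open>
  Differentiating under the integral sign raises the weight \<open>t ^ n\<close> by one, hence the general \<open>n\<close>; only \<open>n = 0\<close>
  is used in Hadamard's lemma.
\<close>

lemma C_diff_shrink_integral:
  assumes "finite K" and F: "C_diff K r (coord_box K a e) F"
  shows "C_diff K r (coord_box K a e) (\<lambda>x. integral {0..1} (\<lambda>t. t ^ n * F (shrink K a x t)))"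
  using F
proof (induction r arbitrary: n F)
  let ?B = "coord_box K a e"
  note B = openin_coord_box[OF assms(1), of a e]
  have c: "continuous_on (?B \<times> cbox 0 1) (\<lambda>(x, t). t ^ n * F (shrink K a x t))"
    if "continuous_on ?B F" for n F
  proof -
    have "continuous_on (?B \<times> cbox 0 1) (\<lambda>q. F ((\<lambda>(x, t). shrink K a x t) q))"
      by (rule continuous_on_compose2[OF that continuous_on_shrink]) (auto intro: shrink_in_box)
    then show ?thesis by (auto simp: split_beta intro!: continuous_intros)
  qed
  have ci: "continuous_on ?B (\<lambda>x. integral {0..1} (\<lambda>t. t ^ n * F (shrink K a x t)))"
    if "continuous_on ?B F" for n F
    using integral_continuous_on_param[OF c[OF that]] by simp
  {
    case 0
    then show ?case using ci C_diff_0[OF B] by blast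
  next
    case (Suc r)
    show ?case
    proof (rule C_diff_SucI[OF assms(1) B, where
          f' = "\<lambda>k x. integral {0..1} (\<lambda>t. t ^ Suc n * partial_deriv k F (shrink K a x t))"])
      show "continuous_on ?B (\<lambda>x. integral {0..1} (\<lambda>t. t ^ n * F (shrink K a x t)))"
        using Suc.prems C_diff_continuous[OF B] by (intro ci) blast
      show "C_diff K r ?B (\<lambda>x. integral {0..1} (\<lambda>t. t ^ Suc n * partial_deriv k F (shrink K a x t)))"
        if "k \<in> K" for k
        using Suc.prems that by (intro Suc.IH C_diff_SucD)
    next
      fix k x assume k: "k \<in> K" and x: "x \<in> ?B"
      let ?U = "ball (a k) e"
      have upd: "x(k := s) \<in> ?B" if "s \<in> ?U" for s
        using x k that by (auto simp: coord_box_iff dist_real_def PiE_def extensional_def)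
      have xk: "x k \<in> ?U" using x k by (auto simp: coord_box_iff dist_real_def)
      \<comment> \<open>Moving coordinate \<open>k\<close> of \<open>x\<close> moves only coordinate
        \<open>k\<close> of the contracted point, and at rate \<open>t\<close>; the integrand
        becomes a function of one real parameter.\<close>
      have shr: "shrink K a (x(k := s)) t = (shrink K a x t)(k := a k + t * (s - a k))" for s t
        using k by (auto simp: shrink_def fun_eq_iff)
      have contF: "continuous_on ?B F" using Suc.prems C_diff_continuous[OF B] by blast
      have contF': "continuous_on ?B (partial_deriv k F)"
        using C_diff_SucD(1)[OF Suc.prems k] C_diff_continuous[OF B] by blast
      have cu: "continuous_on (?U \<times> cbox 0 1) (\<lambda>(s, t). t ^ n * H (shrink K a (x(k := s)) t))"
        if "continuous_on ?B H" for n H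
      proof -
        have "continuous_on (?U \<times> cbox 0 1) (\<lambda>q. (\<lambda>(x, t). t ^ n * H (shrink K a x t)) (x(k := fst q), snd q))"
        proof (rule continuous_on_compose2[OF c[OF that]])
          have "continuous_on (?U \<times> cbox 0 1) (\<lambda>q. x(k := fst q))"
          proof (rule continuous_on_coordinatewise_then_product)
            fix i show "continuous_on (?U \<times> cbox 0 1) (\<lambda>q. (x(k := fst q)) i)"
              by (cases "i = k") (auto intro!: continuous_intros)
          qed
          then show "continuous_on (?U \<times> cbox 0 1) (\<lambda>q. (x(k := fst q), snd q))"
            by (rule continuous_on_Pair) (intro continuous_intros)
        qed (use upd in auto)
        then show ?thesis by (simp add: split_beta)
      qed
      have "((\<lambda>s. integral (cbox 0 1) (\<lambda>t. t ^ n * F (shrink K a (x(k := s)) t))) has_field_derivative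
          integral (cbox 0 1) (\<lambda>t. t ^ Suc n * partial_deriv k F (shrink K a (x(k := x k)) t))) (at (x k) within ?U)"
      proof (rule leibniz_rule_field_derivative[OF _ _ _ xk convex_ball])
        fix s t :: real assume s: "s \<in> ?U" and t: "t \<in> cbox 0 1"
        have "shrink K a (x(k := s)) t \<in> ?B" using upd[OF s] t by (auto intro: shrink_in_box)
        from C_diff_SucD(2)[OF Suc.prems k this]
        have "((\<lambda>u. F ((shrink K a x t)(k := u))) has_real_derivative partial_deriv k F (shrink K a (x(k := s)) t))
            (at (a k + t * (s - a k)))" unfolding shr fun_upd_upd fun_upd_same .
        moreover have "((\<lambda>s. a k + t * (s - a k)) has_real_derivative t) (at s within ?U)"
          by (auto intro!: derivative_eq_intros)
        ultimately have "((\<lambda>s. F ((shrink K a x t)(k := a k + t * (s - a k)))) has_real_derivative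
            partial_deriv k F (shrink K a (x(k := s)) t) * t) (at s within ?U)"
          by (rule DERIV_chain2)
        then have "((\<lambda>s. F (shrink K a (x(k := s)) t)) has_real_derivative
            partial_deriv k F (shrink K a (x(k := s)) t) * t) (at s within ?U)"
          by (simp only: shr)
        from DERIV_cmult[OF this, of "t ^ n"]
        show "((\<lambda>s. t ^ n * F (shrink K a (x(k := s)) t)) has_real_derivative
            t ^ Suc n * partial_deriv k F (shrink K a (x(k := s)) t)) (at s within ?U)"
          by (simp add: algebra_simps)
      next
        fix s assume s: "s \<in> ?U"
        have "continuous_on (cbox 0 1) (\<lambda>t. (\<lambda>(s, t). t ^ n * F (shrink K a (x(k := s)) t)) (s, t))"
          by (rule continuous_on_compose2[OF cu[OF contF]]) (auto intro!: continuous_intros s)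
        then show "(\<lambda>t. t ^ n * F (shrink K a (x(k := s)) t)) integrable_on cbox 0 1"
          by (intro integrable_continuous) simp
      qed (rule cu[OF contF'])
      then show "((\<lambda>s. integral {0..1} (\<lambda>t. t ^ n * F (shrink K a (x(k := s)) t))) has_real_derivative
          integral {0..1} (\<lambda>t. t ^ Suc n * partial_deriv k F (shrink K a x t))) (at (x k))"
        using at_within_open[OF xk open_ball] by simp
    qed
  }
qed

text \<open>Take h_k(x) to be the integral over [0, 1] of the k-th partial derivative of f at a + t
  (x - a). The fundamental theorem of calculus along the segment from \<open>a\<close> to
  \<open>x\<close> gives the expansion, and differentiation under the integral sign makes h_k smooth
  on the same cube.\<close>

lemma C_infinity_Hadamard:
  assumes "finite K" "a \<in> Pi\<^sub>E K (\<lambda>_. UNIV)" "e > 0" "C_infinity K (coord_box K a e) f"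
  obtains h where "\<And>k. k \<in> K \<Longrightarrow> C_infinity K (coord_box K a e) (h k)"
    "\<And>k. k \<in> K \<Longrightarrow> h k a = partial_deriv k f a"
    "\<And>x. x \<in> coord_box K a e \<Longrightarrow> f x = f a + (\<Sum>k\<in>K. (x k - a k) * h k x)"
proof
  let ?B = "coord_box K a e"
  note B = openin_coord_box[OF assms(1), of a e]
  let ?h = "\<lambda>k x. integral {0..1} (\<lambda>t. partial_deriv k f (shrink K a x t))"
  have f: "C_diff K r ?B f" for r using assms(4) by (simp add: C_infinity_def)
  have aB: "a \<in> ?B" using assms(2,3) by (auto simp: coord_box_iff)
  show "C_infinity K ?B (?h k)" if "k \<in> K" for k
    unfolding C_infinity_def
    using C_diff_shrink_integral[OF assms(1) C_diff_SucD(1)[OF f that], of _ 0] by simp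
  \<comment> \<open>At the centre the segment is a single point, so the integral over the unit
    interval is the value of the integrand.\<close>
  have "shrink K a a t = a" for t
    using assms(2) by (auto simp: shrink_def fun_eq_iff PiE_def extensional_def)
  then show "?h k a = partial_deriv k f a" if "k \<in> K" for k by simp
  fix x assume x: "x \<in> ?B"
  have xP: "x \<in> Pi\<^sub>E K (\<lambda>_. UNIV)" using x by (simp add: coord_box_iff)
  have int: "(\<lambda>t. partial_deriv k f (shrink K a x t)) integrable_on {0..1}" if "k \<in> K" for k
  proof (rule integrable_continuous_real)
    have f': "continuous_on ?B (partial_deriv k f)"
      using C_diff_SucD(1)[OF f that] C_diff_continuous[OF B] by blast
    have "continuous_on {0..1} (\<lambda>t. (\<lambda>(x, t). shrink K a x t) (x, t))"
      by (rule continuous_on_compose2[OF continuous_on_shrink[of UNIV]]) (auto intro!: continuous_intros)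
    then have sh: "continuous_on {0..1} (\<lambda>t. shrink K a x t)" by simp
    show "continuous_on {0..1} (\<lambda>t. partial_deriv k f (shrink K a x t))"
      by (rule continuous_on_compose2[OF f' sh]) (use x in \<open>auto intro: shrink_in_box\<close>)
  qed
  have "((\<lambda>t. \<Sum>k\<in>K. partial_deriv k f (shrink K a x t) * (x k - a k)) has_integral
      f (shrink K a x 1) - f (shrink K a x 0)) {0..1}"
  proof (rule fundamental_theorem_of_calculus)
    fix t :: real assume t: "t \<in> {0..1}"
    have "((\<lambda>t. f (shrink K a x t)) has_real_derivative
        (\<Sum>k\<in>K. partial_deriv k f (shrink K a x t) * (x k - a k))) (at t)"
    proof (rule C_diff_chain_curve[OF assms(1) B f shrink_in_box[OF x t]])
      show "((\<lambda>s. shrink K a x s l) has_real_derivative x l - a l) (at t)" if "l \<in> K" for l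
        using that by (auto simp: shrink_def intro!: derivative_eq_intros)
    qed (auto simp: shrink_def)
    then show "((\<lambda>t. f (shrink K a x t)) has_vector_derivative
        (\<Sum>k\<in>K. partial_deriv k f (shrink K a x t) * (x k - a k))) (at t within {0..1})"
      by (simp add: has_real_derivative_iff_has_vector_derivative has_vector_derivative_at_within)
  qed simp
  moreover have "shrink K a x 1 = x" "shrink K a x 0 = a"
    using assms(2) xP by (auto simp: shrink_def fun_eq_iff PiE_def extensional_def)
  ultimately have "f x - f a = integral {0..1} (\<lambda>t. \<Sum>k\<in>K. partial_deriv k f (shrink K a x t) * (x k - a k))"
    by (simp add: integral_unique)
  also have "\<dots> = (\<Sum>k\<in>K. integral {0..1} (\<lambda>t. partial_deriv k f (shrink K a x t) * (x k - a k)))"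
    using int by (intro integral_sum assms(1)) (auto intro!: integrable_on_mult_left)
  also have "\<dots> = (\<Sum>k\<in>K. (x k - a k) * ?h k x)"
    by (intro sum.cong) (auto simp: integral_mult_left mult.commute)
  finally show "f x = f a + (\<Sum>k\<in>K. (x k - a k) * ?h k x)" by simp
qed

section \<open>Smooth functions, tangent vectors and vector fields\<close>

lemma C_infinityD: "C_infinity K V f \<Longrightarrow> C_diff K r V f"
  by (simp add: C_infinity_def)

lemma C_infinity_cong:
  assumes "finite K" "openin (powertop_real K) V" "\<And>x. x \<in> V \<Longrightarrow> f x = g x" "C_infinity K V f"
  shows "C_infinity K V g"
  using C_diff_cong[OF assms(1-3)] assms(4) by (simp add: C_infinity_def)

lemma C_infinity_subset:
  assumes "openin (powertop_real K) V" "openin (powertop_real K) W" "W \<subseteq> V" "C_infinity K V f"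
  shows "C_infinity K W f"
  using C_diff_subset[OF assms(1-3)] assms(4) by (simp add: C_infinity_def)

lemma C_infinity_local:
  assumes "openin (powertop_real K) V"
    and "\<And>x. x \<in> V \<Longrightarrow> \<exists>W. openin (powertop_real K) W \<and> x \<in> W \<and> W \<subseteq> V \<and> C_infinity K W f"
  shows "C_infinity K V f"
  unfolding C_infinity_def
proof
  fix r show "C_diff K r V f"
  proof (rule C_diff_local[OF assms(1)])
    fix x assume "x \<in> V"
    from assms(2)[OF this] obtain W where
      "openin (powertop_real K) W" "x \<in> W" "W \<subseteq> V" "C_infinity K W f" by (elim exE conjE)
    then show "\<exists>W. openin (powertop_real K) W \<and> x \<in> W \<and> W \<subseteq> V \<and> C_diff K r W f"
      by (intro exI[of _ W] conjI C_infinityD)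
  qed
qed

lemma C_infinity_const: "finite K \<Longrightarrow> openin (powertop_real K) V \<Longrightarrow> C_infinity K V (\<lambda>x. c)"
  by (simp add: C_infinity_def C_diff_const)

lemma C_infinity_coord: "finite K \<Longrightarrow> openin (powertop_real K) V \<Longrightarrow> C_infinity K V (\<lambda>x. x k)"
  by (simp add: C_infinity_def C_diff_coord)

lemma C_infinity_add:
  "finite K \<Longrightarrow> openin (powertop_real K) V \<Longrightarrow> C_infinity K V f \<Longrightarrow> C_infinity K V g \<Longrightarrow>
   C_infinity K V (\<lambda>x. f x + g x)"
  by (simp add: C_infinity_def C_diff_add)

lemma C_infinity_mult:
  "finite K \<Longrightarrow> openin (powertop_real K) V \<Longrightarrow> C_infinity K V f \<Longrightarrow> C_infinity K V g \<Longrightarrow>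
   C_infinity K V (\<lambda>x. f x * g x)"
  by (simp add: C_infinity_def C_diff_mult)

lemma C_infinity_powr:
  "finite K \<Longrightarrow> openin (powertop_real K) V \<Longrightarrow> C_infinity K V f \<Longrightarrow> (\<And>x. x \<in> V \<Longrightarrow> f x > 0) \<Longrightarrow>
   C_infinity K V (\<lambda>x. f x powr a)"
  by (simp add: C_infinity_def C_diff_powr)

lemma C_infinity_compose_real:
  "finite K \<Longrightarrow> openin (powertop_real K) V \<Longrightarrow> C_infinity K V f \<Longrightarrow>
   (\<And>n x. x \<in> V \<Longrightarrow> (deriv ^^ n) u differentiable (at (f x))) \<Longrightarrow> C_infinity K V (\<lambda>x. u (f x))"
  by (simp add: C_infinity_def C_diff_compose_real)

lemma C_infinity_compose:
  assumes "finite K" "openin (powertop_real K) V" "finite L" "openin (powertop_real L) W"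
    and "\<And>l. l \<in> L \<Longrightarrow> C_infinity K V (G l)" "\<And>x. x \<in> V \<Longrightarrow> (\<lambda>l\<in>L. G l x) \<in> W"
    and "C_infinity L W f"
  shows "C_infinity K V (\<lambda>x. f (\<lambda>l\<in>L. G l x))"
  unfolding C_infinity_def
proof
  fix r show "C_diff K r V (\<lambda>x. f (\<lambda>l\<in>L. G l x))"
    by (rule C_diff_compose[OF assms(1-4) C_infinityD[OF assms(5)] assms(6) C_infinityD[OF assms(7)]])
qed

lemma C_infinity_partial_deriv: "C_infinity K V f \<Longrightarrow> k \<in> K \<Longrightarrow> C_infinity K V (partial_deriv k f)"
  by (simp add: C_infinity_def C_diff_SucD(1))

lemma C_infinity_has_partial_deriv:
  "C_infinity K V f \<Longrightarrow> k \<in> K \<Longrightarrow> x \<in> V \<Longrightarrow>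
   ((\<lambda>s. f (x(k := s))) has_real_derivative partial_deriv k f x) (at (x k))"
  by (rule C_diff_SucD(2)[OF C_infinityD])

lemma C_infinity_continuous: "openin (powertop_real K) V \<Longrightarrow> C_infinity K V f \<Longrightarrow> continuous_on V f"
  by (rule C_diff_continuous[OF _ C_infinityD])

text \<open>
  The Hausdorff and countability axioms of \<open>smooth_manifold\<close> are dropped: the argument is local, and so they need
  not be verified for the product.
\<close>

locale charted_space =
  fixes M :: "('a, 'k) manifold"
  assumes finite_index: "finite (mindex M)"
    and chart_open: "(U, \<phi>) \<in> matlas M \<Longrightarrow> openin (mtop M) U"
    and chart_image: "(U, \<phi>) \<in> matlas M \<Longrightarrow> openin (powertop_real (mindex M)) (\<phi> ` U)"
    and chart_homeo: "(U, \<phi>) \<in> matlas M \<Longrightarrow>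
      homeomorphic_map (subtopology (mtop M) U) (subtopology (powertop_real (mindex M)) (\<phi> ` U)) \<phi>"
    and charts_cover: "p \<in> topspace (mtop M) \<Longrightarrow> \<exists>U \<phi>. (U, \<phi>) \<in> matlas M \<and> p \<in> U"
    and chart_trans: "(U, \<phi>) \<in> matlas M \<Longrightarrow> (V, \<psi>) \<in> matlas M \<Longrightarrow> k \<in> mindex M \<Longrightarrow>
      C_infinity (mindex M) (\<phi> ` (U \<inter> V)) (\<lambda>x. \<psi> (inv_into U \<phi> x) k)"

lemma smooth_manifold_charted:
  assumes "smooth_manifold M"
  shows "charted_space M"
proof
  note M = assms[unfolded smooth_manifold_def]
  show "finite (mindex M)" using M by blast
  fix U \<phi> assume U: "(U, \<phi>) \<in> matlas M"
  show "openin (mtop M) U" "openin (powertop_real (mindex M)) (\<phi> ` U)"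
    "homeomorphic_map (subtopology (mtop M) U) (subtopology (powertop_real (mindex M)) (\<phi> ` U)) \<phi>"
    using M U by blast+
  show "C_infinity (mindex M) (\<phi> ` (U \<inter> V)) (\<lambda>x. \<psi> (inv_into U \<phi> x) k)"
    if "(V, \<psi>) \<in> matlas M" "k \<in> mindex M" for V \<psi> k
    using M U that by blast
next
  fix p assume "p \<in> topspace (mtop M)"
  moreover have "(\<Union>(U, \<phi>)\<in>matlas M. U) = topspace (mtop M)"
    using assms unfolding smooth_manifold_def by blast
  ultimately show "\<exists>U \<phi>. (U, \<phi>) \<in> matlas M \<and> p \<in> U" by blast
qed

definition vf_sum :: "'l set \<Rightarrow> ('l \<Rightarrow> 'a vfield) \<Rightarrow> 'a vfield" where
  "vf_sum L X = (\<lambda>p f. \<Sum>l\<in>L. X l p f)"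

text \<open>The coordinate field \<partial>/\<partial>x_k. The value 0 at functions that are not
  smooth near \<open>p\<close> is the convention imposed by \<open>tangent_space\<close>.\<close>

definition coord_vf :: "('a, 'k) manifold \<Rightarrow> 'a set \<Rightarrow> ('a \<Rightarrow> 'k \<Rightarrow> real) \<Rightarrow> 'k \<Rightarrow> 'a vfield" where
  "coord_vf M U \<phi> k = (\<lambda>p f. if smooth_at M p f
     then partial_deriv k (\<lambda>x. f (inv_into U \<phi> x)) (\<phi> p) else 0)"

section \<open>Charts and smooth functions\<close>

context charted_space
begin

lemma chart_inj: "(U, \<phi>) \<in> matlas M \<Longrightarrow> inj_on \<phi> U"
  using homeomorphic_imp_injective_map[OF chart_homeo] openin_subset[OF chart_open]
  by (metis topspace_subtopology_subset)

lemma chart_inv: "(U, \<phi>) \<in> matlas M \<Longrightarrow> p \<in> U \<Longrightarrow> inv_into U \<phi> (\<phi> p) = p"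
  using chart_inj by (rule inv_into_f_f)

lemma chart_image_open:
  assumes "(U, \<phi>) \<in> matlas M" "openin (mtop M) W" "W \<subseteq> U"
  shows "openin (powertop_real (mindex M)) (\<phi> ` W)"
proof -
  have "openin (subtopology (mtop M) U) W"
    using assms by (simp add: openin_open_subtopology chart_open)
  then have "openin (subtopology (powertop_real (mindex M)) (\<phi> ` U)) (\<phi> ` W)"
    using homeomorphic_imp_open_map[OF chart_homeo[OF assms(1)]] by (simp add: open_map_def)
  then show ?thesis using chart_image[OF assms(1)] by (simp add: openin_open_subtopology)
qed

lemma chart_preimage_open:
  assumes "(U, \<phi>) \<in> matlas M" "openin (powertop_real (mindex M)) B"
  shows "openin (mtop M) {p \<in> U. \<phi> p \<in> B}"
proof -
  have "continuous_map (subtopology (mtop M) U) (powertop_real (mindex M)) \<phi>"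
    using homeomorphic_imp_continuous_map[OF chart_homeo[OF assms(1)]]
    by (simp add: continuous_map_in_subtopology)
  from openin_continuous_map_preimage[OF this assms(2)]
  have "openin (subtopology (mtop M) U) {p \<in> topspace (subtopology (mtop M) U). \<phi> p \<in> B}" .
  moreover have "{p \<in> topspace (subtopology (mtop M) U). \<phi> p \<in> B} = {p \<in> U. \<phi> p \<in> B}"
    using openin_subset[OF chart_open[OF assms(1)]] by auto
  ultimately have "openin (subtopology (mtop M) U) {p \<in> U. \<phi> p \<in> B}" by simp
  then show ?thesis using chart_open[OF assms(1)] by (simp add: openin_open_subtopology)
qed

lemma openin_topspace_subset: "openin (mtop M) U \<Longrightarrow> p \<in> U \<Longrightarrow> p \<in> topspace (mtop M)"
  using openin_subset by blast

lemma smooth_funD: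
  "smooth_fun M W f \<Longrightarrow> (U, \<phi>) \<in> matlas M \<Longrightarrow> C_infinity (mindex M) (\<phi> ` (W \<inter> U)) (\<lambda>x. f (inv_into U \<phi> x))"
  unfolding smooth_fun_def by blast

lemma chart_inter_open:
  "(U, \<phi>) \<in> matlas M \<Longrightarrow> openin (mtop M) W \<Longrightarrow> openin (powertop_real (mindex M)) (\<phi> ` (W \<inter> U))"
  by (rule chart_image_open) (auto intro: openin_Int chart_open)

lemma smooth_funI:
  "(\<And>U \<phi>. (U, \<phi>) \<in> matlas M \<Longrightarrow> C_infinity (mindex M) (\<phi> ` (W \<inter> U)) (\<lambda>x. f (inv_into U \<phi> x))) \<Longrightarrow>
   smooth_fun M W f"
  unfolding smooth_fun_def by blast

lemma smooth_fun_subset: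
  assumes "openin (mtop M) U" "openin (mtop M) V" "V \<subseteq> U" "smooth_fun M U f"
  shows "smooth_fun M V f"
proof (rule smooth_funI)
  fix W \<phi> assume W: "(W, \<phi>) \<in> matlas M"
  show "C_infinity (mindex M) (\<phi> ` (V \<inter> W)) (\<lambda>x. f (inv_into W \<phi> x))"
    by (rule C_infinity_subset[OF chart_inter_open[OF W assms(1)] chart_inter_open[OF W assms(2)] _
          smooth_funD[OF assms(4) W]]) (use assms(3) in auto)
qed

lemma smooth_fun_cong:
  assumes "openin (mtop M) U" "\<And>p. p \<in> U \<Longrightarrow> f p = g p" "smooth_fun M U f"
  shows "smooth_fun M U g"
proof (rule smooth_funI)
  fix W \<phi> assume W: "(W, \<phi>) \<in> matlas M"
  show "C_infinity (mindex M) (\<phi> ` (U \<inter> W)) (\<lambda>x. g (inv_into W \<phi> x))"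
    by (rule C_infinity_cong[OF finite_index chart_inter_open[OF W assms(1)] _ smooth_funD[OF assms(3) W]])
       (use chart_inv[OF W] assms(2) in auto)
qed

lemma smooth_fun_local:
  assumes "openin (mtop M) U" "\<And>p. p \<in> U \<Longrightarrow> \<exists>W. openin (mtop M) W \<and> p \<in> W \<and> smooth_fun M W f"
  shows "smooth_fun M U f"
proof (rule smooth_funI)
  fix V \<phi> assume V: "(V, \<phi>) \<in> matlas M"
  show "C_infinity (mindex M) (\<phi> ` (U \<inter> V)) (\<lambda>x. f (inv_into V \<phi> x))"
  proof (rule C_infinity_local[OF chart_inter_open[OF V assms(1)]])
    fix x assume "x \<in> \<phi> ` (U \<inter> V)"
    then obtain p where p: "p \<in> U" "p \<in> V" "x = \<phi> p" by blast
    obtain W where W: "openin (mtop M) W" "p \<in> W" "smooth_fun M W f" using assms(2)[OF p(1)] by blast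
    have o: "openin (mtop M) (W \<inter> U)" using W(1) assms(1) by (rule openin_Int)
    have "smooth_fun M (W \<inter> U) f" by (rule smooth_fun_subset[OF W(1) o _ W(3)]) auto
    from smooth_funD[OF this V] chart_inter_open[OF V o] p W(2)
    show "\<exists>W. openin (powertop_real (mindex M)) W \<and> x \<in> W \<and> W \<subseteq> \<phi> ` (U \<inter> V) \<and>
        C_infinity (mindex M) W (\<lambda>x. f (inv_into V \<phi> x))"
      by (intro exI[of _ "\<phi> ` (W \<inter> U \<inter> V)"]) auto
  qed
qed

text \<open>\<open>smooth_fun\<close> asks for smoothness in every chart. One chart around
  \<open>W\<close> suffices, because any other representative is the given one composed with a
  smooth transition map.\<close>

lemma smooth_fun_chart:
  assumes U: "(U, \<phi>) \<in> matlas M" and W: "openin (mtop M) W" "W \<subseteq> U"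
    and f: "C_infinity (mindex M) (\<phi> ` W) (\<lambda>x. f (inv_into U \<phi> x))"
  shows "smooth_fun M W f"
proof (rule smooth_funI)
  fix V \<psi> assume V: "(V, \<psi>) \<in> matlas M"
  let ?K = "mindex M"
  have o: "openin (powertop_real ?K) (\<psi> ` (W \<inter> V))" by (rule chart_inter_open[OF V W(1)])
  \<comment> \<open>Chart values are extensional, so the restriction introduced by the composition
    rule leaves them unchanged.\<close>
  have eq: "(\<lambda>k\<in>?K. \<phi> q k) = \<phi> q" if "q \<in> U" for q
    using that openin_powertop_subset[OF chart_image[OF U]] by (intro extensional_restrict) (auto simp: PiE_def)
  have "C_infinity ?K (\<psi> ` (W \<inter> V)) (\<lambda>y. (\<lambda>x. f (inv_into U \<phi> x)) (\<lambda>k\<in>?K. \<phi> (inv_into V \<psi> y) k))"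
  proof (rule C_infinity_compose[OF finite_index o finite_index chart_image_open[OF U W]])
    show "C_infinity ?K (\<psi> ` (W \<inter> V)) (\<lambda>x. \<phi> (inv_into V \<psi> x) l)" if "l \<in> ?K" for l
      by (rule C_infinity_subset[OF _ o _ chart_trans[OF V U that]])
         (use W(2) chart_inter_open[OF V chart_open[OF U]] in \<open>auto simp: Int_commute\<close>)
    show "(\<lambda>l\<in>?K. \<phi> (inv_into V \<psi> x) l) \<in> \<phi> ` W" if "x \<in> \<psi> ` (W \<inter> V)" for x
      using that eq W(2) chart_inv[OF V] by auto
  qed (rule f)
  then show "C_infinity ?K (\<psi> ` (W \<inter> V)) (\<lambda>y. f (inv_into V \<psi> y))"
    by (rule C_infinity_cong[OF finite_index o, rotated]) (use eq W(2) chart_inv[OF V] chart_inv[OF U] in auto)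
qed

lemma smooth_fun_const: "openin (mtop M) U \<Longrightarrow> smooth_fun M U (\<lambda>p. c)"
  by (rule smooth_funI) (intro C_infinity_const finite_index chart_inter_open)

lemma smooth_fun_add:
  "openin (mtop M) U \<Longrightarrow> smooth_fun M U f \<Longrightarrow> smooth_fun M U g \<Longrightarrow> smooth_fun M U (\<lambda>p. f p + g p)"
  by (rule smooth_funI) (intro C_infinity_add finite_index chart_inter_open smooth_funD)

lemma smooth_fun_mult:
  "openin (mtop M) U \<Longrightarrow> smooth_fun M U f \<Longrightarrow> smooth_fun M U g \<Longrightarrow> smooth_fun M U (\<lambda>p. f p * g p)"
  by (rule smooth_funI) (intro C_infinity_mult finite_index chart_inter_open smooth_funD)

lemma smooth_fun_minus: "openin (mtop M) U \<Longrightarrow> smooth_fun M U f \<Longrightarrow> smooth_fun M U (\<lambda>p. - f p)"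
  using smooth_fun_mult[OF _ smooth_fun_const, of U f "- 1"] by simp

lemma smooth_fun_diff:
  "openin (mtop M) U \<Longrightarrow> smooth_fun M U f \<Longrightarrow> smooth_fun M U g \<Longrightarrow> smooth_fun M U (\<lambda>p. f p - g p)"
  using smooth_fun_add[OF _ _ smooth_fun_minus, of U f g] by simp

lemma smooth_fun_sum:
  "openin (mtop M) U \<Longrightarrow> (\<And>l. l \<in> L \<Longrightarrow> smooth_fun M U (f l)) \<Longrightarrow> smooth_fun M U (\<lambda>p. \<Sum>l\<in>L. f l p)"
proof (induction L rule: infinite_finite_induct)
  case (insert l L)
  then have "smooth_fun M U (\<lambda>p. f l p + (\<Sum>l\<in>L. f l p))" by (intro smooth_fun_add) auto
  then show ?case using insert.hyps by simp
qed (auto intro: smooth_fun_const)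

lemma smooth_fun_powr:
  "openin (mtop M) U \<Longrightarrow> smooth_fun M U f \<Longrightarrow> (\<And>p. p \<in> U \<Longrightarrow> f p > 0) \<Longrightarrow> smooth_fun M U (\<lambda>p. f p powr a)"
  by (rule smooth_funI, rule C_infinity_powr[OF finite_index chart_inter_open smooth_funD])
     (auto simp: chart_inv)

lemma smooth_fun_compose_real:
  "openin (mtop M) U \<Longrightarrow> smooth_fun M U f \<Longrightarrow> (\<And>n p. p \<in> U \<Longrightarrow> (deriv ^^ n) u differentiable (at (f p))) \<Longrightarrow>
   smooth_fun M U (\<lambda>p. u (f p))"
  by (rule smooth_funI, rule C_infinity_compose_real[OF finite_index chart_inter_open smooth_funD])
     (auto simp: chart_inv)

lemma smooth_fun_coord:
  assumes "(U, \<phi>) \<in> matlas M" "k \<in> mindex M"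
  shows "smooth_fun M U (\<lambda>q. \<phi> q k)"
  by (rule smooth_funI) (subst Int_commute, rule chart_trans[OF _ assms])

text \<open>Provides the neighbourhood on which the square of a frame field keeps its sign.
  Continuity of \<open>f\<close> is accessible only through charts, hence the preimages under
  \<open>\<phi>\<close>.\<close>

lemma smooth_fun_pos_open:
  assumes "openin (mtop M) U" "smooth_fun M U f"
  shows "openin (mtop M) {p \<in> U. f p > 0}"
proof (rule openin_subopen[THEN iffD2], rule ballI)
  fix p assume p: "p \<in> {p \<in> U. f p > 0}"
  then obtain V \<phi> where V: "(V, \<phi>) \<in> matlas M" "p \<in> V"
    using charts_cover openin_topspace_subset[OF assms(1)] by blast
  let ?W = "\<phi> ` (U \<inter> V)" and ?F = "\<lambda>x. f (inv_into V \<phi> x)"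
  have "continuous_on ?W ?F"
    using C_infinity_continuous[OF chart_inter_open[OF V(1) assms(1)] smooth_funD[OF assms(2) V(1)]] .
  then have "openin (top_of_set ?W) (?W \<inter> ?F -` {0<..})"
    by (rule continuous_openin_preimage_gen) simp
  then have "openin (powertop_real (mindex M)) (?W \<inter> ?F -` {0<..})"
    using chart_inter_open[OF V(1) assms(1)] unfolding powertop_real_eq by (rule openin_trans)
  from chart_preimage_open[OF V(1) this]
  have "openin (mtop M) {q \<in> V. \<phi> q \<in> ?W \<inter> ?F -` {0<..}}" .
  moreover have "{q \<in> V. \<phi> q \<in> ?W \<inter> ?F -` {0<..}} = {q \<in> U \<inter> V. f q > 0}"
    using chart_inv[OF V(1)] by (auto dest: inj_onD[OF chart_inj[OF V(1)]])
  ultimately show "\<exists>T. openin (mtop M) T \<and> p \<in> T \<and> T \<subseteq> {p \<in> U. f p > 0}"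
    using p V(2) by (intro exI[of _ "{q \<in> U \<inter> V. f q > 0}"]) auto
qed

lemma smooth_atI: "openin (mtop M) U \<Longrightarrow> p \<in> U \<Longrightarrow> smooth_fun M U f \<Longrightarrow> smooth_at M p f"
  unfolding smooth_at_def by blast

end

section \<open>Tangent vectors as derivations\<close>

context charted_space
begin

lemma tangent_nonsmooth: "v \<in> tangent_space M p \<Longrightarrow> \<not> smooth_at M p f \<Longrightarrow> v f = 0"
  unfolding tangent_space_def by blast

lemma tangent_cong:
  "v \<in> tangent_space M p \<Longrightarrow> smooth_at M p f \<Longrightarrow> smooth_at M p h \<Longrightarrow> openin (mtop M) U \<Longrightarrow> p \<in> U \<Longrightarrow>
   (\<And>q. q \<in> U \<Longrightarrow> f q = h q) \<Longrightarrow> v f = v h"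
  unfolding tangent_space_def by blast

lemma tangent_lin:
  "v \<in> tangent_space M p \<Longrightarrow> smooth_at M p f \<Longrightarrow> smooth_at M p h \<Longrightarrow>
   v (\<lambda>q. a * f q + c * h q) = a * v f + c * v h"
  unfolding tangent_space_def by blast

lemma tangent_mult:
  "v \<in> tangent_space M p \<Longrightarrow> smooth_at M p f \<Longrightarrow> smooth_at M p h \<Longrightarrow>
   v (\<lambda>q. f q * h q) = v f * h p + f p * v h"
  unfolding tangent_space_def by blast

lemma smooth_at_common:
  assumes "smooth_at M p f" "smooth_at M p h"
  obtains U where "openin (mtop M) U" "p \<in> U" "smooth_fun M U f" "smooth_fun M U h"
proof -
  obtain U V where U: "openin (mtop M) U" "p \<in> U" "smooth_fun M U f"
    and V: "openin (mtop M) V" "p \<in> V" "smooth_fun M V h"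
    using assms unfolding smooth_at_def by blast
  have o: "openin (mtop M) (U \<inter> V)" using U(1) V(1) by (rule openin_Int)
  show ?thesis
    using smooth_fun_subset[OF U(1) o _ U(3)] smooth_fun_subset[OF V(1) o _ V(3)] o U(2) V(2)
    by (intro that[OF o]) auto
qed

lemma smooth_at_const: "p \<in> topspace (mtop M) \<Longrightarrow> smooth_at M p (\<lambda>q. c)"
  by (rule smooth_atI[OF openin_topspace]) (auto intro: smooth_fun_const)

lemma smooth_at_add: "smooth_at M p f \<Longrightarrow> smooth_at M p h \<Longrightarrow> smooth_at M p (\<lambda>q. f q + h q)"
  by (erule (1) smooth_at_common) (auto intro: smooth_atI smooth_fun_add)

lemma smooth_at_mult: "smooth_at M p f \<Longrightarrow> smooth_at M p h \<Longrightarrow> smooth_at M p (\<lambda>q. f q * h q)"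
  by (erule (1) smooth_at_common) (auto intro: smooth_atI smooth_fun_mult)

lemma smooth_at_sum:
  "p \<in> topspace (mtop M) \<Longrightarrow> (\<And>l. l \<in> L \<Longrightarrow> smooth_at M p (f l)) \<Longrightarrow> smooth_at M p (\<lambda>q. \<Sum>l\<in>L. f l q)"
proof (induction L rule: infinite_finite_induct)
  case (insert l L)
  then have "smooth_at M p (\<lambda>q. f l q + (\<Sum>l\<in>L. f l q))" by (intro smooth_at_add) auto
  then show ?case using insert.hyps by simp
qed (auto intro: smooth_at_const)

lemma tangent_const:
  assumes "v \<in> tangent_space M p" "p \<in> topspace (mtop M)"
  shows "v (\<lambda>q. c) = 0"
proof -
  \<comment> \<open>The product rule for 1 = 1 * 1 reads v(1) = 2 v(1).\<close>
  have "v (\<lambda>q. 1 * 1) = v (\<lambda>q. 1) * 1 + 1 * v (\<lambda>q. 1)"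
    by (rule tangent_mult[OF assms(1)]) (auto intro: smooth_at_const assms)
  then have "v (\<lambda>q. 1) = 0" by simp
  moreover have "v (\<lambda>q. c * 1 + 0 * 1) = c * v (\<lambda>q. 1) + 0 * v (\<lambda>q. 1)"
    by (rule tangent_lin[OF assms(1)]) (auto intro: smooth_at_const assms)
  ultimately show ?thesis by simp
qed

lemma tangent_add:
  "v \<in> tangent_space M p \<Longrightarrow> smooth_at M p f \<Longrightarrow> smooth_at M p h \<Longrightarrow> v (\<lambda>q. f q + h q) = v f + v h"
  using tangent_lin[of v p f h 1 1] by simp

lemma tangent_diff:
  "v \<in> tangent_space M p \<Longrightarrow> smooth_at M p f \<Longrightarrow> smooth_at M p h \<Longrightarrow> v (\<lambda>q. f q - h q) = v f - v h"
  using tangent_lin[of v p f h 1 "-1"] by simp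

lemma tangent_cmult:
  "v \<in> tangent_space M p \<Longrightarrow> smooth_at M p f \<Longrightarrow> v (\<lambda>q. c * f q) = c * v f"
  using tangent_lin[of v p f f c 0] by simp

lemma tangent_sum:
  assumes "v \<in> tangent_space M p" "p \<in> topspace (mtop M)"
  shows "(\<And>l. l \<in> L \<Longrightarrow> smooth_at M p (f l)) \<Longrightarrow> v (\<lambda>q. \<Sum>l\<in>L. f l q) = (\<Sum>l\<in>L. v (f l))"
proof (induction L rule: infinite_finite_induct)
  case (insert l L)
  then have "v (\<lambda>q. f l q + (\<Sum>l\<in>L. f l q)) = v (f l) + v (\<lambda>q. \<Sum>l\<in>L. f l q)"
    by (intro tangent_add smooth_at_sum) (auto intro: assms)
  then show ?case using insert by simp
qed (auto intro: tangent_const assms)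

lemma tangent_space_lin:
  assumes "u \<in> tangent_space M p" "v \<in> tangent_space M p"
  shows "(\<lambda>f. a * u f + c * v f) \<in> tangent_space M p"
  unfolding tangent_space_def
proof (intro CollectI conjI allI impI)
  show "a * u f + c * v f = 0" if "\<not> smooth_at M p f" for f
    using tangent_nonsmooth[OF assms(1) that] tangent_nonsmooth[OF assms(2) that] by simp
  show "a * u f + c * v f = a * u h + c * v h"
    if "smooth_at M p f \<and> smooth_at M p h \<and> (\<exists>U. openin (mtop M) U \<and> p \<in> U \<and> (\<forall>q\<in>U. f q = h q))" for f h
  proof -
    from that obtain U where fh: "smooth_at M p f" "smooth_at M p h"
      and U: "openin (mtop M) U" "p \<in> U" "\<forall>q\<in>U. f q = h q" by (elim conjE exE)
    show ?thesis
      using tangent_cong[OF assms(1) fh U(1,2) bspec[OF U(3)]] tangent_cong[OF assms(2) fh U(1,2) bspec[OF U(3)]]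
      by simp
  qed
  show "a * u (\<lambda>q. a' * f q + c' * h q) + c * v (\<lambda>q. a' * f q + c' * h q)
      = a' * (a * u f + c * v f) + c' * (a * u h + c * v h)"
    if "smooth_at M p f \<and> smooth_at M p h" for f h a' c'
    using that assms by (simp add: tangent_lin algebra_simps)
  show "a * u (\<lambda>q. f q * h q) + c * v (\<lambda>q. f q * h q)
      = (a * u f + c * v f) * h p + f p * (a * u h + c * v h)"
    if "smooth_at M p f \<and> smooth_at M p h" for f h
    using that assms by (simp add: tangent_mult algebra_simps)
qed

lemma tangent_space_0: "(\<lambda>f. 0) \<in> tangent_space M p"
  by (auto simp: tangent_space_def)

lemma tangent_space_scale: "u \<in> tangent_space M p \<Longrightarrow> (\<lambda>f. a * u f) \<in> tangent_space M p"
  using tangent_space_lin[of u p u a 0] by simp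

lemma tangent_space_sum:
  "(\<And>l. l \<in> L \<Longrightarrow> v l \<in> tangent_space M p) \<Longrightarrow> (\<lambda>f. \<Sum>l\<in>L. c l * v l f) \<in> tangent_space M p"
proof (induction L rule: infinite_finite_induct)
  case (insert l L)
  then have "(\<lambda>f. c l * v l f + 1 * (\<Sum>l\<in>L. c l * v l f)) \<in> tangent_space M p"
    by (intro tangent_space_lin) auto
  then show ?case using insert.hyps by simp
qed (auto intro: tangent_space_0)

text \<open>Along the coordinate line through \<open>\<phi> p\<close> every function smooth at
  \<open>p\<close> has the derivative \<open>coord_vf M U \<phi> k p f\<close>. Uniqueness of
  derivatives then turns the sum and product rules of one-variable calculus into the laws of a
  derivation.\<close>

lemma coord_vf_tangent:
  assumes U: "(U, \<phi>) \<in> matlas M" and k: "k \<in> mindex M" and p: "p \<in> U"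
  shows "coord_vf M U \<phi> k p \<in> tangent_space M p"
proof -
  let ?K = "mindex M"
  have repr: "\<exists>W. openin (powertop_real ?K) W \<and> \<phi> p \<in> W \<and> C_infinity ?K W (\<lambda>x. f (inv_into U \<phi> x))"
    if "smooth_at M p f" for f
  proof -
    obtain V where V: "openin (mtop M) V" "p \<in> V" "smooth_fun M V f" using \<open>smooth_at M p f\<close> unfolding smooth_at_def by blast
    show ?thesis
      using chart_inter_open[OF U V(1)] smooth_funD[OF V(3) U] V(2) p
      by (intro exI[of _ "\<phi> ` (V \<inter> U)"]) auto
  qed
  have der: "((\<lambda>s. f (inv_into U \<phi> ((\<phi> p)(k := s)))) has_real_derivative coord_vf M U \<phi> k p f) (at (\<phi> p k))"
    if f: "smooth_at M p f" for f
  proof -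
    obtain W where W: "\<phi> p \<in> W" "C_infinity ?K W (\<lambda>x. f (inv_into U \<phi> x))" using repr[OF f] by blast
    show ?thesis using C_infinity_has_partial_deriv[OF W(2) k W(1)] f by (simp add: coord_vf_def)
  qed
  have val: "f (inv_into U \<phi> ((\<phi> p)(k := \<phi> p k))) = f p" for f :: "'a \<Rightarrow> real"
    using chart_inv[OF U p] by simp
  have p': "p \<in> topspace (mtop M)" using openin_topspace_subset[OF chart_open[OF U] p] .
  show ?thesis
    unfolding tangent_space_def
  proof (intro CollectI conjI allI impI)
    show "coord_vf M U \<phi> k p f = 0" if "\<not> smooth_at M p f" for f using that by (simp add: coord_vf_def)
    fix f h
    show "coord_vf M U \<phi> k p f = coord_vf M U \<phi> k p h"
      if *: "smooth_at M p f \<and> smooth_at M p h \<and> (\<exists>U. openin (mtop M) U \<and> p \<in> U \<and> (\<forall>q\<in>U. f q = h q))"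
    proof -
      from * obtain V where V: "openin (mtop M) V" "p \<in> V" "\<forall>q\<in>V. f q = h q" by (elim conjE exE)
      have "partial_deriv k (\<lambda>x. f (inv_into U \<phi> x)) (\<phi> p) = partial_deriv k (\<lambda>x. h (inv_into U \<phi> x)) (\<phi> p)"
        by (rule partial_deriv_cong[OF finite_index chart_inter_open[OF U V(1)] _ k])
           (use V p chart_inv[OF U] in auto)
      then show ?thesis using * by (simp add: coord_vf_def)
    qed
    {
      fix a c assume *: "smooth_at M p f \<and> smooth_at M p h"
      have s: "smooth_at M p (\<lambda>q. a * f q + c * h q)"
        using * p' by (intro smooth_at_add smooth_at_mult smooth_at_const) auto
      have "((\<lambda>s. a * f (inv_into U \<phi> ((\<phi> p)(k := s))) + c * h (inv_into U \<phi> ((\<phi> p)(k := s))))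
          has_real_derivative a * coord_vf M U \<phi> k p f + c * coord_vf M U \<phi> k p h) (at (\<phi> p k))"
        by (intro DERIV_add DERIV_cmult der) (use * in auto)
      from DERIV_unique[OF der[OF s] this]
      show "coord_vf M U \<phi> k p (\<lambda>q. a * f q + c * h q) = a * coord_vf M U \<phi> k p f + c * coord_vf M U \<phi> k p h" .
    next
      assume *: "smooth_at M p f \<and> smooth_at M p h"
      have s: "smooth_at M p (\<lambda>q. f q * h q)" using * by (intro smooth_at_mult) auto
      have "((\<lambda>s. f (inv_into U \<phi> ((\<phi> p)(k := s))) * h (inv_into U \<phi> ((\<phi> p)(k := s))))
          has_real_derivative coord_vf M U \<phi> k p f * h p + coord_vf M U \<phi> k p h * f p) (at (\<phi> p k))"
        using DERIV_mult[OF der[of f] der[of h]] * unfolding val by blast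
      from DERIV_unique[OF der[OF s] this]
      show "coord_vf M U \<phi> k p (\<lambda>q. f q * h q) = coord_vf M U \<phi> k p f * h p + f p * coord_vf M U \<phi> k p h"
        by simp
    }
  qed
qed

lemma coord_vf_vector_field:
  assumes U: "(U, \<phi>) \<in> matlas M" and k: "k \<in> mindex M"
  shows "coord_vf M U \<phi> k \<in> vector_fields M U"
  unfolding vector_fields_def
proof (intro CollectI conjI ballI allI impI)
  show "coord_vf M U \<phi> k p \<in> tangent_space M p" if "p \<in> U" for p
    using coord_vf_tangent[OF U k that] .
  fix V f assume V: "openin (mtop M) V \<and> V \<subseteq> U \<and> smooth_fun M V f"
  let ?F = "partial_deriv k (\<lambda>x. f (inv_into U \<phi> x))"
  have VU: "V \<inter> U = V" using V by auto
  have "C_infinity (mindex M) (\<phi> ` V) ?F"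
    using C_infinity_partial_deriv[OF smooth_funD[OF _ U] k, of V f] V VU by simp
  then have "C_infinity (mindex M) (\<phi> ` V) (\<lambda>x. coord_vf M U \<phi> k (inv_into U \<phi> x) f)"
  proof (rule C_infinity_cong[OF finite_index chart_image_open[OF U], rotated 3])
    fix x assume "x \<in> \<phi> ` V"
    then obtain q where q: "q \<in> V" "x = \<phi> q" by blast
    then have "smooth_at M q f" using V smooth_atI by blast
    then show "?F x = coord_vf M U \<phi> k (inv_into U \<phi> x) f"
      using q V chart_inv[OF U, of q] by (auto simp: coord_vf_def)
  qed (use V in auto)
  then show "smooth_fun M V (\<lambda>p. coord_vf M U \<phi> k p f)"
    using V by (intro smooth_fun_chart[OF U]) auto
qed

lemma coord_vf_coord:
  assumes U: "(U, \<phi>) \<in> matlas M" and k: "k \<in> mindex M" "l \<in> mindex M" and p: "p \<in> U"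
  shows "coord_vf M U \<phi> k p (\<lambda>q. \<phi> q l) = (if k = l then 1 else 0)"
proof -
  have "smooth_at M p (\<lambda>q. \<phi> q l)"
    using smooth_atI[OF chart_open[OF U] p smooth_fun_coord[OF U k(2)]] .
  then have "coord_vf M U \<phi> k p (\<lambda>q. \<phi> q l) = partial_deriv k (\<lambda>x. \<phi> (inv_into U \<phi> x) l) (\<phi> p)"
    by (simp add: coord_vf_def)
  also have "\<dots> = partial_deriv k (\<lambda>x. x l) (\<phi> p)"
    by (rule partial_deriv_cong[OF finite_index chart_image[OF U] _ k(1)])
       (use p chart_inv[OF U] in auto)
  also have "\<dots> = (if k = l then 1 else 0)"
    by (simp add: partial_deriv_def)
  finally show ?thesis .
qed

text \<open>Apply \<open>v\<close> to Hadamard's expansion f = f(p) + sum of (x_k - x_k(p)) h_k. The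
  constant is killed, and in each product only v(x_k) h_k(p) survives because the first factor
  vanishes at \<open>p\<close>. Since \<open>v\<close> acts on germs, an expansion over a small cube
  is enough.\<close>

lemma tangent_expand:
  assumes U: "(U, \<phi>) \<in> matlas M" and p: "p \<in> U" and v: "v \<in> tangent_space M p"
  shows "v = (\<lambda>f. \<Sum>k\<in>mindex M. v (\<lambda>q. \<phi> q k) * coord_vf M U \<phi> k p f)"
proof
  fix f
  let ?K = "mindex M"
  have p': "p \<in> topspace (mtop M)" using openin_topspace_subset[OF chart_open[OF U] p] .
  show "v f = (\<Sum>k\<in>?K. v (\<lambda>q. \<phi> q k) * coord_vf M U \<phi> k p f)"
  proof (cases "smooth_at M p f")
    case False
    then show ?thesis using tangent_nonsmooth[OF v] by (simp add: coord_vf_def)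
  next
    case True
    then obtain V where V: "openin (mtop M) V" "p \<in> V" "smooth_fun M V f"
      unfolding smooth_at_def by blast
    let ?F = "\<lambda>x. f (inv_into U \<phi> x)"
    have "\<phi> p \<in> \<phi> ` (V \<inter> U)" using V(2) p by auto
    then obtain e where e: "e > 0" "coord_box ?K (\<phi> p) e \<subseteq> \<phi> ` (V \<inter> U)"
      using coord_box_subset[OF finite_index chart_inter_open[OF U V(1)]] by blast
    let ?B = "coord_box ?K (\<phi> p) e"
    have B: "openin (powertop_real ?K) ?B" by (rule openin_coord_box[OF finite_index])
    have pP: "\<phi> p \<in> Pi\<^sub>E ?K (\<lambda>_. UNIV)" using openin_powertop_subset[OF chart_image[OF U]] p by auto
    have "C_infinity ?K ?B ?F"
      by (rule C_infinity_subset[OF chart_inter_open[OF U V(1)] B e(2) smooth_funD[OF V(3) U]])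
    from C_infinity_Hadamard[OF finite_index pP e(1) this]
    obtain h where h: "\<And>k. k \<in> ?K \<Longrightarrow> C_infinity ?K ?B (h k)"
      "\<And>k. k \<in> ?K \<Longrightarrow> h k (\<phi> p) = partial_deriv k ?F (\<phi> p)"
      "\<And>x. x \<in> ?B \<Longrightarrow> ?F x = ?F (\<phi> p) + (\<Sum>k\<in>?K. (x k - \<phi> p k) * h k x)" by blast
    let ?W = "{q \<in> U. \<phi> q \<in> ?B}"
    have W: "openin (mtop M) ?W" "p \<in> ?W" "\<phi> ` ?W \<subseteq> ?B"
      using chart_preimage_open[OF U B] p pP e(1) by (auto simp: coord_box_iff)
    have hs: "smooth_at M p (\<lambda>q. h k (\<phi> q))" if k: "k \<in> ?K" for k
    proof (rule smooth_atI[OF W(1,2)], rule smooth_fun_chart[OF U W(1)])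
      have o: "openin (powertop_real ?K) (\<phi> ` ?W)" by (rule chart_image_open[OF U W(1)]) auto
      have "C_infinity ?K (\<phi> ` ?W) (h k)" by (rule C_infinity_subset[OF B o W(3) h(1)[OF k]])
      then show "C_infinity ?K (\<phi> ` ?W) (\<lambda>x. h k (\<phi> (inv_into U \<phi> x)))"
        by (rule C_infinity_cong[OF finite_index o, rotated]) (auto simp: chart_inv[OF U])
    qed auto
    have cs: "smooth_at M p (\<lambda>q. \<phi> q k)" if "k \<in> ?K" for k
      using smooth_atI[OF chart_open[OF U] p smooth_fun_coord[OF U that]] .
    have cs': "smooth_at M p (\<lambda>q. \<phi> q k - \<phi> p k)" if "k \<in> ?K" for k
      using smooth_at_add[OF cs[OF that] smooth_at_const[OF p'], of "- \<phi> p k"] by simp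
    have ss: "smooth_at M p (\<lambda>q. \<Sum>k\<in>?K. (\<phi> q k - \<phi> p k) * h k (\<phi> q))"
      using p' hs cs' by (intro smooth_at_sum smooth_at_mult)
    have "v f = v (\<lambda>q. f p + (\<Sum>k\<in>?K. (\<phi> q k - \<phi> p k) * h k (\<phi> q)))"
    proof (rule tangent_cong[OF v True _ W(1,2)])
      show "smooth_at M p (\<lambda>q. f p + (\<Sum>k\<in>?K. (\<phi> q k - \<phi> p k) * h k (\<phi> q)))"
        by (intro smooth_at_add smooth_at_const p' ss)
      show "f q = f p + (\<Sum>k\<in>?K. (\<phi> q k - \<phi> p k) * h k (\<phi> q))" if "q \<in> ?W" for q
        using h(3)[of "\<phi> q"] that p by (simp add: chart_inv[OF U])
    qed
    also have "\<dots> = (\<Sum>k\<in>?K. v (\<lambda>q. (\<phi> q k - \<phi> p k) * h k (\<phi> q)))"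
      unfolding tangent_add[OF v smooth_at_const[OF p'] ss] tangent_const[OF v p'] add_0
      by (rule tangent_sum[OF v p']) (intro smooth_at_mult cs' hs)
    also have "\<dots> = (\<Sum>k\<in>?K. v (\<lambda>q. \<phi> q k) * coord_vf M U \<phi> k p f)"
    proof (rule sum.cong[OF refl])
      fix k assume k: "k \<in> ?K"
      have "v (\<lambda>q. (\<phi> q k - \<phi> p k) * h k (\<phi> q)) = v (\<lambda>q. \<phi> q k - \<phi> p k) * h k (\<phi> p)"
        using tangent_mult[OF v cs'[OF k] hs[OF k]] by simp
      also have "v (\<lambda>q. \<phi> q k - \<phi> p k) = v (\<lambda>q. \<phi> q k)"
        using tangent_diff[OF v cs[OF k] smooth_at_const[OF p']] tangent_const[OF v p'] by simp
      also have "h k (\<phi> p) = coord_vf M U \<phi> k p f"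
        using h(2)[OF k] True by (simp add: coord_vf_def)
      finally show "v (\<lambda>q. (\<phi> q k - \<phi> p k) * h k (\<phi> q)) = v (\<lambda>q. \<phi> q k) * coord_vf M U \<phi> k p f" .
    qed
    finally show ?thesis .
  qed
qed

section \<open>Smooth vector fields and Lie brackets\<close>

lemma vfD: "X \<in> vector_fields M U \<Longrightarrow> p \<in> U \<Longrightarrow> X p \<in> tangent_space M p"
  by (simp add: vector_fields_def)

lemma vf_smooth: "X \<in> vector_fields M U \<Longrightarrow> openin (mtop M) V \<Longrightarrow> V \<subseteq> U \<Longrightarrow> smooth_fun M V f \<Longrightarrow>
   smooth_fun M V (\<lambda>p. X p f)"
  unfolding vector_fields_def by blast

lemma vf_subset: "X \<in> vector_fields M U \<Longrightarrow> V \<subseteq> U \<Longrightarrow> X \<in> vector_fields M V"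
  unfolding vector_fields_def by blast

lemma vf_cong:
  assumes "openin (mtop M) U" "X \<in> vector_fields M U" "\<And>p. p \<in> U \<Longrightarrow> X p = Y p"
  shows "Y \<in> vector_fields M U"
  unfolding vector_fields_def
proof (intro CollectI conjI ballI allI impI)
  show "Y p \<in> tangent_space M p" if "p \<in> U" for p using vfD[OF assms(2) that] assms(3)[OF that] by simp
  fix V f assume V: "openin (mtop M) V \<and> V \<subseteq> U \<and> smooth_fun M V f"
  then have V': "openin (mtop M) V" "V \<subseteq> U" "smooth_fun M V f" by auto
  have "X p f = Y p f" if "p \<in> V" for p by (simp only: assms(3)[OF subsetD[OF V'(2) that]])
  then show "smooth_fun M V (\<lambda>p. Y p f)" by (rule smooth_fun_cong[OF V'(1) _ vf_smooth[OF assms(2) V']])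
qed

lemma vf_0: "openin (mtop M) U \<Longrightarrow> (\<lambda>p f. 0) \<in> vector_fields M U"
  by (auto simp: vector_fields_def tangent_space_0 intro: smooth_fun_const)

lemma vf_add_closed:
  assumes "X \<in> vector_fields M U" "Y \<in> vector_fields M U"
  shows "vf_add X Y \<in> vector_fields M U"
  unfolding vector_fields_def
proof (intro CollectI conjI ballI allI impI)
  show "vf_add X Y p \<in> tangent_space M p" if "p \<in> U" for p
    using tangent_space_lin[OF vfD[OF assms(1) that] vfD[OF assms(2) that], of 1 1]
    by (simp add: vf_add_def)
qed (auto simp: vf_add_def intro!: smooth_fun_add vf_smooth[OF assms(1)] vf_smooth[OF assms(2)])

lemma vf_scale_closed:
  assumes "openin (mtop M) U" "X \<in> vector_fields M U" "smooth_fun M U h"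
  shows "vf_scale h X \<in> vector_fields M U"
  unfolding vector_fields_def
proof (intro CollectI conjI ballI allI impI)
  show "vf_scale h X p \<in> tangent_space M p" if "p \<in> U" for p
    using tangent_space_scale[OF vfD[OF assms(2) that]] by (simp add: vf_scale_def)
  fix V f assume V: "openin (mtop M) V \<and> V \<subseteq> U \<and> smooth_fun M V f"
  then have "smooth_fun M V h" using smooth_fun_subset[OF assms(1) _ _ assms(3)] by blast
  then show "smooth_fun M V (\<lambda>p. vf_scale h X p f)"
    using V vf_smooth[OF assms(2)] unfolding vf_scale_def by (intro smooth_fun_mult) auto
qed

lemma vf_sum_insert: "finite L \<Longrightarrow> l \<notin> L \<Longrightarrow> vf_sum (insert l L) X = vf_add (X l) (vf_sum L X)"
  by (auto simp: vf_sum_def vf_add_def fun_eq_iff)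

lemma vf_sum_empty: "vf_sum {} X = (\<lambda>p f. 0)"
  by (simp add: vf_sum_def)

lemma vf_sum_closed:
  assumes "openin (mtop M) U"
  shows "finite L \<Longrightarrow> (\<And>l. l \<in> L \<Longrightarrow> X l \<in> vector_fields M U) \<Longrightarrow> vf_sum L X \<in> vector_fields M U"
proof (induction L rule: finite_induct)
  case (insert l L)
  then show ?case by (simp add: vf_sum_insert vf_add_closed)
qed (auto simp: vf_sum_empty vf_0[OF assms])

lemma vf_smooth_at:
  assumes "openin (mtop M) U" "X \<in> vector_fields M U" "p \<in> U" "smooth_at M p f"
  shows "smooth_at M p (\<lambda>q. X q f)"
proof -
  obtain V where V: "openin (mtop M) V" "p \<in> V" "smooth_fun M V f"
    using assms(4) unfolding smooth_at_def by blast
  have o: "openin (mtop M) (V \<inter> U)" using V(1) assms(1) by (rule openin_Int)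
  have "smooth_fun M (V \<inter> U) (\<lambda>q. X q f)"
    by (rule vf_smooth[OF assms(2) o]) (auto intro: smooth_fun_subset[OF V(1) o _ V(3)])
  then show ?thesis using o V(2) assms(3) by (intro smooth_atI[of "V \<inter> U"]) auto
qed

text \<open>A composite of two derivations violates the product rule by mixed first-order terms.
  These are symmetric in \<open>X\<close> and \<open>Y\<close> and cancel in the commutator.\<close>

lemma lie_bracket_tangent:
  assumes U: "openin (mtop M) U" and X: "X \<in> vector_fields M U" and Y: "Y \<in> vector_fields M U" and p: "p \<in> U"
  shows "lie_bracket M X Y p \<in> tangent_space M p"
proof -
  have p': "p \<in> topspace (mtop M)" using openin_topspace_subset[OF U p] .
  note Xp = vfD[OF X p] and Yp = vfD[OF Y p]
  note sX = vf_smooth_at[OF U X p] and sY = vf_smooth_at[OF U Y p]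
  \<comment> \<open>The inner field is evaluated at all points near \<open>p\<close>, and its
    derivation laws ask for \<open>f\<close> and \<open>h\<close> to be smooth at each of
    them.\<close>
  have near: "\<exists>W. openin (mtop M) W \<and> p \<in> W \<and> (\<forall>q\<in>W. q \<in> U \<and> smooth_at M q f \<and> smooth_at M q h)"
    if "smooth_at M p f" "smooth_at M p h" for f h
  proof -
    obtain W where W: "openin (mtop M) W" "p \<in> W" "smooth_fun M W f" "smooth_fun M W h"
      using smooth_at_common[OF \<open>smooth_at M p f\<close> \<open>smooth_at M p h\<close>] .
    then show ?thesis using U p by (intro exI[of _ "W \<inter> U"]) (auto intro: smooth_atI)
  qed
  show ?thesis
    unfolding tangent_space_def
  proof (intro CollectI conjI allI impI)
    show "lie_bracket M X Y p f = 0" if "\<not> smooth_at M p f" for f using that by (simp add: lie_bracket_def)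
    fix f h
    {
      assume *: "smooth_at M p f \<and> smooth_at M p h \<and> (\<exists>U. openin (mtop M) U \<and> p \<in> U \<and> (\<forall>q\<in>U. f q = h q))"
      from * obtain V where V: "openin (mtop M) V" "p \<in> V" "\<forall>q\<in>V. f q = h q" by (elim conjE exE)
      obtain W where W: "openin (mtop M) W" "p \<in> W" "\<And>q. q \<in> W \<Longrightarrow> q \<in> U \<and> smooth_at M q f \<and> smooth_at M q h"
        using near[of f h] * by blast
      have o: "openin (mtop M) (W \<inter> V)" "p \<in> W \<inter> V" using W V by auto
      have eq: "Z q f = Z q h" if "Z \<in> vector_fields M U" "q \<in> W \<inter> V" for Z q
        using that W(3)[of q] V by (intro tangent_cong[OF vfD[OF that(1)] _ _ V(1)]) auto
      have "X p (\<lambda>q. Y q f) = X p (\<lambda>q. Y q h)"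
        using * sY eq[OF Y] by (intro tangent_cong[OF Xp _ _ o]) auto
      moreover have "Y p (\<lambda>q. X q f) = Y p (\<lambda>q. X q h)"
        using * sX eq[OF X] by (intro tangent_cong[OF Yp _ _ o]) auto
      ultimately show "lie_bracket M X Y p f = lie_bracket M X Y p h" using * by (simp add: lie_bracket_def)
    next
      fix a c assume *: "smooth_at M p f \<and> smooth_at M p h"
      obtain W where W: "openin (mtop M) W" "p \<in> W" "\<And>q. q \<in> W \<Longrightarrow> q \<in> U \<and> smooth_at M q f \<and> smooth_at M q h"
        using near[of f h] * by blast
      have s: "smooth_at M p (\<lambda>q. a * f q + c * h q)"
        using * p' by (intro smooth_at_add smooth_at_mult smooth_at_const) auto
      have inner: "V (\<lambda>q. Z q (\<lambda>q. a * f q + c * h q)) = a * V (\<lambda>q. Z q f) + c * V (\<lambda>q. Z q h)"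
        if Z: "Z \<in> vector_fields M U" and V: "V \<in> tangent_space M p" for Z V
      proof -
        note sZ = vf_smooth_at[OF U Z p]
        have "V (\<lambda>q. Z q (\<lambda>q. a * f q + c * h q)) = V (\<lambda>q. a * Z q f + c * Z q h)"
        proof (rule tangent_cong[OF V sZ[OF s] _ W(1,2)])
          show "smooth_at M p (\<lambda>q. a * Z q f + c * Z q h)"
            using * p' sZ by (intro smooth_at_add smooth_at_mult smooth_at_const) auto
          show "Z q (\<lambda>q. a * f q + c * h q) = a * Z q f + c * Z q h" if "q \<in> W" for q
            using W(3)[OF that] by (intro tangent_lin[OF vfD[OF Z]]) auto
        qed
        then show ?thesis using tangent_lin[OF V sZ sZ] * by simp
      qed
      show "lie_bracket M X Y p (\<lambda>q. a * f q + c * h q) = a * lie_bracket M X Y p f + c * lie_bracket M X Y p h"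
        using * s inner[OF Y Xp] inner[OF X Yp] by (simp add: lie_bracket_def algebra_simps)
    next
      assume *: "smooth_at M p f \<and> smooth_at M p h"
      obtain W where W: "openin (mtop M) W" "p \<in> W" "\<And>q. q \<in> W \<Longrightarrow> q \<in> U \<and> smooth_at M q f \<and> smooth_at M q h"
        using near[of f h] * by blast
      have s: "smooth_at M p (\<lambda>q. f q * h q)"
        using * p' by (intro smooth_at_mult) auto
      have inner: "V (\<lambda>q. Z q (\<lambda>q. f q * h q)) =
          V (\<lambda>q. Z q f) * h p + Z p f * V h + (V f * Z p h + f p * V (\<lambda>q. Z q h))"
        if Z: "Z \<in> vector_fields M U" and V: "V \<in> tangent_space M p" for Z V
      proof -
        note sZ = vf_smooth_at[OF U Z p]
        have "V (\<lambda>q. Z q (\<lambda>q. f q * h q)) = V (\<lambda>q. Z q f * h q + f q * Z q h)"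
        proof (rule tangent_cong[OF V sZ[OF s] _ W(1,2)])
          show "smooth_at M p (\<lambda>q. Z q f * h q + f q * Z q h)"
            using * p' sZ by (intro smooth_at_add smooth_at_mult) auto
          show "Z q (\<lambda>q. f q * h q) = Z q f * h q + f q * Z q h" if "q \<in> W" for q
            using W(3)[OF that] by (intro tangent_mult[OF vfD[OF Z]]) auto
        qed
        also have "\<dots> = V (\<lambda>q. Z q f * h q) + V (\<lambda>q. f q * Z q h)"
          using * sZ by (intro tangent_add[OF V] smooth_at_mult) auto
        also have "V (\<lambda>q. Z q f * h q) = V (\<lambda>q. Z q f) * h p + Z p f * V h"
          using * sZ by (intro tangent_mult[OF V]) auto
        also have "V (\<lambda>q. f q * Z q h) = V f * Z p h + f p * V (\<lambda>q. Z q h)"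
          using * sZ by (intro tangent_mult[OF V]) auto
        finally show ?thesis .
      qed
      show "lie_bracket M X Y p (\<lambda>q. f q * h q) = lie_bracket M X Y p f * h p + f p * lie_bracket M X Y p h"
        using * s inner[OF Y Xp] inner[OF X Yp] by (simp add: lie_bracket_def algebra_simps)
    }
  qed
qed

lemma lie_bracket_closed:
  assumes U: "openin (mtop M) U" and X: "X \<in> vector_fields M U" and Y: "Y \<in> vector_fields M U"
  shows "lie_bracket M X Y \<in> vector_fields M U"
  unfolding vector_fields_def
proof (intro CollectI conjI ballI allI impI)
  show "lie_bracket M X Y p \<in> tangent_space M p" if "p \<in> U" for p
    by (rule lie_bracket_tangent[OF U X Y that])
  fix V f assume V: "openin (mtop M) V \<and> V \<subseteq> U \<and> smooth_fun M V f"
  then have "smooth_fun M V (\<lambda>p. X p (\<lambda>q. Y q f) - Y p (\<lambda>q. X q f))"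
    using vf_smooth[OF X] vf_smooth[OF Y] by (intro smooth_fun_diff) auto
  then show "smooth_fun M V (\<lambda>p. lie_bracket M X Y p f)"
    by (rule smooth_fun_cong[rotated 2]) (use V smooth_atI in \<open>auto simp: lie_bracket_def\<close>)
qed

end

section \<open>Orthonormal frames\<close>

interpretation tvec: vector_space "\<lambda>(c::real) (v :: 'a tvec). (\<lambda>f. c * v f)"
  by standard (auto simp: fun_eq_iff plus_fun_def algebra_simps)

text \<open>\<open>L k\<close> annihilates every member except \<open>e k\<close>, so
  \<open>e k\<close> lies outside the span of the others. Linearity is asked for on \<open>S\<close>
  only, since a metric is known to be linear just on tangent vectors.\<close>

lemma dual_family_independent:
  fixes e :: "'k \<Rightarrow> 'a tvec"
  assumes "\<And>k. k \<in> K \<Longrightarrow> tvec.subspace {x \<in> S. L k x = (0::real)}"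
    and "\<And>k. k \<in> K \<Longrightarrow> e k \<in> S" "\<And>k. k \<in> K \<Longrightarrow> L k (e k) \<noteq> 0"
    and "\<And>k l. k \<in> K \<Longrightarrow> l \<in> K \<Longrightarrow> k \<noteq> l \<Longrightarrow> L l (e k) = 0"
  shows "inj_on e K" "\<not> tvec.dependent (e ` K)"
proof -
  show "inj_on e K"
    by (rule inj_onI) (metis assms(3,4))
  show "\<not> tvec.dependent (e ` K)"
  proof
    assume "tvec.dependent (e ` K)"
    then obtain k where k: "k \<in> K" "e k \<in> tvec.span (e ` K - {e k})"
      unfolding tvec.dependent_def by blast
    have "e ` K - {e k} \<subseteq> {x \<in> S. L k x = 0}"
      using assms(2,4) k(1) by auto
    then have "tvec.span (e ` K - {e k}) \<subseteq> {x \<in> S. L k x = 0}"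
      by (rule tvec.span_minimal) (rule assms(1)[OF k(1)])
    then show False using k assms(3) by auto
  qed
qed

text \<open>The dual functionals are the evaluations at the coordinate functions.\<close>

lemma (in charted_space) coord_vf_independent:
  assumes U: "(U, \<phi>) \<in> matlas M" and p: "p \<in> U"
  shows "inj_on (\<lambda>k. coord_vf M U \<phi> k p) (mindex M)"
    "\<not> tvec.dependent ((\<lambda>k. coord_vf M U \<phi> k p) ` mindex M)"
proof -
  have s: "tvec.subspace {x \<in> UNIV. x (\<lambda>q. \<phi> q k) = 0}" for k
    by (rule tvec.subspaceI) (auto simp: zero_fun_def plus_fun_def)
  note * = dual_family_independent[where S = UNIV and L = "\<lambda>k x. x (\<lambda>q. \<phi> q k)" and
      e = "\<lambda>k. coord_vf M U \<phi> k p" and K = "mindex M", OF s]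
  show "inj_on (\<lambda>k. coord_vf M U \<phi> k p) (mindex M)"
    by (rule *(1)) (use coord_vf_coord[OF U _ _ p] in auto)
  show "\<not> tvec.dependent ((\<lambda>k. coord_vf M U \<phi> k p) ` mindex M)"
    by (rule *(2)) (use coord_vf_coord[OF U _ _ p] in auto)
qed

lemma tvec_lin_span:
  "finite L \<Longrightarrow> (\<And>l. l \<in> L \<Longrightarrow> v l \<in> tvec.span S) \<Longrightarrow> (\<lambda>f. \<Sum>l\<in>L. c l * v l f) \<in> tvec.span S"
proof (induction L rule: finite_induct)
  case empty
  then show ?case using tvec.span_zero[of S] by (simp add: zero_fun_def)
next
  case (insert l L)
  have "(\<lambda>f. c l * v l f) + (\<lambda>f. \<Sum>l\<in>L. c l * v l f) \<in> tvec.span S"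
    by (intro tvec.span_add tvec.span_scale insert) auto
  then show ?case using insert.hyps by (simp add: plus_fun_def)
qed

lemma (in charted_space) tangent_in_coord_span:
  assumes U: "(U, \<phi>) \<in> matlas M" and p: "p \<in> U" and v: "v \<in> tangent_space M p"
  shows "v \<in> tvec.span ((\<lambda>k. coord_vf M U \<phi> k p) ` mindex M)"
  by (subst tangent_expand[OF U p v]) (intro tvec_lin_span finite_index tvec.span_base, blast)

text \<open>Shared by the factors and the warped product. On the factors nondegeneracy is added in
  \<open>pseudo_metric\<close> and yields frames; on the warped product the explicit lifted frame
  takes that place.\<close>

locale charted_metric = charted_space M for M :: "('a, 'k) manifold" +
  fixes g :: "'a metric_field"
  assumes g_sym: "p \<in> topspace (mtop M) \<Longrightarrow> u \<in> tangent_space M p \<Longrightarrow> v \<in> tangent_space M p \<Longrightarrow> g p u v = g p v u"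
    and g_lin: "p \<in> topspace (mtop M) \<Longrightarrow> u \<in> tangent_space M p \<Longrightarrow> v \<in> tangent_space M p \<Longrightarrow>
      w \<in> tangent_space M p \<Longrightarrow> g p (\<lambda>f. a * u f + c * v f) w = a * g p u w + c * g p v w"
    and g_smooth: "openin (mtop M) U \<Longrightarrow> X \<in> vector_fields M U \<Longrightarrow> Y \<in> vector_fields M U \<Longrightarrow>
      smooth_fun M U (\<lambda>p. g p (X p) (Y p))"
begin

lemma g_lin_right:
  "p \<in> topspace (mtop M) \<Longrightarrow> u \<in> tangent_space M p \<Longrightarrow> v \<in> tangent_space M p \<Longrightarrow>
   w \<in> tangent_space M p \<Longrightarrow> g p w (\<lambda>f. a * u f + c * v f) = a * g p w u + c * g p w v"
  using g_sym[of p w] g_lin tangent_space_lin by simp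

lemma g_0: "p \<in> topspace (mtop M) \<Longrightarrow> w \<in> tangent_space M p \<Longrightarrow> g p (\<lambda>f. 0) w = 0"
  using g_lin[OF _ tangent_space_0 tangent_space_0, of p w 0 0] by simp

lemma g_scale: "p \<in> topspace (mtop M) \<Longrightarrow> u \<in> tangent_space M p \<Longrightarrow> w \<in> tangent_space M p \<Longrightarrow>
   g p (\<lambda>f. a * u f) w = a * g p u w"
  using g_lin[of p u u w a 0] by simp

lemma g_add: "p \<in> topspace (mtop M) \<Longrightarrow> u \<in> tangent_space M p \<Longrightarrow> v \<in> tangent_space M p \<Longrightarrow> w \<in> tangent_space M p \<Longrightarrow>
   g p (\<lambda>f. u f + v f) w = g p u w + g p v w"
  using g_lin[of p u v w 1 1] by simp

lemma g_diff: "p \<in> topspace (mtop M) \<Longrightarrow> u \<in> tangent_space M p \<Longrightarrow> v \<in> tangent_space M p \<Longrightarrow> w \<in> tangent_space M p \<Longrightarrow>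
   g p (\<lambda>f. u f - v f) w = g p u w - g p v w"
  using g_lin[of p u v w 1 "-1"] by simp

lemma g_scale_right: "p \<in> topspace (mtop M) \<Longrightarrow> u \<in> tangent_space M p \<Longrightarrow> w \<in> tangent_space M p \<Longrightarrow>
   g p w (\<lambda>f. a * u f) = a * g p w u"
  using g_lin_right[of p u u w a 0] by simp

lemma g_sum:
  assumes "p \<in> topspace (mtop M)" "w \<in> tangent_space M p"
  shows "(\<And>l. l \<in> L \<Longrightarrow> v l \<in> tangent_space M p) \<Longrightarrow> g p (\<lambda>f. \<Sum>l\<in>L. c l * v l f) w = (\<Sum>l\<in>L. c l * g p (v l) w)"
proof (induction L rule: infinite_finite_induct)
  case (insert l L)
  have "g p (\<lambda>f. c l * v l f + 1 * (\<Sum>l\<in>L. c l * v l f)) w = c l * g p (v l) w + 1 * g p (\<lambda>f. \<Sum>l\<in>L. c l * v l f) w"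
    by (rule g_lin[OF assms(1) _ _ assms(2)]) (auto intro!: tangent_space_sum insert.prems)
  then show ?case using insert by simp
qed (use g_0 assms in auto)

lemma g_sum_right:
  assumes "p \<in> topspace (mtop M)" "w \<in> tangent_space M p" "\<And>l. l \<in> L \<Longrightarrow> v l \<in> tangent_space M p"
  shows "g p w (\<lambda>f. \<Sum>l\<in>L. c l * v l f) = (\<Sum>l\<in>L. c l * g p w (v l))"
proof -
  have "g p w (\<lambda>f. \<Sum>l\<in>L. c l * v l f) = g p (\<lambda>f. \<Sum>l\<in>L. c l * v l f) w"
    by (rule g_sym[OF assms(1,2) tangent_space_sum[OF assms(3)]])
  also have "\<dots> = (\<Sum>l\<in>L. c l * g p (v l) w)" by (rule g_sum[OF assms])
  also have "\<dots> = (\<Sum>l\<in>L. c l * g p w (v l))"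
    by (intro sum.cong refl arg_cong2[of _ _ _ _ "(*)"] g_sym assms)
  finally show ?thesis .
qed

text \<open>The squares \<open>G k\<close> may be any nonzero numbers, because lifted frame vectors
  have square \<open>(b i t)\<^sup>2 * \<epsilon> i k\<close>.\<close>

definition orthogonal_at :: "'k set \<Rightarrow> 'a \<Rightarrow> ('k \<Rightarrow> 'a tvec) \<Rightarrow> ('k \<Rightarrow> real) \<Rightarrow> bool" where
  "orthogonal_at A p e G \<longleftrightarrow> (\<forall>k\<in>A. e k \<in> tangent_space M p \<and> G k \<noteq> 0) \<and>
     (\<forall>k\<in>A. \<forall>l\<in>A. g p (e k) (e l) = (if k = l then G k else 0))"

lemma orthogonal_independent:
  assumes p: "p \<in> topspace (mtop M)" and e: "orthogonal_at A p e G"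
  shows "inj_on e A" "\<not> tvec.dependent (e ` A)"
proof -
  let ?T = "tangent_space M p"
  have eT: "e k \<in> ?T" if "k \<in> A" for k using e that by (simp add: orthogonal_at_def)
  have s: "tvec.subspace {x \<in> ?T. g p x (e k) = 0}" if k: "k \<in> A" for k
  proof (rule tvec.subspaceI)
    show "0 \<in> {x \<in> ?T. g p x (e k) = 0}"
      using tangent_space_0[of p] g_0[OF p eT[OF k]] by (simp add: zero_fun_def)
    show "x + y \<in> {x \<in> ?T. g p x (e k) = 0}"
      if "x \<in> {x \<in> ?T. g p x (e k) = 0}" "y \<in> {x \<in> ?T. g p x (e k) = 0}" for x y
      using tangent_space_lin[of x p y 1 1] g_add[OF p _ _ eT[OF k], of x y] that by (simp add: plus_fun_def)
    show "(\<lambda>f. c * x f) \<in> {x \<in> ?T. g p x (e k) = 0}" if "x \<in> {x \<in> ?T. g p x (e k) = 0}" for c x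
      using tangent_space_scale[of x p c] g_scale[OF p _ eT[OF k], of x c] that by simp
  qed
  note * = dual_family_independent[where S = ?T and L = "\<lambda>k x. g p x (e k)" and e = e and K = A, OF s]
  show "inj_on e A"
    by (rule *(1)) (use e in \<open>auto simp: orthogonal_at_def\<close>)
  show "\<not> tvec.dependent (e ` A)"
    by (rule *(2)) (use e in \<open>auto simp: orthogonal_at_def\<close>)
qed

text \<open>An orthogonal family of full size spans the tangent space: another independent vector
  would exceed the number of coordinate vectors. The vectors that equal their expansion form a
  subspace containing the family, hence all tangent vectors.\<close>

lemma orthogonal_expand:
  assumes p: "p \<in> topspace (mtop M)" and e: "orthogonal_at (mindex M) p e G" and v: "v \<in> tangent_space M p"
  shows "v = (\<lambda>f. \<Sum>k\<in>mindex M. (g p v (e k) / G k) * e k f)"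
proof -
  let ?T = "tangent_space M p" and ?K = "mindex M"
  let ?ex = "\<lambda>v. (\<lambda>f. \<Sum>k\<in>?K. (g p v (e k) / G k) * e k f)"
  have eT: "e k \<in> ?T" if "k \<in> ?K" for k using e that by (simp add: orthogonal_at_def)
  obtain U \<phi> where U: "(U, \<phi>) \<in> matlas M" "p \<in> U" using charts_cover[OF p] by blast
  let ?C = "(\<lambda>k. coord_vf M U \<phi> k p) ` ?K"
  have "v \<in> tvec.span (e ` ?K)"
  proof (rule ccontr)
    assume nv: "v \<notin> tvec.span (e ` ?K)"
    then have i: "\<not> tvec.dependent (insert v (e ` ?K))"
      using orthogonal_independent(2)[OF p e] by (rule tvec.independent_insertI)
    have "insert v (e ` ?K) \<subseteq> tvec.span ?C"
      using tangent_in_coord_span[OF U] v eT by blast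
    then have "card (insert v (e ` ?K)) \<le> card ?C"
      using tvec.independent_span_bound[OF finite_imageI[OF finite_index] i] by blast
    also have "\<dots> \<le> card ?K" by (rule card_image_le[OF finite_index])
    finally have "card (insert v (e ` ?K)) \<le> card ?K" .
    moreover have "v \<notin> e ` ?K" using nv tvec.span_superset by blast
    ultimately show False
      using card_image[OF orthogonal_independent(1)[OF p e]] finite_index by simp
  qed
  moreover have "tvec.subspace {x \<in> ?T. x = ?ex x}"
  proof (rule tvec.subspaceI)
    show "0 \<in> {x \<in> ?T. x = ?ex x}"
      using tangent_space_0[of p] by (simp add: zero_fun_def g_0[OF p eT])
    fix x assume x: "x \<in> {x \<in> ?T. x = ?ex x}"
    then have xT: "x \<in> ?T" by blast
    show "(\<lambda>f. c * x f) \<in> {x \<in> ?T. x = ?ex x}" for c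
    proof -
      have "?ex (\<lambda>f. c * x f) = (\<lambda>f. c * ?ex x f)"
        using xT by (auto simp: g_scale[OF p _ eT] sum_distrib_left fun_eq_iff intro!: sum.cong)
      then have "(\<lambda>f. c * x f) = ?ex (\<lambda>f. c * x f)" using x by auto
      then show ?thesis using x tangent_space_scale by auto
    qed
    fix y assume y: "y \<in> {x \<in> ?T. x = ?ex x}"
    then have yT: "y \<in> ?T" by blast
    have "?ex (x + y) = (\<lambda>f. ?ex x f + ?ex y f)"
      using xT yT unfolding plus_fun_def
      by (auto simp: g_add[OF p _ _ eT] sum.distrib[symmetric] fun_eq_iff add_divide_distrib distrib_right intro!: sum.cong)
    moreover have ex: "?ex x = x" by (rule sym) (use x in blast)
    have ey: "?ex y = y" by (rule sym) (use y in blast)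
    have "(\<lambda>f. ?ex x f + ?ex y f) = x + y"
      unfolding plus_fun_def using fun_cong[OF ex] fun_cong[OF ey] by (intro ext arg_cong2[of _ _ _ _ "(+)"])
    ultimately have "x + y = ?ex (x + y)" by (rule trans[THEN sym])
    moreover have "x + y \<in> ?T" using x y tangent_space_lin[of x p y 1 1] by (simp add: plus_fun_def)
    ultimately show "x + y \<in> {x \<in> ?T. x = ?ex x}" by blast
  qed
  moreover have "e ` ?K \<subseteq> {x \<in> ?T. x = ?ex x}"
  proof (rule image_subsetI)
    fix l assume l: "l \<in> ?K"
    have "?ex (e l) = (\<lambda>f. \<Sum>k\<in>?K. if l = k then e k f else 0)"
      using e l by (intro ext sum.cong) (auto simp: orthogonal_at_def)
    then have "?ex (e l) = e l" using l finite_index by simp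
    then show "e l \<in> {x \<in> ?T. x = ?ex x}" using eT[OF l] by simp
  qed
  ultimately have "v \<in> {x \<in> ?T. x = ?ex x}" using tvec.span_minimal by blast
  then show ?thesis by blast
qed

text \<open>One Gram-Schmidt step. By the last claim pairings with vectors orthogonal to the family
  are unaffected, and so nondegeneracy is inherited by the orthogonal complement.\<close>

lemma orthogonal_projection:
  assumes p: "p \<in> topspace (mtop M)" and e: "orthogonal_at A p e G" and A: "finite A" and x: "x \<in> tangent_space M p"
  defines "y \<equiv> (\<lambda>f. x f + (\<Sum>k\<in>A. (- g p x (e k) / G k) * e k f))"
  shows "y \<in> tangent_space M p" "\<And>l. l \<in> A \<Longrightarrow> g p y (e l) = 0"
    and "w \<in> tangent_space M p \<Longrightarrow> (\<And>l. l \<in> A \<Longrightarrow> g p (e l) w = 0) \<Longrightarrow> g p y w = g p x w"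
proof -
  have eT: "e k \<in> tangent_space M p" if "k \<in> A" for k using e that by (simp add: orthogonal_at_def)
  have sT: "(\<lambda>f. \<Sum>k\<in>A. (- g p x (e k) / G k) * e k f) \<in> tangent_space M p"
    by (intro tangent_space_sum eT)
  show "y \<in> tangent_space M p" unfolding y_def using tangent_space_lin[OF x sT, of 1 1] by simp
  have gy: "g p y w = g p x w + (\<Sum>k\<in>A. (- g p x (e k) / G k) * g p (e k) w)"
    if w: "w \<in> tangent_space M p" for w
    unfolding y_def g_add[OF p x sT w] by (simp only: g_sum[OF p w eT])
  show "g p y (e l) = 0" if l: "l \<in> A" for l
  proof -
    have "(\<Sum>k\<in>A. (- g p x (e k) / G k) * g p (e k) (e l)) = (\<Sum>k\<in>A. if k = l then - g p x (e k) else 0)"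
      using e l by (intro sum.cong) (auto simp: orthogonal_at_def)
    then show ?thesis using gy[OF eT[OF l]] A l by simp
  qed
  show "w \<in> tangent_space M p \<Longrightarrow> (\<And>l. l \<in> A \<Longrightarrow> g p (e l) w = 0) \<Longrightarrow> g p y w = g p x w"
    using gy by simp
qed

end

locale pseudo_metric = charted_metric M g for M :: "('a, 'k) manifold" and g +
  assumes g_nondeg: "p \<in> topspace (mtop M) \<Longrightarrow> u \<in> tangent_space M p \<Longrightarrow>
    (\<And>v. v \<in> tangent_space M p \<Longrightarrow> g p u v = 0) \<Longrightarrow> u = (\<lambda>f. 0)"
begin

text \<open>In an indefinite metric the orthogonal complement may contain null vectors; if \<open>v\<close> and \<open>w\<close> are
  null with \<open>g(v, w) \<noteq> 0\<close>, then \<open>v + w\<close> is not null.\<close>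

lemma non_null_complement:
  assumes p: "p \<in> topspace (mtop M)" and e: "orthogonal_at A p e G" and A: "A \<subset> mindex M"
  obtains u where "u \<in> tangent_space M p" "g p u u \<noteq> 0" "\<And>l. l \<in> A \<Longrightarrow> g p u (e l) = 0"
proof -
  let ?T = "tangent_space M p" and ?K = "mindex M"
  have fA: "finite A" using A finite_index finite_subset by blast
  have eT: "e k \<in> ?T" if "k \<in> A" for k using e that by (simp add: orthogonal_at_def)
  obtain U \<phi> where U: "(U, \<phi>) \<in> matlas M" "p \<in> U" using charts_cover[OF p] by blast
  let ?c = "\<lambda>k. coord_vf M U \<phi> k p"
  \<comment> \<open>\<open>A\<close> is a proper subset of the index set, so by dimension some
    coordinate vector lies outside the span. Its projection is a nonzero vector of the
    complement.\<close>
  have "\<not> ?c ` ?K \<subseteq> tvec.span (e ` A)"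
  proof
    assume "?c ` ?K \<subseteq> tvec.span (e ` A)"
    then have "card (?c ` ?K) \<le> card (e ` A)"
      using tvec.independent_span_bound[OF finite_imageI[OF fA] coord_vf_independent(2)[OF U]] by blast
    also have "\<dots> \<le> card A" by (rule card_image_le[OF fA])
    also have "\<dots> < card ?K" by (rule psubset_card_mono[OF finite_index A])
    finally show False using card_image[OF coord_vf_independent(1)[OF U]] by simp
  qed
  then obtain k where k: "k \<in> ?K" "?c k \<notin> tvec.span (e ` A)" by blast
  have cT: "?c k \<in> ?T" by (rule coord_vf_tangent[OF U(1) k(1) U(2)])
  define pr where "pr x = (\<lambda>f. x f + (\<Sum>k\<in>A. (- g p x (e k) / G k) * e k f))" for x
  note pr = orthogonal_projection[OF p e fA, folded pr_def]
  define v where "v = pr (?c k)"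
  have vT: "v \<in> ?T" and ve: "\<And>l. l \<in> A \<Longrightarrow> g p v (e l) = 0"
    unfolding v_def using pr[OF cT] by auto
  have "v \<noteq> (\<lambda>f. 0)"
  proof
    assume "v = (\<lambda>f. 0)"
    then have "?c k f = (\<Sum>j\<in>A. (g p (?c k) (e j) / G j) * e j f)" for f
      by (simp add: v_def pr_def fun_eq_iff sum_negf add_eq_0_iff)
    then have "?c k = (\<lambda>f. \<Sum>j\<in>A. (g p (?c k) (e j) / G j) * e j f)" by (rule ext)
    also have "\<dots> \<in> tvec.span (e ` A)" by (intro tvec_lin_span fA tvec.span_base imageI)
    finally show False using k(2) by blast
  qed
  then obtain w0 where w0: "w0 \<in> ?T" "g p v w0 \<noteq> 0" using g_nondeg[OF p vT] by blast
  define w where "w = pr w0"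
  have wT: "w \<in> ?T" and we: "\<And>l. l \<in> A \<Longrightarrow> g p w (e l) = 0"
    unfolding w_def using pr[OF w0(1)] by auto
  \<comment> \<open>Projecting the witness \<open>w0\<close> of nondegeneracy keeps its pairing with
    \<open>v\<close>, which is already orthogonal to the family.\<close>
  have "g p w v = g p w0 v"
    unfolding w_def by (rule pr(3)[OF w0(1) vT]) (use ve g_sym[OF p eT vT] in auto)
  then have vw: "g p v w \<noteq> 0"
    using w0 g_sym[OF p vT wT] g_sym[OF p vT w0(1)] by simp
  show ?thesis
  proof (cases "g p v v = 0 \<and> g p w w = 0")
    case False
    then show ?thesis using that[OF vT _ ve] that[OF wT _ we] by blast
  next
    case True
    let ?s = "\<lambda>f. v f + w f"
    have sT: "?s \<in> ?T" using tangent_space_lin[OF vT wT, of 1 1] by simp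
    have "g p ?s ?s = g p v ?s + g p w ?s" by (rule g_add[OF p vT wT sT])
    also have "\<dots> = g p ?s v + g p ?s w" using g_sym[OF p sT] vT wT by simp
    also have "\<dots> = 2 * g p v w"
      using g_add[OF p vT wT vT] g_add[OF p vT wT wT] True g_sym[OF p vT wT] by simp
    finally have "g p ?s ?s \<noteq> 0" using vw by simp
    moreover have "g p ?s (e l) = 0" if "l \<in> A" for l
      using g_add[OF p vT wT eT[OF that]] ve[OF that] we[OF that] by simp
    ultimately show ?thesis using that[OF sT] by blast
  qed
qed

text \<open>Constant coefficients on the coordinate fields of a chart give an extension over the
  chart domain, with no cut-off function.\<close>

lemma extend_tangent:
  assumes p: "p \<in> topspace (mtop M)" and u: "u \<in> tangent_space M p"
  obtains U X where "openin (mtop M) U" "p \<in> U" "X \<in> vector_fields M U" "X p = u"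
proof -
  obtain U \<phi> where U: "(U, \<phi>) \<in> matlas M" "p \<in> U" using charts_cover[OF p] by blast
  let ?X = "vf_sum (mindex M) (\<lambda>k. vf_scale (\<lambda>_. u (\<lambda>q. \<phi> q k)) (coord_vf M U \<phi> k))"
  have "?X \<in> vector_fields M U"
    by (intro vf_sum_closed vf_scale_closed finite_index chart_open[OF U(1)] smooth_fun_const coord_vf_vector_field[OF U(1)])
  moreover have "?X p = u"
    using tangent_expand[OF U u] by (simp add: vf_sum_def vf_scale_def)
  ultimately show ?thesis using that[OF chart_open[OF U(1)] U(2)] by blast
qed

text \<open>Gram-Schmidt with shrinking neighbourhoods. A non-null vector orthogonal to the previous
  fields at \<open>p\<close> is extended to a field, corrected to be orthogonal to them near
  \<open>p\<close>, and divided by its length where its square keeps its sign.\<close>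

lemma partial_orthonormal_frame:
  assumes p: "p \<in> topspace (mtop M)"
  shows "finite A \<Longrightarrow> A \<subseteq> mindex M \<Longrightarrow> \<exists>U e \<epsilon>. openin (mtop M) U \<and> p \<in> U \<and> (\<forall>k\<in>A. e k \<in> vector_fields M U) \<and>
    (\<forall>k\<in>A. \<epsilon> k = 1 \<or> \<epsilon> k = - 1) \<and> (\<forall>q\<in>U. orthogonal_at A q (\<lambda>k. e k q) \<epsilon>)"
proof (induction A rule: finite_induct)
  case empty
  then show ?case
    by (intro exI[of _ "topspace (mtop M)"]) (auto simp: p orthogonal_at_def)
next
  case (insert a A)
  then have "A \<subseteq> mindex M" by blast
  from insert.IH[OF this] obtain U e \<epsilon> where U0: "openin (mtop M) U" "p \<in> U" "\<forall>k\<in>A. e k \<in> vector_fields M U"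
    "\<forall>k\<in>A. \<epsilon> k = 1 \<or> \<epsilon> k = - 1" "\<forall>q\<in>U. orthogonal_at A q (\<lambda>k. e k q) \<epsilon>"
    by (elim exE conjE)
  note U = U0(1,2) bspec[OF U0(3)] bspec[OF U0(4)] bspec[OF U0(5)]
  have "A \<subset> mindex M" using insert by blast
  from non_null_complement[OF p U(5)[OF U(2)] this]
  obtain u where u: "u \<in> tangent_space M p" "g p u u \<noteq> 0" "\<And>l. l \<in> A \<Longrightarrow> g p u (e l p) = 0" by blast
  obtain V X where V: "openin (mtop M) V" "p \<in> V" "X \<in> vector_fields M V" "X p = u"
    using extend_tangent[OF p u(1)] by blast
  define W where "W = U \<inter> V"
  have W: "openin (mtop M) W" "p \<in> W" "W \<subseteq> U" using U V by (auto simp: W_def)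
  have Wt: "q \<in> topspace (mtop M)" if "q \<in> W" for q using openin_topspace_subset[OF W(1) that] .
  have XW: "X \<in> vector_fields M W" using vf_subset[OF V(3)] by (simp add: W_def)
  have eW: "e k \<in> vector_fields M W" if "k \<in> A" for k using vf_subset[OF U(3)[OF that] W(3)] .
  have \<epsilon>: "\<epsilon> k \<noteq> 0" if "k \<in> A" for k using U(4)[OF that] by auto
  define Y where "Y = vf_add X (vf_sum A (\<lambda>k. vf_scale (\<lambda>q. - g q (X q) (e k q) * (1 / \<epsilon> k)) (e k)))"
  have YW: "Y \<in> vector_fields M W"
    unfolding Y_def
    by (intro vf_add_closed vf_sum_closed vf_scale_closed W(1) insert.hyps(1) XW eW smooth_fun_mult
        smooth_fun_minus g_smooth smooth_fun_const)
  have Yq: "Y q = (\<lambda>f. X q f + (\<Sum>k\<in>A. (- g q (X q) (e k q) / \<epsilon> k) * e k q f))" for q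
    by (simp add: Y_def vf_add_def vf_sum_def vf_scale_def)
  \<comment> \<open>\<open>u\<close> is orthogonal to the frame at \<open>p\<close>, so the
    correction vanishes there and \<open>Y p\<close> is still non-null.\<close>
  have Yp: "Y p = u" using u(3) V(4) by (simp add: Yq)
  have Ye: "g q (Y q) (e l q) = 0" if "l \<in> A" "q \<in> W" for l q
    unfolding Yq using that W(3) U(5)
    by (intro orthogonal_projection(2)[OF Wt _ insert.hyps(1) vfD[OF XW]]) auto
  \<comment> \<open>The sign makes \<open>\<sigma> * g q (Y q) (Y q)\<close> positive near
    \<open>p\<close>, as the power -1/2 requires. It becomes the square of the new frame
    field.\<close>
  define \<sigma> where "\<sigma> = sgn (g p u u)"
  have \<sigma>: "\<sigma> = 1 \<or> \<sigma> = - 1" using u(2) by (auto simp: \<sigma>_def sgn_if)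
  let ?h = "\<lambda>q. \<sigma> * g q (Y q) (Y q)"
  have hs: "smooth_fun M W ?h" by (intro smooth_fun_mult smooth_fun_const g_smooth W(1) YW)
  define W' where "W' = {q \<in> W. ?h q > 0}"
  have W': "openin (mtop M) W'" "W' \<subseteq> W" unfolding W'_def using smooth_fun_pos_open[OF W(1) hs] by auto
  have pW': "p \<in> W'" using W(2) u(2) by (auto simp: W'_def \<sigma>_def Yp sgn_if)
  define E where "E = vf_scale (\<lambda>q. ?h q powr (- 1 / 2)) Y"
  have EW: "E \<in> vector_fields M W'"
    unfolding E_def
    by (intro vf_scale_closed W' vf_subset[OF YW] smooth_fun_powr smooth_fun_subset[OF W(1) _ _ hs])
       (auto simp: W'_def)
  have Eq: "E q = (\<lambda>f. ?h q powr (- 1 / 2) * Y q f)" for q by (simp add: E_def vf_scale_def)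
  have YT: "Y q \<in> tangent_space M q" if "q \<in> W'" for q using vfD[OF YW] that W'(2) by blast
  have eT: "e k q \<in> tangent_space M q" if "k \<in> A" "q \<in> W'" for k q using vfD[OF eW[OF that(1)]] that(2) W'(2) by blast
  have W't: "q \<in> topspace (mtop M)" if "q \<in> W'" for q using openin_topspace_subset[OF W'(1) that] .
  have ET: "E q \<in> tangent_space M q" if "q \<in> W'" for q unfolding Eq using tangent_space_scale[OF YT[OF that]] .
  have EE: "g q (E q) (E q) = \<sigma>" if "q \<in> W'" for q
  proof -
    have pos: "?h q > 0" using that by (simp add: W'_def)
    have "g q (E q) (E q) = ?h q powr (- 1 / 2) * g q (Y q) (E q)"
      by (subst Eq) (rule g_scale[OF W't[OF that] YT[OF that] ET[OF that]])
    also have "g q (Y q) (E q) = ?h q powr (- 1 / 2) * g q (Y q) (Y q)"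
      by (subst Eq) (rule g_scale_right[OF W't[OF that] YT[OF that] YT[OF that]])
    also have "?h q powr (- 1 / 2) * (?h q powr (- 1 / 2) * g q (Y q) (Y q)) = ?h q powr (- 1) * g q (Y q) (Y q)"
      by (simp add: powr_add[symmetric] mult.assoc[symmetric])
    also have "\<dots> = \<sigma>" using pos \<sigma> by (auto simp: powr_minus field_simps)
    finally show ?thesis .
  qed
  have Ee: "g q (E q) (e l q) = 0" if "l \<in> A" "q \<in> W'" for l q
    unfolding Eq using g_scale[OF W't[OF that(2)] YT[OF that(2)] eT[OF that]] Ye[OF that(1)] that(2) W'(2) by auto
  have orth: "orthogonal_at (insert a A) q (\<lambda>k. (e(a := E)) k q) (\<epsilon>(a := \<sigma>))" if q: "q \<in> W'" for q
  proof -
    have "q \<in> U" using q W W' by blast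
    then have o: "orthogonal_at A q (\<lambda>k. e k q) \<epsilon>" by (rule U(5))
    have eE: "g q (e l q) (E q) = 0" if "l \<in> A" for l
      using g_sym[OF W't[OF q] eT[OF that q] ET[OF q]] Ee[OF that q] by simp
    show ?thesis
      using o insert.hyps(2) ET[OF q] EE[OF q] Ee[OF _ q] eE \<sigma>
      by (auto simp: orthogonal_at_def)
  qed
  have "\<forall>k\<in>insert a A. (e(a := E)) k \<in> vector_fields M W'"
    using EW vf_subset[OF eW W'(2)] insert.hyps(2) by auto
  moreover have "\<forall>k\<in>insert a A. (\<epsilon>(a := \<sigma>)) k = 1 \<or> (\<epsilon>(a := \<sigma>)) k = - 1"
    using U(4) \<sigma> insert.hyps(2) by auto
  ultimately show ?case using W'(1) pW' orth by blast
qed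

lemma ex_orthonormal_frame:
  assumes "p \<in> topspace (mtop M)"
  shows "\<exists>U E. openin (mtop M) U \<and> p \<in> U \<and> orthonormal_frame M g U E"
proof -
  from partial_orthonormal_frame[OF assms finite_index order_refl]
  obtain U e \<epsilon> where U: "openin (mtop M) U" "p \<in> U" "\<forall>k\<in>mindex M. e k \<in> vector_fields M U"
    "\<forall>k\<in>mindex M. \<epsilon> k = 1 \<or> \<epsilon> k = - 1" "\<forall>q\<in>U. orthogonal_at (mindex M) q (\<lambda>k. e k q) \<epsilon>"
    by (elim exE conjE)
  then have "orthonormal_frame M g U e"
    unfolding orthonormal_frame_def orthogonal_at_def by (intro conjI exI[of _ \<epsilon>]) auto
  then show ?thesis using U(1,2) by blast
qed

end

lemma pseudo_riemannian_pseudo_metric: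
  assumes "pseudo_riemannian M g"
  shows "pseudo_metric M g"
proof -
  note g = assms[unfolded pseudo_riemannian_def]
  interpret charted_space M using g smooth_manifold_charted by blast
  show ?thesis
  proof
    fix p u v assume p: "p \<in> topspace (mtop M)" and u: "u \<in> tangent_space M p"
    show "g p u v = g p v u" if "v \<in> tangent_space M p" using g p u that by blast
    show "g p (\<lambda>f. a * u f + c * v f) w = a * g p u w + c * g p v w"
      if "v \<in> tangent_space M p" "w \<in> tangent_space M p" for a c w using g p u that by blast
    show "u = (\<lambda>f. 0)" if "\<And>v. v \<in> tangent_space M p \<Longrightarrow> g p u v = 0" using g p u that by blast
  next
    fix U X Y assume "openin (mtop M) U" "X \<in> vector_fields M U" "Y \<in> vector_fields M U"
    then show "smooth_fun M U (\<lambda>p. g p (X p) (Y p))" using g by blast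
  qed
qed

section \<open>Curvature of a connection in a frame\<close>

text \<open>The clauses of \<open>affine_connection\<close> for a single open set. For the
  quarter-symmetric connection they are established only near a point, where \<open>d_dt\<close> has
  been shown to be a smooth field.\<close>

definition connection_on :: "('a, 'k) manifold \<Rightarrow> 'a set \<Rightarrow> 'a connection \<Rightarrow> bool" where
  "connection_on M U D \<longleftrightarrow>
     (\<forall>X\<in>vector_fields M U. \<forall>Y\<in>vector_fields M U.
      \<forall>X'\<in>vector_fields M U. \<forall>Y'\<in>vector_fields M U.
        (\<forall>p\<in>U. X p = X' p \<and> Y p = Y' p) \<longrightarrow> (\<forall>p\<in>U. D X Y p = D X' Y' p)) \<and>
     (\<forall>X\<in>vector_fields M U. \<forall>Y\<in>vector_fields M U. D X Y \<in> vector_fields M U) \<and>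
     (\<forall>X\<in>vector_fields M U. \<forall>Y\<in>vector_fields M U. \<forall>Z\<in>vector_fields M U. \<forall>p\<in>U. \<forall>f.
        D (vf_add X Y) Z p f = D X Z p f + D Y Z p f \<and>
        D X (vf_add Y Z) p f = D X Y p f + D X Z p f) \<and>
     (\<forall>h. \<forall>X\<in>vector_fields M U. \<forall>Y\<in>vector_fields M U. smooth_fun M U h \<longrightarrow> (\<forall>p\<in>U. \<forall>f.
        D (vf_scale h X) Y p f = h p * D X Y p f \<and>
        D X (vf_scale h Y) p f = X p h * Y p f + h p * D X Y p f))"

lemma affine_connection_iff:
  "affine_connection M D \<longleftrightarrow> (\<forall>U. openin (mtop M) U \<longrightarrow> connection_on M U D)"
  by (simp only: affine_connection_def connection_on_def)

lemma vf_add_apply: "vf_add X Y p f = X p f + Y p f"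
  by (simp add: vf_add_def)

lemma vf_scale_apply: "vf_scale h X p f = h p * X p f"
  by (simp add: vf_scale_def)

lemma vf_sum_apply: "vf_sum L X p f = (\<Sum>l\<in>L. X l p f)"
  by (simp add: vf_sum_def)

section \<open>Affine connections on one open set: the curvature is a tensor\<close>

locale local_connection = charted_space M for M :: "('a, 'k) manifold" +
  fixes U :: "'a set" and D :: "'a connection"
  assumes U_open: "openin (mtop M) U" and conn: "connection_on M U D"
begin

abbreviation VF :: "'a vfield set" where "VF \<equiv> vector_fields M U"

lemma D_cong:
  assumes "X \<in> VF" "Y \<in> VF" "X' \<in> VF" "Y' \<in> VF" "\<And>q. q \<in> U \<Longrightarrow> X q = X' q" "\<And>q. q \<in> U \<Longrightarrow> Y q = Y' q" "p \<in> U"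
  shows "D X Y p = D X' Y' p"
proof -
  have eq: "\<forall>p\<in>U. X p = X' p \<and> Y p = Y' p" by (intro ballI conjI assms(5,6))
  note c = conn[unfolded connection_on_def, THEN conjunct1]
  note c = c[THEN bspec, OF assms(1), THEN bspec, OF assms(2), THEN bspec, OF assms(3), THEN bspec, OF assms(4)]
  show ?thesis by (rule c[THEN mp, OF eq, THEN bspec, OF assms(7)])
qed

lemmas conn_rest = conn[unfolded connection_on_def, THEN conjunct2]

lemma D_closed: "X \<in> VF \<Longrightarrow> Y \<in> VF \<Longrightarrow> D X Y \<in> VF"
  using conn_rest[THEN conjunct1] by blast

lemma D_add_left: "X \<in> VF \<Longrightarrow> Y \<in> VF \<Longrightarrow> Z \<in> VF \<Longrightarrow> p \<in> U \<Longrightarrow> D (vf_add X Y) Z p f = D X Z p f + D Y Z p f"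
  using conn_rest[THEN conjunct2, THEN conjunct1] by simp

lemma D_add_right: "X \<in> VF \<Longrightarrow> Y \<in> VF \<Longrightarrow> Z \<in> VF \<Longrightarrow> p \<in> U \<Longrightarrow> D X (vf_add Y Z) p f = D X Y p f + D X Z p f"
  using conn_rest[THEN conjunct2, THEN conjunct1] by simp

lemma D_scale_left: "X \<in> VF \<Longrightarrow> Y \<in> VF \<Longrightarrow> smooth_fun M U h \<Longrightarrow> p \<in> U \<Longrightarrow> D (vf_scale h X) Y p f = h p * D X Y p f"
  using conn_rest[THEN conjunct2, THEN conjunct2] by simp

lemma D_scale_right: "X \<in> VF \<Longrightarrow> Y \<in> VF \<Longrightarrow> smooth_fun M U h \<Longrightarrow> p \<in> U \<Longrightarrow>
    D X (vf_scale h Y) p f = X p h * Y p f + h p * D X Y p f"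
  using conn_rest[THEN conjunct2, THEN conjunct2] by simp

lemma U_top: "p \<in> U \<Longrightarrow> p \<in> topspace (mtop M)"
  by (rule openin_topspace_subset[OF U_open])

text \<open>The zero field as a multiple of some field, so that the scaling laws evaluate connection
  and curvature at empty sums.\<close>

lemma vf_zero_scale: "(\<lambda>p f. 0) = vf_scale (\<lambda>_. 0) X"
  by (simp add: vf_scale_def)

lemma D_sum_right:
  assumes X: "X \<in> VF" and p: "p \<in> U"
  shows "finite L \<Longrightarrow> (\<And>l. l \<in> L \<Longrightarrow> B l \<in> VF) \<Longrightarrow> (\<And>l. l \<in> L \<Longrightarrow> smooth_fun M U (a l)) \<Longrightarrow>
    D X (vf_sum L (\<lambda>l. vf_scale (a l) (B l))) p f = (\<Sum>l\<in>L. X p (a l) * B l p f + a l p * D X (B l) p f)"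
proof (induction L rule: finite_induct)
  case empty
  have "D X (vf_scale (\<lambda>_. 0) X) p f = X p (\<lambda>_. 0) * X p f + 0 * D X X p f"
    by (rule D_scale_right[OF X X smooth_fun_const[OF U_open] p])
  then show ?case
    using tangent_const[OF vfD[OF X p] U_top[OF p], of 0] by (simp add: vf_sum_empty vf_zero_scale[of X])
next
  case (insert l L)
  have "vf_scale (a l) (B l) \<in> VF" "vf_sum L (\<lambda>l. vf_scale (a l) (B l)) \<in> VF"
    using insert by (auto intro!: vf_scale_closed vf_sum_closed U_open)
  then show ?case
    using insert by (simp add: vf_sum_insert D_add_right[OF X] D_scale_right[OF X] p)
qed

lemma lie_bracket_add:
  assumes "X \<in> VF" "X' \<in> VF" "Y \<in> VF" "p \<in> U"
  shows "lie_bracket M (vf_add X X') Y p = vf_add (lie_bracket M X Y) (lie_bracket M X' Y) p"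
proof
  fix f show "lie_bracket M (vf_add X X') Y p f = vf_add (lie_bracket M X Y) (lie_bracket M X' Y) p f"
    using tangent_add[OF vfD[OF assms(3,4)] vf_smooth_at[OF U_open assms(1,4)] vf_smooth_at[OF U_open assms(2,4)], of f f]
    by (simp add: lie_bracket_def vf_add_def)
qed

lemma lie_bracket_scale:
  assumes "X \<in> VF" "Y \<in> VF" "smooth_fun M U h" "p \<in> U"
  shows "lie_bracket M (vf_scale h X) Y p =
    vf_add (vf_scale h (lie_bracket M X Y)) (vf_scale (\<lambda>q. - Y q h) X) p"
proof
  fix f show "lie_bracket M (vf_scale h X) Y p f =
    vf_add (vf_scale h (lie_bracket M X Y)) (vf_scale (\<lambda>q. - Y q h) X) p f"
  proof (cases "smooth_at M p f")
    case True
    have "Y p (\<lambda>q. h q * X q f) = Y p h * X p f + h p * Y p (\<lambda>q. X q f)"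
      by (rule tangent_mult[OF vfD[OF assms(2,4)] smooth_atI[OF U_open assms(4,3)]
            vf_smooth_at[OF U_open assms(1,4) True]])
    then show ?thesis using True by (simp add: lie_bracket_def vf_add_def vf_scale_def algebra_simps)
  next
    case False
    then show ?thesis
      using tangent_nonsmooth[OF vfD[OF assms(1,4)]] by (simp add: lie_bracket_def vf_add_def vf_scale_def)
  qed
qed

lemma lie_bracket_swap: "lie_bracket M Y X p = vf_scale (\<lambda>_. - 1) (lie_bracket M X Y) p"
  by (auto simp: lie_bracket_def vf_scale_def)

lemma lie_bracket_cong:
  assumes "X \<in> VF" "Y \<in> VF" "X' \<in> VF" "Y' \<in> VF" "\<And>q. q \<in> U \<Longrightarrow> X q = X' q" "\<And>q. q \<in> U \<Longrightarrow> Y q = Y' q" "p \<in> U"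
  shows "lie_bracket M X Y p = lie_bracket M X' Y' p"
proof
  fix f
  have *: "V p (\<lambda>q. Z q f) = V' p (\<lambda>q. Z' q f)"
    if "V \<in> VF" "Z \<in> VF" "Z' \<in> VF" "V p = V' p" "\<And>q. q \<in> U \<Longrightarrow> Z q = Z' q" "smooth_at M p f" for V V' Z Z'
  proof -
    have "V p (\<lambda>q. Z q f) = V p (\<lambda>q. Z' q f)"
      by (rule tangent_cong[OF vfD[OF that(1) assms(7)] vf_smooth_at[OF U_open that(2) assms(7) that(6)]
            vf_smooth_at[OF U_open that(3) assms(7) that(6)] U_open assms(7)]) (simp only: that(5))
    then show ?thesis by (simp only: that(4))
  qed
  show "lie_bracket M X Y p f = lie_bracket M X' Y' p f"
    using *[of X Y Y' X', OF assms(1,2,4) assms(5)[OF assms(7)] assms(6)]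
      *[of Y X X' Y', OF assms(2,1,3) assms(6)[OF assms(7)] assms(5)]
    by (simp add: lie_bracket_def)
qed

lemmas lie_closed = lie_bracket_closed[OF U_open]
lemmas scale_closed = vf_scale_closed[OF U_open]

lemma curvature_cong:
  assumes "X \<in> VF" "Y \<in> VF" "Z \<in> VF" "X' \<in> VF" "Y' \<in> VF" "Z' \<in> VF"
    "\<And>q. q \<in> U \<Longrightarrow> X q = X' q" "\<And>q. q \<in> U \<Longrightarrow> Y q = Y' q" "\<And>q. q \<in> U \<Longrightarrow> Z q = Z' q" "p \<in> U"
  shows "curvature M D X Y Z p = curvature M D X' Y' Z' p"
proof -
  have "D X (D Y Z) p = D X' (D Y' Z') p"
    by (rule D_cong[OF assms(1) D_closed[OF assms(2,3)] assms(4) D_closed[OF assms(5,6)] assms(7)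
          D_cong[OF assms(2,3,5,6,8,9)] assms(10)])
  moreover have "D Y (D X Z) p = D Y' (D X' Z') p"
    by (rule D_cong[OF assms(2) D_closed[OF assms(1,3)] assms(5) D_closed[OF assms(4,6)] assms(8)
          D_cong[OF assms(1,3,4,6,7,9)] assms(10)])
  moreover have "D (lie_bracket M X Y) Z p = D (lie_bracket M X' Y') Z' p"
    by (rule D_cong[OF lie_closed[OF assms(1,2)] assms(3) lie_closed[OF assms(4,5)] assms(6)
          lie_bracket_cong[OF assms(1,2,4,5,7,8)] assms(9,10)])
  ultimately show ?thesis by (simp add: curvature_def)
qed

lemma curvature_add_left:
  assumes "X \<in> VF" "X' \<in> VF" "Y \<in> VF" "Z \<in> VF" "p \<in> U"
  shows "curvature M D (vf_add X X') Y Z p f = curvature M D X Y Z p f + curvature M D X' Y Z p f"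
proof -
  note XX = vf_add_closed[OF assms(1,2)]
  have "D (vf_add X X') (D Y Z) p f = D X (D Y Z) p f + D X' (D Y Z) p f"
    by (intro D_add_left D_closed assms)
  moreover have "D Y (D (vf_add X X') Z) p = D Y (vf_add (D X Z) (D X' Z)) p"
    by (rule D_cong) (auto intro!: D_closed vf_add_closed XX assms simp: D_add_left[OF assms(1,2,4)] vf_add_apply fun_eq_iff)
  moreover have "D Y (vf_add (D X Z) (D X' Z)) p f = D Y (D X Z) p f + D Y (D X' Z) p f"
    by (intro D_add_right D_closed assms)
  moreover have "D (lie_bracket M (vf_add X X') Y) Z p = D (vf_add (lie_bracket M X Y) (lie_bracket M X' Y)) Z p"
    by (rule D_cong) (auto intro!: lie_closed vf_add_closed XX assms lie_bracket_add)
  moreover have "D (vf_add (lie_bracket M X Y) (lie_bracket M X' Y)) Z p f =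
      D (lie_bracket M X Y) Z p f + D (lie_bracket M X' Y) Z p f"
    by (intro D_add_left lie_closed assms)
  ultimately show ?thesis by (simp add: curvature_def)
qed

text \<open>Differentiating the factor in \<open>D Y (D (vf_scale h X) Z)\<close> leaves the term (Y
  h) D_X Z. The summand -(Y h) X of the bracket [h X, Y] removes it.\<close>

lemma curvature_scale_left:
  assumes "X \<in> VF" "Y \<in> VF" "Z \<in> VF" "smooth_fun M U h" "p \<in> U"
  shows "curvature M D (vf_scale h X) Y Z p f = h p * curvature M D X Y Z p f"
proof -
  note hX = scale_closed[OF assms(1,4)]
  have Yh: "smooth_fun M U (\<lambda>q. - Y q h)"
    by (intro smooth_fun_minus U_open vf_smooth[OF assms(2)] order_refl assms(4))
  have "D (vf_scale h X) (D Y Z) p f = h p * D X (D Y Z) p f"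
    by (intro D_scale_left D_closed assms)
  moreover have "D Y (D (vf_scale h X) Z) p = D Y (vf_scale h (D X Z)) p"
    by (rule D_cong) (auto intro!: D_closed scale_closed hX assms simp: D_scale_left[OF assms(1,3,4)] vf_scale_apply fun_eq_iff)
  moreover have "D Y (vf_scale h (D X Z)) p f = Y p h * D X Z p f + h p * D Y (D X Z) p f"
    by (intro D_scale_right D_closed assms)
  moreover have "D (lie_bracket M (vf_scale h X) Y) Z p =
      D (vf_add (vf_scale h (lie_bracket M X Y)) (vf_scale (\<lambda>q. - Y q h) X)) Z p"
    by (rule D_cong) (auto intro!: lie_closed vf_add_closed scale_closed hX Yh assms lie_bracket_scale)
  moreover have "D (vf_add (vf_scale h (lie_bracket M X Y)) (vf_scale (\<lambda>q. - Y q h) X)) Z p f =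
      D (vf_scale h (lie_bracket M X Y)) Z p f + D (vf_scale (\<lambda>q. - Y q h) X) Z p f"
    by (intro D_add_left lie_closed scale_closed Yh assms)
  moreover have "D (vf_scale h (lie_bracket M X Y)) Z p f = h p * D (lie_bracket M X Y) Z p f"
    by (intro D_scale_left lie_closed assms)
  moreover have "D (vf_scale (\<lambda>q. - Y q h) X) Z p f = - Y p h * D X Z p f"
    by (intro D_scale_left Yh assms)
  ultimately show ?thesis by (simp add: curvature_def algebra_simps)
qed

lemma curvature_swap:
  assumes "X \<in> VF" "Y \<in> VF" "Z \<in> VF" "p \<in> U"
  shows "curvature M D X Y Z p f = - curvature M D Y X Z p f"
proof -
  have "D (lie_bracket M X Y) Z p = D (vf_scale (\<lambda>_. - 1) (lie_bracket M Y X)) Z p"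
    by (rule D_cong) (auto intro!: lie_closed scale_closed smooth_fun_const U_open assms lie_bracket_swap)
  moreover have "D (vf_scale (\<lambda>_. - 1) (lie_bracket M Y X)) Z p f = - 1 * D (lie_bracket M Y X) Z p f"
    by (intro D_scale_left lie_closed smooth_fun_const U_open assms)
  ultimately show ?thesis by (simp add: curvature_def)
qed

lemma curvature_add_third:
  assumes "X \<in> VF" "Y \<in> VF" "Z \<in> VF" "Z' \<in> VF" "p \<in> U"
  shows "curvature M D X Y (vf_add Z Z') p f = curvature M D X Y Z p f + curvature M D X Y Z' p f"
proof -
  have *: "D V (D W (vf_add Z Z')) p f = D V (D W Z) p f + D V (D W Z') p f" if "V \<in> VF" "W \<in> VF" for V W
  proof -
    have "D V (D W (vf_add Z Z')) p = D V (vf_add (D W Z) (D W Z')) p"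
      by (rule D_cong) (auto intro!: D_closed vf_add_closed that assms simp: D_add_right[OF that(2) assms(3,4)] vf_add_apply fun_eq_iff)
    moreover have "D V (vf_add (D W Z) (D W Z')) p f = D V (D W Z) p f + D V (D W Z') p f"
      by (intro D_add_right D_closed assms that)
    ultimately show ?thesis by simp
  qed
  have "D (lie_bracket M X Y) (vf_add Z Z') p f = D (lie_bracket M X Y) Z p f + D (lie_bracket M X Y) Z' p f"
    by (intro D_add_right lie_closed assms)
  then show ?thesis using *[OF assms(1,2)] *[OF assms(2,1)] by (simp add: curvature_def)
qed

text \<open>The terms with one derivative of \<open>h\<close> are symmetric in \<open>X\<close> and
  \<open>Y\<close> and cancel. The second derivatives leave X(Y h) - Y(X h), which the derivative of
  \<open>h\<close> along the bracket takes away.\<close>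

lemma curvature_scale_third:
  assumes "X \<in> VF" "Y \<in> VF" "Z \<in> VF" "smooth_fun M U h" "p \<in> U"
  shows "curvature M D X Y (vf_scale h Z) p f = h p * curvature M D X Y Z p f"
proof -
  have *: "D V (D W (vf_scale h Z)) p f =
      V p (\<lambda>q. W q h) * Z p f + W p h * D V Z p f + (V p h * D W Z p f + h p * D V (D W Z) p f)"
    if "V \<in> VF" "W \<in> VF" for V W
  proof -
    have Wh: "smooth_fun M U (\<lambda>q. W q h)" by (intro vf_smooth[OF that(2)] U_open order_refl assms(4))
    have "D V (D W (vf_scale h Z)) p = D V (vf_add (vf_scale (\<lambda>q. W q h) Z) (vf_scale h (D W Z))) p"
      by (rule D_cong) (auto intro!: D_closed vf_add_closed scale_closed Wh that assms
          simp: D_scale_right[OF that(2) assms(3,4)] vf_add_apply vf_scale_apply fun_eq_iff)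
    moreover have "D V (vf_add (vf_scale (\<lambda>q. W q h) Z) (vf_scale h (D W Z))) p f =
        D V (vf_scale (\<lambda>q. W q h) Z) p f + D V (vf_scale h (D W Z)) p f"
      by (intro D_add_right D_closed scale_closed Wh assms that)
    moreover have "D V (vf_scale (\<lambda>q. W q h) Z) p f = V p (\<lambda>q. W q h) * Z p f + W p h * D V Z p f"
      by (intro D_scale_right Wh assms that)
    moreover have "D V (vf_scale h (D W Z)) p f = V p h * D W Z p f + h p * D V (D W Z) p f"
      by (intro D_scale_right D_closed assms that)
    ultimately show ?thesis by simp
  qed
  have "D (lie_bracket M X Y) (vf_scale h Z) p f = lie_bracket M X Y p h * Z p f + h p * D (lie_bracket M X Y) Z p f"
    by (intro D_scale_right lie_closed assms)
  moreover have "lie_bracket M X Y p h = X p (\<lambda>q. Y q h) - Y p (\<lambda>q. X q h)"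
    using smooth_atI[OF U_open assms(5,4)] by (simp add: lie_bracket_def)
  ultimately show ?thesis using *[OF assms(1,2)] *[OF assms(2,1)] by (simp add: curvature_def algebra_simps)
qed

lemma curvature_sum_left:
  assumes Y: "Y \<in> VF" and Z: "Z \<in> VF" and p: "p \<in> U"
  shows "finite L \<Longrightarrow> (\<And>l. l \<in> L \<Longrightarrow> B l \<in> VF) \<Longrightarrow> (\<And>l. l \<in> L \<Longrightarrow> smooth_fun M U (a l)) \<Longrightarrow>
    curvature M D (vf_sum L (\<lambda>l. vf_scale (a l) (B l))) Y Z p f = (\<Sum>l\<in>L. a l p * curvature M D (B l) Y Z p f)"
proof (induction L rule: finite_induct)
  case empty
  have "curvature M D (vf_scale (\<lambda>_. 0) Y) Y Z p f = 0 * curvature M D Y Y Z p f"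
    by (rule curvature_scale_left[OF Y Y Z smooth_fun_const[OF U_open] p])
  then show ?case by (simp add: vf_sum_empty vf_zero_scale[of Y])
next
  case (insert l L)
  have "vf_scale (a l) (B l) \<in> VF" "vf_sum L (\<lambda>l. vf_scale (a l) (B l)) \<in> VF"
    using insert by (auto intro!: scale_closed vf_sum_closed U_open)
  then show ?case
    using insert Y Z p by (simp add: vf_sum_insert curvature_add_left curvature_scale_left)
qed

lemma curvature_sum_third:
  assumes X: "X \<in> VF" and Y: "Y \<in> VF" and p: "p \<in> U"
  shows "finite L \<Longrightarrow> (\<And>l. l \<in> L \<Longrightarrow> B l \<in> VF) \<Longrightarrow> (\<And>l. l \<in> L \<Longrightarrow> smooth_fun M U (a l)) \<Longrightarrow>
    curvature M D X Y (vf_sum L (\<lambda>l. vf_scale (a l) (B l))) p f = (\<Sum>l\<in>L. a l p * curvature M D X Y (B l) p f)"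
proof (induction L rule: finite_induct)
  case empty
  have "curvature M D X Y (vf_scale (\<lambda>_. 0) Y) p f = 0 * curvature M D X Y Y p f"
    by (rule curvature_scale_third[OF X Y Y smooth_fun_const[OF U_open] p])
  then show ?case by (simp add: vf_sum_empty vf_zero_scale[of Y])
next
  case (insert l L)
  have "vf_scale (a l) (B l) \<in> VF" "vf_sum L (\<lambda>l. vf_scale (a l) (B l)) \<in> VF"
    using insert by (auto intro!: scale_closed vf_sum_closed U_open)
  then show ?case
    using insert X Y p by (simp add: vf_sum_insert curvature_add_third curvature_scale_third)
qed

text \<open>Antisymmetry moves the sum to the first argument.\<close>

lemma curvature_sum_mid:
  assumes "X \<in> VF" "Z \<in> VF" "p \<in> U" "finite L" "\<And>l. l \<in> L \<Longrightarrow> B l \<in> VF" "\<And>l. l \<in> L \<Longrightarrow> smooth_fun M U (a l)"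
  shows "curvature M D X (vf_sum L (\<lambda>l. vf_scale (a l) (B l))) Z p f = (\<Sum>l\<in>L. a l p * curvature M D X (B l) Z p f)"
proof -
  have "vf_sum L (\<lambda>l. vf_scale (a l) (B l)) \<in> VF"
    using assms by (auto intro!: scale_closed vf_sum_closed U_open)
  note curvature_swap[OF assms(1) this assms(2,3), of f]
  moreover have "curvature M D (vf_sum L (\<lambda>l. vf_scale (a l) (B l))) X Z p f =
      (\<Sum>l\<in>L. a l p * curvature M D (B l) X Z p f)"
    by (intro curvature_sum_left assms)
  ultimately show ?thesis
    using curvature_swap[OF assms(1) assms(5) assms(2,3)] by (simp add: sum_negf)
qed

lemma curvature_tangent:
  assumes "X \<in> VF" "Y \<in> VF" "Z \<in> VF" "p \<in> U"
  shows "curvature M D X Y Z p \<in> tangent_space M p"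
proof -
  have T: "V p \<in> tangent_space M p" if "V \<in> VF" for V using vfD[OF that assms(4)] .
  have 1: "D X (D Y Z) p \<in> tangent_space M p" "D Y (D X Z) p \<in> tangent_space M p"
    "D (lie_bracket M X Y) Z p \<in> tangent_space M p"
    by (intro T D_closed lie_closed assms)+
  from tangent_space_lin[OF tangent_space_lin[OF 1(1,2), of 1 "- 1"] 1(3), of 1 "- 1"]
  show ?thesis by (simp add: curvature_def)
qed

end

text \<open>The component of R(B_a, B_b) B_d along B_c, where \<open>\<Gamma> a b c\<close> is the
  coefficient of B_c in the derivative of B_b along B_a and \<open>C a b c\<close> its coefficient
  in [B_a, B_b]. The last sum accounts for a frame that is not a coordinate frame.\<close>

definition curvature_coeff ::
    "'l set \<Rightarrow> ('l \<Rightarrow> 'a vfield) \<Rightarrow> ('l \<Rightarrow> 'l \<Rightarrow> 'l \<Rightarrow> 'a \<Rightarrow> real) \<Rightarrow> ('l \<Rightarrow> 'l \<Rightarrow> 'l \<Rightarrow> 'a \<Rightarrow> real) \<Rightarrow>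
     'l \<Rightarrow> 'l \<Rightarrow> 'l \<Rightarrow> 'l \<Rightarrow> 'a \<Rightarrow> real" where
  "curvature_coeff K B \<Gamma> C a b d c p = B a p (\<Gamma> b d c) - B b p (\<Gamma> a d c) +
     (\<Sum>e\<in>K. \<Gamma> b d e p * \<Gamma> a e c p - \<Gamma> a d e p * \<Gamma> b e c p) - (\<Sum>e\<in>K. C a b e p * \<Gamma> e d c p)"

lemma sum_mult_swap:
  "(\<Sum>c\<in>K. x c * (\<Sum>e\<in>L. y c e * z e)) = (\<Sum>e\<in>L. (\<Sum>c\<in>K. x c * y c e) * (z e :: real))"
proof -
  have "(\<Sum>c\<in>K. x c * (\<Sum>e\<in>L. y c e * z e)) = (\<Sum>c\<in>K. \<Sum>e\<in>L. x c * y c e * z e)"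
    by (simp add: sum_distrib_left mult.assoc)
  also have "\<dots> = (\<Sum>e\<in>L. \<Sum>c\<in>K. x c * y c e * z e)" by (rule sum.swap)
  finally show ?thesis by (simp add: sum_distrib_right)
qed

lemma (in local_connection) curvature_in_frame:
  assumes K: "finite K" and B: "\<And>a. a \<in> K \<Longrightarrow> B a \<in> VF"
    and \<Gamma>: "\<And>a b c. a \<in> K \<Longrightarrow> b \<in> K \<Longrightarrow> c \<in> K \<Longrightarrow> smooth_fun M U (\<Gamma> a b c)"
    "\<And>a b q f. a \<in> K \<Longrightarrow> b \<in> K \<Longrightarrow> q \<in> U \<Longrightarrow> D (B a) (B b) q f = (\<Sum>c\<in>K. \<Gamma> a b c q * B c q f)"
    and C: "\<And>a b c. a \<in> K \<Longrightarrow> b \<in> K \<Longrightarrow> c \<in> K \<Longrightarrow> smooth_fun M U (C a b c)"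
    "\<And>a b q f. a \<in> K \<Longrightarrow> b \<in> K \<Longrightarrow> q \<in> U \<Longrightarrow> lie_bracket M (B a) (B b) q f = (\<Sum>c\<in>K. C a b c q * B c q f)"
    and p: "p \<in> U" and abd: "a \<in> K" "b \<in> K" "d \<in> K"
  shows "curvature M D (B a) (B b) (B d) p f = (\<Sum>c\<in>K. curvature_coeff K B \<Gamma> C a b d c p * B c p f)"
proof -
  have sumVF: "vf_sum K (\<lambda>c. vf_scale (h c) (B c)) \<in> VF" if "\<And>c. c \<in> K \<Longrightarrow> smooth_fun M U (h c)" for h
    using that K B by (intro vf_sum_closed U_open scale_closed)
  have second: "D (B i) (D (B j) (B d)) p f =
      (\<Sum>c\<in>K. B i p (\<Gamma> j d c) * B c p f) + (\<Sum>c\<in>K. (\<Sum>e\<in>K. \<Gamma> j d e p * \<Gamma> i e c p) * B c p f)"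
    if ij: "i \<in> K" "j \<in> K" for i j
  proof -
    have eq: "D (B i) (D (B j) (B d)) p = D (B i) (vf_sum K (\<lambda>c. vf_scale (\<Gamma> j d c) (B c))) p"
      by (rule D_cong) (auto intro!: D_closed sumVF B \<Gamma>(1) abd p ij simp: \<Gamma>(2) ij abd vf_sum_apply vf_scale_apply fun_eq_iff)
    have "D (B i) (D (B j) (B d)) p f = D (B i) (vf_sum K (\<lambda>c. vf_scale (\<Gamma> j d c) (B c))) p f"
      by (simp only: eq)
    also have "\<dots> =
        (\<Sum>c\<in>K. B i p (\<Gamma> j d c) * B c p f + \<Gamma> j d c p * D (B i) (B c) p f)"
      using ij abd by (intro D_sum_right B p K \<Gamma>(1))
    also have "\<dots> = (\<Sum>c\<in>K. B i p (\<Gamma> j d c) * B c p f) + (\<Sum>c\<in>K. \<Gamma> j d c p * (\<Sum>e\<in>K. \<Gamma> i c e p * B e p f))"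
      using ij p by (simp add: sum.distrib \<Gamma>(2))
    finally show ?thesis by (simp only: sum_mult_swap)
  qed
  have eq: "D (lie_bracket M (B a) (B b)) (B d) p = D (vf_sum K (\<lambda>c. vf_scale (C a b c) (B c))) (B d) p"
    by (rule D_cong) (auto intro!: lie_closed sumVF B C(1) abd p simp: C(2) abd vf_sum_apply vf_scale_apply fun_eq_iff)
  have "D (lie_bracket M (B a) (B b)) (B d) p f = D (vf_sum K (\<lambda>c. vf_scale (C a b c) (B c))) (B d) p f"
    by (simp only: eq)
  also have "\<dots> = (\<Sum>e\<in>K. C a b e p * D (B e) (B d) p f)"
  proof -
    \<comment> \<open>The induction runs over subsets of \<open>K\<close>, which keeps the
      smoothness of \<open>B\<close> and \<open>C\<close> available for every index met.\<close>
    have "D (vf_sum L (\<lambda>c. vf_scale (C a b c) (B c))) (B d) p f = (\<Sum>e\<in>L. C a b e p * D (B e) (B d) p f)"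
      if "finite L" "L \<subseteq> K" for L
      using that
    proof (induction L rule: finite_induct)
      case empty
      have "D (vf_scale (\<lambda>_. 0) (B d)) (B d) p f = 0 * D (B d) (B d) p f"
        by (intro D_scale_left B abd smooth_fun_const U_open p)
      then show ?case by (simp add: vf_sum_empty vf_zero_scale[of "B d"])
    next
      case (insert l L)
      have "vf_scale (C a b l) (B l) \<in> VF" "vf_sum L (\<lambda>l. vf_scale (C a b l) (B l)) \<in> VF"
        using insert abd by (auto intro!: scale_closed vf_sum_closed U_open B C(1))
      then show ?case
        using insert abd by (simp add: vf_sum_insert D_add_left D_scale_left p B C(1))
    qed
    then show ?thesis using K by simp
  qed
  also have "\<dots> = (\<Sum>e\<in>K. C a b e p * (\<Sum>c\<in>K. \<Gamma> e d c p * B c p f))"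
    using abd p by (simp add: \<Gamma>(2))
  also have "\<dots> = (\<Sum>c\<in>K. (\<Sum>e\<in>K. C a b e p * \<Gamma> e d c p) * B c p f)" by (rule sum_mult_swap)
  finally have "D (lie_bracket M (B a) (B b)) (B d) p f = (\<Sum>c\<in>K. (\<Sum>e\<in>K. C a b e p * \<Gamma> e d c p) * B c p f)" .
  then show ?thesis
    using second[OF abd(1,2)] second[OF abd(2,1)]
    by (simp add: curvature_def curvature_coeff_def sum.distrib sum_subtractf algebra_simps)
qed

text \<open>Written as f (f f)^(-1), since \<open>f\<close> may be negative and real powers are
  taken of positive functions only.\<close>

lemma (in charted_space) smooth_fun_inverse:
  assumes "openin (mtop M) U" "smooth_fun M U f" "\<And>p. p \<in> U \<Longrightarrow> f p \<noteq> 0"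
  shows "smooth_fun M U (\<lambda>p. 1 / f p)"
proof -
  have pos: "f p * f p > 0" if "p \<in> U" for p using assms(3)[OF that] by (auto simp: zero_less_mult_iff)
  have "smooth_fun M U (\<lambda>p. f p * (f p * f p) powr (- 1))"
    by (intro smooth_fun_mult smooth_fun_powr assms(1,2) pos)
  then show ?thesis
  proof (rule smooth_fun_cong[OF assms(1), rotated])
    fix p assume "p \<in> U"
    then show "f p * (f p * f p) powr (- 1) = 1 / f p"
      using pos[of p] assms(3)[of p] by (simp add: powr_minus field_simps)
  qed
qed

lemma sum_swap_divide:
  "(\<Sum>a\<in>K. x a * (\<Sum>d\<in>L. y a d / z d)) = (\<Sum>d\<in>L. (\<Sum>a\<in>K. x a * y a d) / (z d :: real))"
proof -
  have "(\<Sum>a\<in>K. x a * (\<Sum>d\<in>L. y a d / z d)) = (\<Sum>a\<in>K. \<Sum>d\<in>L. x a * y a d / z d)"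
    by (simp add: sum_distrib_left)
  also have "\<dots> = (\<Sum>d\<in>L. \<Sum>a\<in>K. x a * y a d / z d)" by (rule sum.swap)
  finally show ?thesis by (simp add: sum_divide_distrib)
qed

text \<open>\<open>A\<close> is the matrix of an orthonormal frame in terms of an orthogonal one.
  The hypothesis says that it carries the inverse Gram matrix diag(\<epsilon>) of the first to
  diag(1/G) of the second, so a trace may be taken in either frame.\<close>

lemma double_trace:
  fixes A :: "'a \<Rightarrow> 'c \<Rightarrow> real"
  assumes "finite L" "\<And>c e. c \<in> L \<Longrightarrow> e \<in> L \<Longrightarrow> (\<Sum>a\<in>K. \<epsilon> a * A a c * A a e) = (if c = e then 1 / G c else 0)"
  shows "(\<Sum>a\<in>K. \<epsilon> a * (\<Sum>c\<in>L. \<Sum>e\<in>L. A a c * A a e * T c e)) = (\<Sum>c\<in>L. T c c / G c)"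
proof -
  have "(\<Sum>a\<in>K. \<epsilon> a * (\<Sum>c\<in>L. \<Sum>e\<in>L. A a c * A a e * T c e)) =
      (\<Sum>a\<in>K. \<Sum>c\<in>L. \<Sum>e\<in>L. \<epsilon> a * A a c * A a e * T c e)"
    by (simp add: sum_distrib_left mult.assoc)
  also have "\<dots> = (\<Sum>c\<in>L. \<Sum>a\<in>K. \<Sum>e\<in>L. \<epsilon> a * A a c * A a e * T c e)" by (rule sum.swap)
  also have "\<dots> = (\<Sum>c\<in>L. \<Sum>e\<in>L. \<Sum>a\<in>K. \<epsilon> a * A a c * A a e * T c e)" by (intro sum.cong refl sum.swap)
  also have "\<dots> = (\<Sum>c\<in>L. \<Sum>e\<in>L. (if c = e then 1 / G c else 0) * T c e)"
    by (intro sum.cong refl) (simp only: sum_distrib_right[symmetric] assms(2))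
  also have "\<dots> = (\<Sum>c\<in>L. \<Sum>e\<in>L. if c = e then T c e / G c else 0)"
    by (intro sum.cong refl) auto
  also have "\<dots> = (\<Sum>c\<in>L. T c c / G c)" using assms(1) by (intro sum.cong refl) simp
  finally show ?thesis .
qed

section \<open>Scalar curvature in an orthogonal frame, and connections of a metric\<close>

context charted_metric
begin

text \<open>The frame picked by \<open>SOME\<close> is expanded in \<open>B\<close> with smooth
  coefficients, and tensoriality moves both traces to \<open>B\<close>. Only one division, by
  \<open>G a\<close>, is left: the trace over \<open>b\<close> divides by \<open>G b\<close>, while
  pairing the component along \<open>B b\<close> with \<open>B b\<close> multiplies by it. The
  connection laws are assumed on all open subsets of \<open>U\<close> because the picked frame lives
  on a smaller set.\<close>

lemma scalar_curvature_frame: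
  assumes p: "p \<in> U" and U: "openin (mtop M) U"
    and conn: "\<And>V. openin (mtop M) V \<Longrightarrow> V \<subseteq> U \<Longrightarrow> connection_on M V D"
    and B: "\<And>a. a \<in> mindex M \<Longrightarrow> B a \<in> vector_fields M U"
    and G: "\<And>q. q \<in> U \<Longrightarrow> orthogonal_at (mindex M) q (\<lambda>k. B k q) (\<lambda>k. G k q)"
    and \<Gamma>: "\<And>a b c. a \<in> mindex M \<Longrightarrow> b \<in> mindex M \<Longrightarrow> c \<in> mindex M \<Longrightarrow> smooth_fun M U (\<Gamma> a b c)"
    "\<And>a b q f. a \<in> mindex M \<Longrightarrow> b \<in> mindex M \<Longrightarrow> q \<in> U \<Longrightarrow> D (B a) (B b) q f = (\<Sum>c\<in>mindex M. \<Gamma> a b c q * B c q f)"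
    and C: "\<And>a b c. a \<in> mindex M \<Longrightarrow> b \<in> mindex M \<Longrightarrow> c \<in> mindex M \<Longrightarrow> smooth_fun M U (C a b c)"
    "\<And>a b q f. a \<in> mindex M \<Longrightarrow> b \<in> mindex M \<Longrightarrow> q \<in> U \<Longrightarrow> lie_bracket M (B a) (B b) q f = (\<Sum>c\<in>mindex M. C a b c q * B c q f)"
    and ex: "\<exists>U E. openin (mtop M) U \<and> p \<in> U \<and> orthonormal_frame M g U E"
  shows "scalar_curvature M g D p =
    (\<Sum>a\<in>mindex M. \<Sum>b\<in>mindex M. curvature_coeff (mindex M) B \<Gamma> C a b a b p / G a p)"
proof -
  let ?K = "mindex M"
  define E where "E = frame_around M g p"
  \<comment> \<open>Quantifiers in the order of \<open>frame_around\<close>; existence makes the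
    picked \<open>E\<close> a genuine orthonormal frame.\<close>
  have "\<exists>E. \<exists>U. openin (mtop M) U \<and> p \<in> U \<and> orthonormal_frame M g U E" using ex by blast
  then have "\<exists>U. openin (mtop M) U \<and> p \<in> U \<and> orthonormal_frame M g U E"
    unfolding E_def frame_around_def by (rule someI_ex)
  then obtain U' where U': "openin (mtop M) U'" "p \<in> U'" "orthonormal_frame M g U' E" by blast
  define W where "W = U \<inter> U'"
  have W: "openin (mtop M) W" "W \<subseteq> U" "W \<subseteq> U'" "p \<in> W" using U p U' by (auto simp: W_def)
  interpret local_connection M W D
    using W conn by unfold_locales
  have EW: "E a \<in> VF" if "a \<in> ?K" for a
    using U'(3) that vf_subset[OF _ W(3)] unfolding orthonormal_frame_def by blast
  have BW: "B a \<in> VF" if "a \<in> ?K" for a using vf_subset[OF B[OF that] W(2)] .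
  have ET: "E a q \<in> tangent_space M q" if "a \<in> ?K" "q \<in> W" for a q using vfD[OF EW[OF that(1)] that(2)] .
  have BT: "B a q \<in> tangent_space M q" if "a \<in> ?K" "q \<in> W" for a q using vfD[OF BW[OF that(1)] that(2)] .
  from U'(3) obtain \<epsilon> where \<epsilon>0: "\<forall>k\<in>?K. \<epsilon> k = 1 \<or> \<epsilon> k = - 1"
    and E\<epsilon>: "\<forall>q\<in>U'. \<forall>k\<in>?K. \<forall>l\<in>?K. g q (E k q) (E l q) = (if k = l then \<epsilon> k else 0)"
    unfolding orthonormal_frame_def by (elim exE conjE)
  note \<epsilon> = bspec[OF \<epsilon>0]
  have gE': "g p (E k p) (E l p) = (if k = l then \<epsilon> k else 0)" if "k \<in> ?K" "l \<in> ?K" for k l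
    using E\<epsilon>[THEN bspec, OF U'(2), THEN bspec, OF that(1), THEN bspec, OF that(2)] .
  have oE: "orthogonal_at ?K p (\<lambda>k. E k p) \<epsilon>"
    unfolding orthogonal_at_def
  proof (intro conjI ballI)
    show "\<epsilon> k \<noteq> 0" if "k \<in> ?K" for k using \<epsilon>[OF that] by auto
  qed (use ET[OF _ W(4)] gE' in simp_all)
  have oB: "orthogonal_at ?K q (\<lambda>k. B k q) (\<lambda>k. G k q)" if "q \<in> W" for q by (rule G[OF subsetD[OF W(2) that]])
  have Gnz: "G a q \<noteq> 0" if "a \<in> ?K" "q \<in> W" for a q
    using oB[OF that(2), unfolded orthogonal_at_def] that(1) by simp
  have gB: "g q (B a q) (B b q) = (if a = b then G a q else 0)" if "a \<in> ?K" "b \<in> ?K" "q \<in> W" for a b q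
    using oB[OF that(3), unfolded orthogonal_at_def] that(1,2) by simp
  \<comment> \<open>Expressed by the metric instead of \<open>G\<close>, so that smoothness follows
    from \<open>g_smooth\<close>; on \<open>W\<close> the denominators agree with
    \<open>G c q\<close>.\<close>
  define A where "A a c q = g q (E a q) (B c q) * (1 / g q (B c q) (B c q))" for a c q
  have As: "smooth_fun M W (A a c)" if "a \<in> ?K" "c \<in> ?K" for a c
    unfolding A_def using that
    by (intro smooth_fun_mult smooth_fun_inverse g_smooth W(1) EW BW) (auto simp: gB Gnz)
  have AG: "A a c q = g q (E a q) (B c q) / G c q" if "c \<in> ?K" "q \<in> W" for a c q
    using gB[OF that(1,1,2)] by (simp add: A_def)
  have Eexp: "E a q f = (\<Sum>c\<in>?K. A a c q * B c q f)" if "a \<in> ?K" "q \<in> W" for a q f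
    using fun_cong[OF orthogonal_expand[OF U_top[OF that(2)] oB[OF that(2)] ET[OF that]], of f] AG that(2) by simp
  let ?E = "\<lambda>a. vf_sum ?K (\<lambda>c. vf_scale (A a c) (B c))"
  have E'W: "?E a \<in> VF" if "a \<in> ?K" for a
    using that by (intro vf_sum_closed W(1) finite_index scale_closed BW As)
  have EE': "E a q = ?E a q" if "a \<in> ?K" "q \<in> W" for a q
    by (rule ext) (simp add: vf_sum_apply vf_scale_apply Eexp[OF that])
  \<comment> \<open>Expanding \<open>B c\<close> in the orthonormal frame turns g(B_c, B_e) into
    this sum times \<open>G c p * G e p\<close>.\<close>
  have P: "(\<Sum>a\<in>?K. \<epsilon> a * A a c p * A a e p) = (if c = e then 1 / G c p else 0)" if "c \<in> ?K" "e \<in> ?K" for c e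
  proof -
    note pt = U_top[OF W(4)]
    have "g p (B c p) (B e p) = (\<Sum>a\<in>?K. g p (B c p) (E a p) / \<epsilon> a * g p (E a p) (B e p))"
      by (subst orthogonal_expand[OF pt oE BT[OF that(1) W(4)]])
         (rule g_sum[OF pt BT[OF that(2) W(4)] ET[OF _ W(4)]])
    also have "\<dots> = (\<Sum>a\<in>?K. (\<epsilon> a * A a c p * A a e p) * (G c p * G e p))"
    proof (rule sum.cong[OF refl])
      fix a assume a: "a \<in> ?K"
      have "g p (B c p) (E a p) = A a c p * G c p"
        using g_sym[OF pt BT[OF that(1) W(4)] ET[OF a W(4)]] AG[OF that(1) W(4), of a] Gnz[OF that(1) W(4)] by simp
      moreover have "g p (E a p) (B e p) = A a e p * G e p"
        using AG[OF that(2) W(4), of a] Gnz[OF that(2) W(4)] by simp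
      ultimately show "g p (B c p) (E a p) / \<epsilon> a * g p (E a p) (B e p) = (\<epsilon> a * A a c p * A a e p) * (G c p * G e p)"
        using \<epsilon>[OF a] by auto
    qed
    also have "\<dots> = (\<Sum>a\<in>?K. \<epsilon> a * A a c p * A a e p) * (G c p * G e p)" by (simp add: sum_distrib_right)
    finally have "(\<Sum>a\<in>?K. \<epsilon> a * A a c p * A a e p) * (G c p * G e p) = (if c = e then G c p else 0)"
      using gB[OF that W(4)] by simp
    then show ?thesis using Gnz[OF that(1) W(4)] Gnz[OF that(2) W(4)] by (auto simp: field_simps split: if_splits)
  qed
  let ?R = "curvature M D"
  note pt = U_top[OF W(4)]
  have RT: "?R X Y Z p \<in> tangent_space M p" if "X \<in> VF" "Y \<in> VF" "Z \<in> VF" for X Y Z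
    using curvature_tangent[OF that W(4)] .
  \<comment> \<open>The index \<open>b\<close> is traced first, with \<open>E a\<close> untouched.
    What remains is diagonal in \<open>d\<close>, and so \<open>outer\<close> treats only that
    case.\<close>
  have mid: "g p (?R (E a) (E b) (E a) p) (E b p) =
      (\<Sum>d\<in>?K. \<Sum>h\<in>?K. A b d p * A b h p * g p (?R (E a) (B d) (E a) p) (B h p))" if ab: "a \<in> ?K" "b \<in> ?K" for a b
  proof -
    have "?R (E a) (E b) (E a) p = ?R (E a) (?E b) (E a) p"
      by (rule curvature_cong[OF EW[OF ab(1)] EW[OF ab(2)] EW[OF ab(1)] EW[OF ab(1)] E'W[OF ab(2)] EW[OF ab(1)]])
         (simp_all only: EE'[OF ab(2)] W(4))
    also have "\<dots> = (\<lambda>f. \<Sum>d\<in>?K. A b d p * ?R (E a) (B d) (E a) p f)"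
      using ab by (intro ext curvature_sum_mid EW W(4) finite_index BW As)
    finally have 1: "g p (?R (E a) (E b) (E a) p) (E b p) = (\<Sum>d\<in>?K. A b d p * g p (?R (E a) (B d) (E a) p) (E b p))"
      using g_sum[OF pt ET[OF ab(2) W(4)] RT[OF EW[OF ab(1)] BW EW[OF ab(1)]]] by simp
    have "E b p = (\<lambda>f. \<Sum>h\<in>?K. A b h p * B h p f)" by (rule ext) (rule Eexp[OF ab(2) W(4)])
    then have "g p (?R (E a) (B d) (E a) p) (E b p) = (\<Sum>h\<in>?K. A b h p * g p (?R (E a) (B d) (E a) p) (B h p))"
      if "d \<in> ?K" for d
      using g_sum_right[OF pt RT[OF EW[OF ab(1)] BW[OF that] EW[OF ab(1)]] BT[OF _ W(4)]] by simp
    then show ?thesis unfolding 1 by (simp add: sum_distrib_left mult.assoc)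
  qed
  have outer: "g p (?R (E a) (B d) (E a) p) (B d p) =
      (\<Sum>c\<in>?K. \<Sum>e\<in>?K. A a c p * A a e p * g p (?R (B c) (B d) (B e) p) (B d p))" if ad: "a \<in> ?K" "d \<in> ?K" for a d
  proof -
    have "?R (E a) (B d) (E a) p = ?R (?E a) (B d) (E a) p"
      by (rule curvature_cong[OF EW[OF ad(1)] BW[OF ad(2)] EW[OF ad(1)] E'W[OF ad(1)] BW[OF ad(2)] EW[OF ad(1)]])
         (simp_all only: EE'[OF ad(1)] W(4))
    also have "\<dots> = (\<lambda>f. \<Sum>c\<in>?K. A a c p * ?R (B c) (B d) (E a) p f)"
      using ad by (intro ext curvature_sum_left EW W(4) finite_index BW As)
    finally have 1: "g p (?R (E a) (B d) (E a) p) (B d p) = (\<Sum>c\<in>?K. A a c p * g p (?R (B c) (B d) (E a) p) (B d p))"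
      using g_sum[OF pt BT[OF ad(2) W(4)] RT[OF BW BW[OF ad(2)] EW[OF ad(1)]]] by simp
    have "g p (?R (B c) (B d) (E a) p) (B d p) = (\<Sum>e\<in>?K. A a e p * g p (?R (B c) (B d) (B e) p) (B d p))"
      if c: "c \<in> ?K" for c
    proof -
      have "?R (B c) (B d) (E a) p = ?R (B c) (B d) (?E a) p"
        by (rule curvature_cong[OF BW[OF c] BW[OF ad(2)] EW[OF ad(1)] BW[OF c] BW[OF ad(2)] E'W[OF ad(1)]])
           (simp_all only: EE'[OF ad(1)] W(4))
      also have "\<dots> = (\<lambda>f. \<Sum>e\<in>?K. A a e p * ?R (B c) (B d) (B e) p f)"
        using ad c by (intro ext curvature_sum_third EW W(4) finite_index BW As)
      finally show ?thesis
        using g_sum[OF pt BT[OF ad(2) W(4)] RT[OF BW[OF c] BW[OF ad(2)] BW]] by simp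
    qed
    then show ?thesis unfolding 1 by (simp add: sum_distrib_left mult.assoc)
  qed
  have inner: "g p (?R (B c) (B d) (B c) p) (B d p) = curvature_coeff ?K B \<Gamma> C c d c d p * G d p"
    if cd: "c \<in> ?K" "d \<in> ?K" for c d
  proof -
    have WU: "q \<in> U" if "q \<in> W" for q using that W(2) by blast
    have "?R (B c) (B d) (B c) p f = (\<Sum>h\<in>?K. curvature_coeff ?K B \<Gamma> C c d c h p * B h p f)" for f
      by (rule curvature_in_frame[OF finite_index BW smooth_fun_subset[OF U W(1,2) \<Gamma>(1)] \<Gamma>(2)[OF _ _ WU]
            smooth_fun_subset[OF U W(1,2) C(1)] C(2)[OF _ _ WU] W(4) cd cd(1)])
    then have "?R (B c) (B d) (B c) p = (\<lambda>f. \<Sum>h\<in>?K. curvature_coeff ?K B \<Gamma> C c d c h p * B h p f)" by (rule ext)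
    then have "g p (?R (B c) (B d) (B c) p) (B d p) =
        (\<Sum>h\<in>?K. curvature_coeff ?K B \<Gamma> C c d c h p * g p (B h p) (B d p))"
      using g_sum[OF pt BT[OF cd(2) W(4)] BT[OF _ W(4)]] by simp
    also have "\<dots> = (\<Sum>h\<in>?K. if h = d then curvature_coeff ?K B \<Gamma> C c d c h p * G d p else 0)"
      using cd gB W(4) by (intro sum.cong) auto
    also have "\<dots> = curvature_coeff ?K B \<Gamma> C c d c d p * G d p" using cd finite_index by simp
    finally show ?thesis .
  qed
  have gE: "g p (E k p) (E k p) = \<epsilon> k" if "k \<in> ?K" for k using gE'[OF that that] by simp
  have "scalar_curvature M g D p =
      (\<Sum>a\<in>?K. \<epsilon> a * (\<Sum>b\<in>?K. \<epsilon> b * g p (?R (E a) (E b) (E a) p) (E b p)))"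
    unfolding scalar_curvature_def ricci_def Let_def E_def[symmetric] using gE by simp
  also have "\<dots> = (\<Sum>a\<in>?K. \<epsilon> a * (\<Sum>d\<in>?K. g p (?R (E a) (B d) (E a) p) (B d p) / G d p))"
  proof (rule sum.cong[OF refl])
    fix a assume a: "a \<in> ?K"
    have "(\<Sum>b\<in>?K. \<epsilon> b * g p (?R (E a) (E b) (E a) p) (E b p)) =
       (\<Sum>b\<in>?K. \<epsilon> b * (\<Sum>d\<in>?K. \<Sum>h\<in>?K. A b d p * A b h p * g p (?R (E a) (B d) (E a) p) (B h p)))"
      using mid[OF a] by simp
    also have "\<dots> = (\<Sum>d\<in>?K. g p (?R (E a) (B d) (E a) p) (B d p) / G d p)"
      by (rule double_trace[OF finite_index P])
    finally show "\<epsilon> a * (\<Sum>b\<in>?K. \<epsilon> b * g p (?R (E a) (E b) (E a) p) (E b p)) =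
      \<epsilon> a * (\<Sum>d\<in>?K. g p (?R (E a) (B d) (E a) p) (B d p) / G d p)" by (simp only:)
  qed
  also have "\<dots> = (\<Sum>d\<in>?K. (\<Sum>a\<in>?K. \<epsilon> a * g p (?R (E a) (B d) (E a) p) (B d p)) / G d p)"
    by (rule sum_swap_divide)
  also have "\<dots> = (\<Sum>d\<in>?K. (\<Sum>c\<in>?K. g p (?R (B c) (B d) (B c) p) (B d p) / G c p) / G d p)"
  proof (rule sum.cong[OF refl])
    fix d assume d: "d \<in> ?K"
    have "(\<Sum>a\<in>?K. \<epsilon> a * g p (?R (E a) (B d) (E a) p) (B d p)) =
       (\<Sum>a\<in>?K. \<epsilon> a * (\<Sum>c\<in>?K. \<Sum>e\<in>?K. A a c p * A a e p * g p (?R (B c) (B d) (B e) p) (B d p)))"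
      using outer[OF _ d] by simp
    also have "\<dots> = (\<Sum>c\<in>?K. g p (?R (B c) (B d) (B c) p) (B d p) / G c p)"
      by (rule double_trace[OF finite_index P])
    finally show "(\<Sum>a\<in>?K. \<epsilon> a * g p (?R (E a) (B d) (E a) p) (B d p)) / G d p =
      (\<Sum>c\<in>?K. g p (?R (B c) (B d) (B c) p) (B d p) / G c p) / G d p" by (simp only:)
  qed
  also have "\<dots> = (\<Sum>d\<in>?K. \<Sum>c\<in>?K. curvature_coeff ?K B \<Gamma> C c d c d p / G c p)"
    unfolding sum_divide_distrib using inner Gnz[OF _ W(4)] by (intro sum.cong refl) simp
  also have "\<dots> = (\<Sum>c\<in>?K. \<Sum>d\<in>?K. curvature_coeff ?K B \<Gamma> C c d c d p / G c p)"
    by (rule sum.swap)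
  finally show ?thesis .
qed

text \<open>The given \<open>D\<close> is known through its axioms alone. Combining metric
  compatibility for three orders of the fields with vanishing torsion yields its values on a frame
  from brackets and derivatives of the metric.\<close>

lemma koszul:
  assumes LC: "levi_civita M g D" and U: "openin (mtop M) U"
    and X: "X \<in> vector_fields M U" and Y: "Y \<in> vector_fields M U" and Z: "Z \<in> vector_fields M U" and p: "p \<in> U"
  shows "2 * g p (D X Y p) (Z p) =
    X p (\<lambda>q. g q (Y q) (Z q)) + Y p (\<lambda>q. g q (X q) (Z q)) - Z p (\<lambda>q. g q (X q) (Y q))
    + g p (lie_bracket M X Y p) (Z p) - g p (lie_bracket M X Z p) (Y p) - g p (lie_bracket M Y Z p) (X p)"
proof -
  interpret local_connection M U D
    using LC U unfolding levi_civita_def affine_connection_iff by unfold_locales blast+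
  have tor: "lie_bracket M V W p = (\<lambda>f. D V W p f - D W V p f)" if "V \<in> VF" "W \<in> VF" for V W
  proof
    fix f show "lie_bracket M V W p f = D V W p f - D W V p f"
      using LC U that p unfolding levi_civita_def by simp
  qed
  have met: "V p (\<lambda>q. g q (W q) (S q)) = g p (D V W p) (S p) + g p (W p) (D V S p)"
    if "V \<in> VF" "W \<in> VF" "S \<in> VF" for V W S
    using LC U that p unfolding levi_civita_def by simp
  note pt = U_top[OF p]
  have T: "V p \<in> tangent_space M p" if "V \<in> VF" for V using vfD[OF that p] .
  have br: "g p (lie_bracket M V W p) (S p) = g p (D V W p) (S p) - g p (D W V p) (S p)"
    if "V \<in> VF" "W \<in> VF" "S \<in> VF" for V W S
    unfolding tor[OF that(1,2)] by (intro g_diff pt T D_closed that)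
  have sy: "g p (W p) (D V S p) = g p (D V S p) (W p)" if "V \<in> VF" "W \<in> VF" "S \<in> VF" for V W S
    by (intro g_sym pt T D_closed that)
  show ?thesis
    unfolding met[OF X Y Z] met[OF Y X Z] met[OF Z X Y] br[OF X Y Z] br[OF X Z Y] br[OF Y Z X]
      sy[OF X Y Z] sy[OF Y X Z] sy[OF Z X Y] by simp
qed

text \<open>The two added terms are linear over functions in both fields, so the Leibniz rule
  carries over from \<open>D\<close>.\<close>

lemma quarter_symmetric_connection:
  assumes U: "openin (mtop M) U" and conn: "connection_on M U D" and P: "P \<in> vector_fields M U"
  shows "connection_on M U (quarter_symmetric g D P l1 l2)"
proof -
  interpret local_connection M U D using U conn by unfold_locales
  let ?Q = "quarter_symmetric g D P l1 l2"
  have Q: "?Q X Y p f = D X Y p f + l1 * g p (Y p) (P p) * X p f - l2 * g p (X p) (Y p) * P p f" for X Y p f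
    by (simp add: quarter_symmetric_def)
  have T: "V p \<in> tangent_space M p" if "V \<in> VF" "p \<in> U" for V p using vfD[OF that] .
  show ?thesis
    unfolding connection_on_def
  proof (intro conjI ballI allI impI)
    fix X Y assume X: "X \<in> VF" and Y: "Y \<in> VF"
    {
      fix X' Y' p assume X': "X' \<in> VF" and Y': "Y' \<in> VF" and eq: "\<forall>p\<in>U. X p = X' p \<and> Y p = Y' p" and p: "p \<in> U"
      have e: "X q = X' q" "Y q = Y' q" if "q \<in> U" for q using eq that by auto
      have "D X Y p = D X' Y' p" by (rule D_cong[OF X Y X' Y' e p])
      then show "?Q X Y p = ?Q X' Y' p" by (intro ext) (simp only: Q e[OF p])
    }
    have "?Q X Y = vf_add (D X Y) (vf_add (vf_scale (\<lambda>p. l1 * g p (Y p) (P p)) X) (vf_scale (\<lambda>p. - l2 * g p (X p) (Y p)) P))"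
      by (intro ext) (simp add: Q vf_add_apply vf_scale_apply)
    then show "?Q X Y \<in> VF"
      by (simp only:) (intro vf_add_closed scale_closed smooth_fun_mult smooth_fun_const g_smooth D_closed X Y P U)
    {
      fix h p f assume h: "smooth_fun M U h" and p: "p \<in> U"
      note pt = U_top[OF p]
      have sc: "vf_scale h V p = (\<lambda>f. h p * V p f)" for V by (simp add: vf_scale_def)
      have "g p (vf_scale h X p) (Y p) = h p * g p (X p) (Y p)"
        unfolding sc by (intro g_scale pt T X Y p)
      then show "?Q (vf_scale h X) Y p f = h p * ?Q X Y p f"
        using D_scale_left[OF X Y h p] by (simp add: Q vf_scale_apply algebra_simps)
      have "g p (X p) (vf_scale h Y p) = h p * g p (X p) (Y p)" "g p (vf_scale h Y p) (P p) = h p * g p (Y p) (P p)"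
        unfolding sc by (intro g_scale g_scale_right pt T X Y P p)+
      then show "?Q X (vf_scale h Y) p f = X p h * Y p f + h p * ?Q X Y p f"
        using D_scale_right[OF X Y h p] by (simp add: Q vf_scale_apply algebra_simps)
    }
    {
      fix Z p f assume Z: "Z \<in> VF" and p: "p \<in> U"
      note pt = U_top[OF p]
      have ad: "vf_add V W p = (\<lambda>f. V p f + W p f)" for V W by (simp add: vf_add_def)
      have ar: "g p (S p) (\<lambda>f. V p f + W p f) = g p (S p) (V p) + g p (S p) (W p)"
        if "V \<in> VF" "W \<in> VF" "S \<in> VF" for V W S
        using g_lin_right[OF pt T[OF that(1) p] T[OF that(2) p] T[OF that(3) p], of 1 1] by simp
      have "g p (vf_add X Y p) (Z p) = g p (X p) (Z p) + g p (Y p) (Z p)"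
        unfolding ad by (intro g_add pt T X Y Z p)
      then show "?Q (vf_add X Y) Z p f = ?Q X Z p f + ?Q Y Z p f"
        using D_add_left[OF X Y Z p] by (simp add: Q vf_add_apply algebra_simps)
      have "g p (vf_add Y Z p) (P p) = g p (Y p) (P p) + g p (Z p) (P p)"
        unfolding ad by (intro g_add pt T P Y Z p)
      moreover have "g p (X p) (vf_add Y Z p) = g p (X p) (Y p) + g p (X p) (Z p)"
        unfolding ad by (rule ar[OF Y Z X])
      ultimately show "?Q X (vf_add Y Z) p f = ?Q X Y p f + ?Q X Z p f"
        using D_add_right[OF X Y Z p] by (simp add: Q vf_add_apply algebra_simps)
    }
  qed
qed

end

section \<open>Charts and vector fields on the product\<close>

definition factor_coords :: "(nat \<Rightarrow> ('a, 'k) manifold) \<Rightarrow> nat \<Rightarrow> ((nat \<times> 'k) option \<Rightarrow> real) \<Rightarrow> 'k \<Rightarrow> real" where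
  "factor_coords F i y = (\<lambda>k\<in>mindex (F i). y (Some (i, k)))"

text \<open>Here and in the next two definitions the index set, the chart domains and the charts
  inside \<open>product_manifold\<close> receive names.\<close>

definition product_index :: "nat \<Rightarrow> (nat \<Rightarrow> ('a, 'k) manifold) \<Rightarrow> (nat \<times> 'k) option set" where
  "product_index m F = insert None (Some ` (SIGMA i:{1..m}. mindex (F i)))"

definition product_dom :: "real set \<Rightarrow> nat \<Rightarrow> (nat \<Rightarrow> 'a set) \<Rightarrow> (real \<times> (nat \<Rightarrow> 'a)) set" where
  "product_dom I m U = I \<times> (\<Pi>\<^sub>E i\<in>{1..m}. U i)"

definition product_chart ::
    "nat \<Rightarrow> (nat \<Rightarrow> ('a, 'k) manifold) \<Rightarrow> (nat \<Rightarrow> 'a \<Rightarrow> 'k \<Rightarrow> real) \<Rightarrow> real \<times> (nat \<Rightarrow> 'a) \<Rightarrow> (nat \<times> 'k) option \<Rightarrow> real" where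
  "product_chart m F \<phi> = (\<lambda>(t, x). \<lambda>j\<in>product_index m F. case j of None \<Rightarrow> t | Some (i, k) \<Rightarrow> \<phi> i (x i) k)"

lemma mindex_product: "mindex (product_manifold I m F) = product_index m F"
  by (simp add: product_manifold_def product_index_def)

lemma mtop_product: "mtop (product_manifold I m F) =
    prod_topology (top_of_set I) (product_topology (\<lambda>i. mtop (F i)) {1..m})"
  by (simp add: product_manifold_def)

lemma topspace_product: "topspace (mtop (product_manifold I m F)) = I \<times> (\<Pi>\<^sub>E i\<in>{1..m}. topspace (mtop (F i)))"
  by (simp add: mtop_product)

lemma matlas_product: "matlas (product_manifold I m F) =
    {(product_dom I m U, product_chart m F \<phi>) | U \<phi>. \<forall>i\<in>{1..m}. (U i, \<phi> i) \<in> matlas (F i)}"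
  by (simp add: product_manifold_def product_dom_def product_chart_def product_index_def)

lemma product_index_simps [simp]:
  "None \<in> product_index m F" "Some (i, k) \<in> product_index m F \<longleftrightarrow> i \<in> {1..m} \<and> k \<in> mindex (F i)"
  by (auto simp: product_index_def)

lemma product_chart_None [simp]: "product_chart m F \<phi> q None = fst q"
  by (simp add: product_chart_def split_beta)

lemma product_chart_Some [simp]:
  "i \<in> {1..m} \<Longrightarrow> k \<in> mindex (F i) \<Longrightarrow> product_chart m F \<phi> q (Some (i, k)) = \<phi> i (snd q i) k"
  by (simp add: product_chart_def split_beta)

locale charted_factors =
  fixes I :: "real set" and m :: nat and F :: "nat \<Rightarrow> ('a, 'k) manifold"
  assumes I_open: "open I" and factor_charted: "i \<in> {1..m} \<Longrightarrow> charted_space (F i)"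
begin

abbreviation "M \<equiv> product_manifold I m F"
abbreviation "J \<equiv> {1..m}"
abbreviation "KM \<equiv> product_index m F"

lemma finite_product_index: "finite KM"
  unfolding product_index_def
  by (intro finite.insertI finite_imageI finite_SigmaI charted_space.finite_index[OF factor_charted]) auto

lemma openin_product_dom:
  assumes "\<And>i. i \<in> J \<Longrightarrow> openin (mtop (F i)) (W i)"
  shows "openin (mtop M) (product_dom I m W)"
  unfolding mtop_product product_dom_def
proof (rule openin_prod_Times_iff[THEN iffD2], intro disjI2 conjI)
  show "openin (product_topology (\<lambda>i. mtop (F i)) J) (Pi\<^sub>E J W)"
    unfolding openin_PiE_gen using assms by auto
qed simp

definition preimage_factor :: "nat \<Rightarrow> 'a set \<Rightarrow> (real \<times> (nat \<Rightarrow> 'a)) set" where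
  "preimage_factor i W = {q \<in> topspace (mtop M). snd q i \<in> W}"

lemma openin_preimage_factor:
  assumes "i \<in> J" "openin (mtop (F i)) W"
  shows "openin (mtop M) (preimage_factor i W)"
proof -
  have "continuous_map (mtop M) (mtop (F i)) (\<lambda>q. snd q i)"
    unfolding mtop_product
    using continuous_map_compose[OF continuous_map_snd continuous_map_product_projection[OF assms(1)],
        of "top_of_set I" "\<lambda>i. mtop (F i)"] by (simp add: o_def)
  from openin_continuous_map_preimage[OF this assms(2)] show ?thesis by (simp add: preimage_factor_def)
qed

section \<open>A product of charts is a chart\<close>

context
  fixes U :: "nat \<Rightarrow> 'a set" and \<phi> :: "nat \<Rightarrow> 'a \<Rightarrow> 'k \<Rightarrow> real"
  assumes charts: "\<And>i. i \<in> J \<Longrightarrow> (U i, \<phi> i) \<in> matlas (F i)"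
begin

abbreviation "PU \<equiv> product_dom I m U"
abbreviation "P\<phi> \<equiv> product_chart m F \<phi>"

lemma factor_chart_PiE: "i \<in> J \<Longrightarrow> x \<in> U i \<Longrightarrow> \<phi> i x \<in> Pi\<^sub>E (mindex (F i)) (\<lambda>_. UNIV)"
  using openin_powertop_subset[OF charted_space.chart_image[OF factor_charted charts]] by blast

lemma factor_coords_chart: "i \<in> J \<Longrightarrow> q \<in> PU \<Longrightarrow> factor_coords F i (P\<phi> q) = \<phi> i (snd q i)"
proof -
  assume i: "i \<in> J" and q: "q \<in> PU"
  have "snd q i \<in> U i" using i q by (auto simp: product_dom_def)
  from factor_chart_PiE[OF i this] show ?thesis
    using i by (auto simp: factor_coords_def PiE_def extensional_def fun_eq_iff)
qed

text \<open>An explicit formula, block by block, for what \<open>smooth_fun\<close> expresses by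
  \<open>inv_into\<close>. The effect of changing a single coordinate can be read off from
  it.\<close>

definition chart_inverse :: "((nat \<times> 'k) option \<Rightarrow> real) \<Rightarrow> real \<times> (nat \<Rightarrow> 'a)" where
  "chart_inverse y = (y None, \<lambda>i\<in>J. inv_into (U i) (\<phi> i) (factor_coords F i y))"

lemma chart_inverse_chart: "q \<in> PU \<Longrightarrow> chart_inverse (P\<phi> q) = q"
proof -
  assume q: "q \<in> PU"
  have "(\<lambda>i\<in>J. inv_into (U i) (\<phi> i) (factor_coords F i (P\<phi> q))) = snd q"
  proof
    fix i show "(\<lambda>i\<in>J. inv_into (U i) (\<phi> i) (factor_coords F i (P\<phi> q))) i = snd q i"
    proof (cases "i \<in> J")
      case True
      then have "snd q i \<in> U i" using q by (auto simp: product_dom_def)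
      then show ?thesis
        using True factor_coords_chart[OF True q] charted_space.chart_inv[OF factor_charted charts] by simp
    next
      case False
      then show ?thesis using q by (auto simp: product_dom_def PiE_def extensional_def)
    qed
  qed
  then show ?thesis by (simp add: chart_inverse_def)
qed

text \<open>The conditions concern the separate blocks, each of them the preimage of an open set
  under a continuous projection; openness of the image follows.\<close>

lemma product_chart_image:
  "P\<phi> ` PU = {y \<in> Pi\<^sub>E KM (\<lambda>_. UNIV). y None \<in> I \<and> (\<forall>i\<in>J. factor_coords F i y \<in> \<phi> i ` U i)}"
proof (intro set_eqI iffI)
  fix y assume "y \<in> P\<phi> ` PU"
  then obtain q where q: "q \<in> PU" "y = P\<phi> q" by blast
  have "P\<phi> q \<in> Pi\<^sub>E KM (\<lambda>_. UNIV)" by (auto simp: product_chart_def split_beta)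
  then show "y \<in> {y \<in> Pi\<^sub>E KM (\<lambda>_. UNIV). y None \<in> I \<and> (\<forall>i\<in>J. factor_coords F i y \<in> \<phi> i ` U i)}"
    using q factor_coords_chart[OF _ q(1)] by (auto simp: product_dom_def)
next
  fix y assume y: "y \<in> {y \<in> Pi\<^sub>E KM (\<lambda>_. UNIV). y None \<in> I \<and> (\<forall>i\<in>J. factor_coords F i y \<in> \<phi> i ` U i)}"
  have inU: "inv_into (U i) (\<phi> i) (factor_coords F i y) \<in> U i" if "i \<in> J" for i
    using y that by (intro inv_into_into) blast
  then have q: "chart_inverse y \<in> PU" using y by (auto simp: chart_inverse_def product_dom_def)
  have "P\<phi> (chart_inverse y) j = y j" for j
  proof (cases "j \<in> KM")
    case False
    then show ?thesis using y by (auto simp: product_chart_def split_beta PiE_def extensional_def)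
  next
    case True
    show ?thesis
    proof (cases j)
      case None then show ?thesis by (simp add: chart_inverse_def)
    next
      case (Some ik)
      then obtain i k where j: "j = Some (i, k)" by (cases ik) auto
      then have ik: "i \<in> J" "k \<in> mindex (F i)" using True by auto
      have "\<phi> i (inv_into (U i) (\<phi> i) (factor_coords F i y)) = factor_coords F i y"
        using y ik(1) by (intro f_inv_into_f) blast
      then show ?thesis using ik by (simp add: j chart_inverse_def factor_coords_def)
    qed
  qed
  then have "y = P\<phi> (chart_inverse y)" by (simp add: fun_eq_iff)
  then show "y \<in> P\<phi> ` PU" using q by blast
qed

lemma inv_product_chart: "y \<in> P\<phi> ` PU \<Longrightarrow> inv_into PU P\<phi> y = chart_inverse y"
proof -
  assume "y \<in> P\<phi> ` PU"
  then obtain q where q: "q \<in> PU" "y = P\<phi> q" by blast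
  have "inj_on P\<phi> PU" by (rule inj_on_inverseI) (rule chart_inverse_chart)
  then show ?thesis using q by (simp add: inv_into_f_f chart_inverse_chart)
qed

lemma continuous_map_factor_coords:
  assumes i: "i \<in> J"
  shows "continuous_map (powertop_real KM) (powertop_real (mindex (F i))) (factor_coords F i)"
proof (rule continuous_map_componentwise[THEN iffD2], intro conjI ballI)
  show "factor_coords F i ` topspace (powertop_real KM) \<subseteq> extensional (mindex (F i))"
    by (auto simp: factor_coords_def)
  fix k assume k: "k \<in> mindex (F i)"
  have "continuous_map (powertop_real KM) euclideanreal (\<lambda>x. x (Some (i, k)))"
    by (rule continuous_map_product_projection) (use i k in simp)
  then show "continuous_map (powertop_real KM) euclideanreal (\<lambda>x. factor_coords F i x k)"
    using k by (simp add: factor_coords_def)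
qed

lemma openin_product_chart_image: "openin (powertop_real KM) (P\<phi> ` PU)"
proof -
  have 1: "openin (powertop_real KM) {y \<in> topspace (powertop_real KM). y None \<in> I}"
    by (rule openin_continuous_map_preimage[OF continuous_map_product_projection]) (auto simp: I_open)
  have 2: "openin (powertop_real KM) {y \<in> topspace (powertop_real KM). factor_coords F i y \<in> \<phi> i ` U i}" if "i \<in> J" for i
    by (rule openin_continuous_map_preimage[OF continuous_map_factor_coords[OF that]
          charted_space.chart_image[OF factor_charted[OF that] charts[OF that]]])
  have "openin (powertop_real KM) ({y \<in> topspace (powertop_real KM). y None \<in> I} \<inter>
      ((\<Inter>i\<in>J. {y \<in> topspace (powertop_real KM). factor_coords F i y \<in> \<phi> i ` U i}) \<inter> topspace (powertop_real KM)))"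
    by (rule openin_Int[OF 1 openin_INT[OF finite_atLeastAtMost 2]])
  also have "{y \<in> topspace (powertop_real KM). y None \<in> I} \<inter>
      ((\<Inter>i\<in>J. {y \<in> topspace (powertop_real KM). factor_coords F i y \<in> \<phi> i ` U i}) \<inter> topspace (powertop_real KM)) = P\<phi> ` PU"
    unfolding product_chart_image by auto
  finally show ?thesis .
qed

lemma subtopology_product_dom:
  "subtopology (mtop M) PU = prod_topology (top_of_set I) (product_topology (\<lambda>i. subtopology (mtop (F i)) (U i)) J)"
  unfolding mtop_product product_dom_def subtopology_Times subtopology_product_topology by (simp add: subtopology_subtopology)

text \<open>Continuity is checked component by component in both directions. For the inverse it
  reduces to the continuity of the inverse chart of each factor.\<close>

lemma product_chart_homeo:
  "homeomorphic_map (subtopology (mtop M) PU) (subtopology (powertop_real KM) (P\<phi> ` PU)) P\<phi>"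
proof -
  let ?X = "subtopology (mtop M) PU" and ?Y = "subtopology (powertop_real KM) (P\<phi> ` PU)"
  have tX: "topspace ?X = PU"
    using openin_subset[OF openin_product_dom[OF charted_space.chart_open[OF factor_charted charts]]] by auto
  have tY: "topspace ?Y = P\<phi> ` PU" using openin_subset[OF openin_product_chart_image] by auto
  have sndi: "continuous_map ?X (subtopology (mtop (F i)) (U i)) (\<lambda>q. snd q i)" if i: "i \<in> J" for i
    unfolding subtopology_product_dom
    using continuous_map_compose[OF continuous_map_snd continuous_map_product_projection[OF i],
        of "top_of_set I" "\<lambda>i. subtopology (mtop (F i)) (U i)"] by (simp add: o_def)
  have "continuous_map ?X (powertop_real KM) P\<phi>"
  proof (rule continuous_map_componentwise[THEN iffD2], intro conjI ballI)
    show "P\<phi> ` topspace ?X \<subseteq> extensional KM" by (auto simp: product_chart_def)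
    fix j assume j: "j \<in> KM"
    show "continuous_map ?X euclideanreal (\<lambda>q. P\<phi> q j)"
    proof (cases j)
      case None
      have "continuous_map ?X (top_of_set I) fst"
        unfolding subtopology_product_dom by (rule continuous_map_fst)
      then show ?thesis using None by (simp add: continuous_map_in_subtopology)
    next
      case (Some ik)
      then obtain i k where j': "j = Some (i, k)" by (cases ik) auto
      then have ik: "i \<in> J" "k \<in> mindex (F i)" using j by auto
      have "continuous_map (subtopology (mtop (F i)) (U i)) (powertop_real (mindex (F i))) (\<phi> i)"
        using homeomorphic_imp_continuous_map[OF charted_space.chart_homeo[OF factor_charted[OF ik(1)] charts[OF ik(1)]]]
        by (simp add: continuous_map_in_subtopology)
      from continuous_map_compose[OF continuous_map_compose[OF sndi[OF ik(1)] this] continuous_map_product_projection[OF ik(2)]]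
      show ?thesis using ik by (simp add: j' o_def)
    qed
  qed
  then have c1: "continuous_map ?X ?Y P\<phi>" by (auto simp: continuous_map_in_subtopology tX)
  have "continuous_map ?Y (top_of_set I) (\<lambda>y. y None)"
  proof -
    have "continuous_map ?Y euclideanreal (\<lambda>y. y None)"
      by (rule continuous_map_from_subtopology[OF continuous_map_product_projection]) simp
    then show ?thesis unfolding continuous_map_in_subtopology tY product_chart_image by auto
  qed
  moreover have "continuous_map ?Y (product_topology (\<lambda>i. subtopology (mtop (F i)) (U i)) J)
      (\<lambda>y. \<lambda>i\<in>J. inv_into (U i) (\<phi> i) (factor_coords F i y))"
  proof (rule continuous_map_componentwise[THEN iffD2], intro conjI ballI)
    fix i assume i: "i \<in> J"
    let ?Fi = "subtopology (mtop (F i)) (U i)" and ?Yi = "subtopology (powertop_real (mindex (F i))) (\<phi> i ` U i)"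
    interpret Fi: charted_space "F i" by (rule factor_charted[OF i])
    obtain g where g: "homeomorphic_maps ?Fi ?Yi (\<phi> i) g"
      using Fi.chart_homeo[OF charts[OF i]] unfolding homeomorphic_map_maps by blast
    have tF: "topspace ?Fi = U i" using openin_subset[OF Fi.chart_open[OF charts[OF i]]] by auto
    have tYi: "topspace ?Yi = \<phi> i ` U i" using openin_subset[OF Fi.chart_image[OF charts[OF i]]] by auto
    have "continuous_map ?Yi ?Fi g" using g by (simp add: homeomorphic_maps_def)
    then have "continuous_map ?Yi ?Fi (inv_into (U i) (\<phi> i))"
    proof (rule continuous_map_eq)
      fix y assume "y \<in> topspace ?Yi"
      then obtain x where x: "x \<in> U i" "y = \<phi> i x" using tYi by auto
      then show "g y = inv_into (U i) (\<phi> i) y"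
        using g tF Fi.chart_inv[OF charts[OF i] x(1)] by (simp add: homeomorphic_maps_def)
    qed
    moreover have "continuous_map ?Y ?Yi (factor_coords F i)"
      using continuous_map_from_subtopology[OF continuous_map_factor_coords[OF i]] i
      by (auto simp: continuous_map_in_subtopology tY product_chart_image)
    ultimately have "continuous_map ?Y ?Fi (inv_into (U i) (\<phi> i) \<circ> factor_coords F i)"
      by (rule continuous_map_compose[rotated])
    then show "continuous_map ?Y ?Fi (\<lambda>y. (\<lambda>i\<in>J. inv_into (U i) (\<phi> i) (factor_coords F i y)) i)"
      using i by (simp add: o_def)
  qed auto
  ultimately have c2: "continuous_map ?Y ?X chart_inverse"
    unfolding subtopology_product_dom chart_inverse_def by (rule continuous_map_pairedI)
  have "homeomorphic_maps ?X ?Y P\<phi> chart_inverse"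
    unfolding homeomorphic_maps_def tX tY using c1 c2 by (auto simp: chart_inverse_chart)
  then show ?thesis unfolding homeomorphic_map_maps by blast
qed

lemma openin_product_chart_image':
  assumes "openin (mtop M) W" "W \<subseteq> PU"
  shows "openin (powertop_real KM) (P\<phi> ` W)"
proof -
  have "openin (subtopology (mtop M) PU) W"
    using assms openin_product_dom[OF charted_space.chart_open[OF factor_charted charts]]
    by (simp add: openin_open_subtopology)
  then have "openin (subtopology (powertop_real KM) (P\<phi> ` PU)) (P\<phi> ` W)"
    using homeomorphic_imp_open_map[OF product_chart_homeo] by (simp add: open_map_def)
  then show ?thesis using openin_product_chart_image by (simp add: openin_open_subtopology)
qed

text \<open>In a product chart a function of the \<open>i\<close>-th factor depends on the
  \<open>i\<close>-th block only, so its representative is that of the factor after a coordinate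
  projection. With a chart component for \<open>h\<close> this gives the transition maps of the
  product.\<close>

lemma C_infinity_pullback_factor:
  assumes i: "i \<in> J" and W: "openin (mtop (F i)) W" and h: "smooth_fun (F i) W h"
    and V: "openin (mtop M) V" "V \<subseteq> preimage_factor i W" "V \<subseteq> PU"
  shows "C_infinity KM (P\<phi> ` V) (\<lambda>y. h (snd (inv_into PU P\<phi> y) i))"
proof -
  interpret Fi: charted_space "F i" by (rule factor_charted[OF i])
  note o = openin_product_chart_image'[OF V(1,3)]
  have "C_infinity KM (P\<phi> ` V) (\<lambda>y. (\<lambda>z. h (inv_into (U i) (\<phi> i) z)) (\<lambda>k\<in>mindex (F i). y (Some (i, k))))"
  proof (rule C_infinity_compose[OF finite_product_index o Fi.finite_index Fi.chart_inter_open[OF charts[OF i] W]])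
    show "C_infinity KM (P\<phi> ` V) (\<lambda>x. x (Some (i, l)))" for l by (rule C_infinity_coord[OF finite_product_index o])
    show "(\<lambda>k\<in>mindex (F i). x (Some (i, k))) \<in> \<phi> i ` (W \<inter> U i)" if x: "x \<in> P\<phi> ` V" for x
    proof -
      obtain q where q: "q \<in> V" "x = P\<phi> q" using x by blast
      have "q \<in> PU" using q(1) V(3) by blast
      then have "snd q i \<in> U i" using i by (auto simp: product_dom_def)
      moreover have "snd q i \<in> W" using q(1) V(2) by (auto simp: preimage_factor_def)
      ultimately have "snd q i \<in> W \<inter> U i" by blast
      moreover have "(\<lambda>k\<in>mindex (F i). x (Some (i, k))) = \<phi> i (snd q i)"
        using factor_coords_chart[OF i, of q] q V(3) by (auto simp: factor_coords_def)
      ultimately show ?thesis by simp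
    qed
  qed (rule Fi.smooth_funD[OF h charts[OF i]])
  then show ?thesis
  proof (rule C_infinity_cong[OF finite_product_index o, rotated])
    fix y assume "y \<in> P\<phi> ` V"
    then have "y \<in> P\<phi> ` PU" using V(3) by blast
    from inv_product_chart[OF this] i
    show "h (inv_into (U i) (\<phi> i) (\<lambda>k\<in>mindex (F i). y (Some (i, k)))) = h (snd (inv_into PU P\<phi> y) i)"
      by (simp add: chart_inverse_def factor_coords_def)
  qed
qed

lemma C_infinity_fst:
  assumes V: "openin (mtop M) V" "V \<subseteq> PU"
  shows "C_infinity KM (P\<phi> ` V) (\<lambda>y. fst (inv_into PU P\<phi> y))"
proof (rule C_infinity_cong[OF finite_product_index openin_product_chart_image'[OF V] _
      C_infinity_coord[OF finite_product_index openin_product_chart_image'[OF V], of None]])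
  fix y assume "y \<in> P\<phi> ` V"
  then have "y \<in> P\<phi> ` PU" using V(2) by blast
  from inv_product_chart[OF this] show "y None = fst (inv_into PU P\<phi> y)" by (simp add: chart_inverse_def)
qed

end

section \<open>The product as a charted space\<close>

sublocale product: charted_space M
proof
  show "finite (mindex M)" by (simp add: mindex_product finite_product_index)
next
  fix W \<Phi> assume "(W, \<Phi>) \<in> matlas M"
  then obtain U \<phi> where *: "W = product_dom I m U" "\<Phi> = product_chart m F \<phi>" "\<forall>i\<in>J. (U i, \<phi> i) \<in> matlas (F i)"
    unfolding matlas_product by blast
  note ch = bspec[OF *(3)]
  show W: "openin (mtop M) W"
    unfolding *(1) by (rule openin_product_dom[OF charted_space.chart_open[OF factor_charted ch]])
  show "openin (powertop_real (mindex M)) (\<Phi> ` W)"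
    unfolding *(1,2) mindex_product by (rule openin_product_chart_image[OF ch])
  show "homeomorphic_map (subtopology (mtop M) W) (subtopology (powertop_real (mindex M)) (\<Phi> ` W)) \<Phi>"
    unfolding *(1,2) mindex_product by (rule product_chart_homeo[OF ch])
  fix W' \<Psi> j assume "(W', \<Psi>) \<in> matlas M" and j: "j \<in> mindex M"
  then obtain V \<psi> where V: "W' = product_dom I m V" "\<Psi> = product_chart m F \<psi>" "\<forall>i\<in>J. (V i, \<psi> i) \<in> matlas (F i)"
    unfolding matlas_product by blast
  note ch' = bspec[OF V(3)]
  have oWW: "openin (mtop M) (W \<inter> W')"
    unfolding V(1) by (intro openin_Int W openin_product_dom charted_space.chart_open[OF factor_charted ch'])
  show "C_infinity (mindex M) (\<Phi> ` (W \<inter> W')) (\<lambda>x. \<Psi> (inv_into W \<Phi> x) j)"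
  proof (cases j)
    case None
    then show ?thesis
      using C_infinity_fst[OF ch oWW[unfolded *(1)]] by (simp add: *(1,2) V(2) mindex_product)
  next
    case (Some ik)
    then obtain i k where j': "j = Some (i, k)" by (cases ik) auto
    then have ik: "i \<in> J" "k \<in> mindex (F i)" using j by (auto simp: mindex_product)
    interpret Fi: charted_space "F i" by (rule factor_charted[OF ik(1)])
    have "C_infinity KM (product_chart m F \<phi> ` (W \<inter> W'))
        (\<lambda>y. \<psi> i (snd (inv_into (product_dom I m U) (product_chart m F \<phi>) y) i) k)"
    proof (rule C_infinity_pullback_factor[OF ch ik(1) Fi.chart_open[OF ch'[OF ik(1)]] Fi.smooth_fun_coord[OF ch'[OF ik(1)] ik(2)] oWW])
      have "W \<inter> W' \<subseteq> topspace (mtop M)" using openin_subset[OF oWW] .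
      then show "W \<inter> W' \<subseteq> preimage_factor i (V i)"
        using ik(1) unfolding V(1) by (auto simp: preimage_factor_def product_dom_def)
      show "W \<inter> W' \<subseteq> product_dom I m U" unfolding *(1) by blast
    qed
    then show ?thesis using ik by (simp add: *(1,2) V(2) mindex_product j')
  qed
next
  fix p assume p: "p \<in> topspace (mtop M)"
  have "\<exists>c. c \<in> matlas (F i) \<and> snd p i \<in> fst c" if i: "i \<in> J" for i
  proof -
    have "snd p i \<in> topspace (mtop (F i))" using p i by (auto simp: topspace_product)
    from charted_space.charts_cover[OF factor_charted[OF i] this] obtain U \<phi> where "(U, \<phi>) \<in> matlas (F i)" "snd p i \<in> U" by blast
    then show ?thesis by (intro exI[of _ "(U, \<phi>)"]) simp
  qed
  then obtain c where c: "\<forall>i\<in>J. c i \<in> matlas (F i) \<and> snd p i \<in> fst (c i)" by metis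
  have "(product_dom I m (\<lambda>i. fst (c i)), product_chart m F (\<lambda>i. snd (c i))) \<in> matlas M"
    unfolding matlas_product using c by (intro CollectI exI conjI) (auto simp: split_pairs)
  moreover have "p \<in> product_dom I m (\<lambda>i. fst (c i))"
    using p c by (auto simp: product_dom_def topspace_product)
  ultimately show "\<exists>U \<phi>. (U, \<phi>) \<in> matlas M \<and> p \<in> U" by blast
qed

end

section \<open>Pulling functions back and pushing vectors forward along the projections\<close>

context charted_factors
begin

lemma smooth_fst:
  assumes "openin (mtop M) V"
  shows "smooth_fun M V fst"
proof (rule product.smooth_funI)
  fix W \<Phi> assume W: "(W, \<Phi>) \<in> matlas M"
  then obtain U \<phi> where *: "W = product_dom I m U" "\<Phi> = product_chart m F \<phi>" "\<forall>i\<in>J. (U i, \<phi> i) \<in> matlas (F i)"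
    unfolding matlas_product by blast
  have "openin (mtop M) (V \<inter> W)" by (intro openin_Int assms product.chart_open[OF W])
  then show "C_infinity (mindex M) (\<Phi> ` (V \<inter> W)) (\<lambda>x. fst (inv_into W \<Phi> x))"
    unfolding mindex_product *(1,2) by (intro C_infinity_fst bspec[OF *(3)]) auto
qed

lemma smooth_pullback:
  assumes i: "i \<in> J" and o: "openin (mtop (F i)) W" and h: "smooth_fun (F i) W h"
  shows "smooth_fun M (preimage_factor i W) (\<lambda>q. h (snd q i))"
proof (rule product.smooth_funI)
  fix V \<Phi> assume V: "(V, \<Phi>) \<in> matlas M"
  then obtain U \<phi> where *: "V = product_dom I m U" "\<Phi> = product_chart m F \<phi>" "\<forall>i\<in>J. (U i, \<phi> i) \<in> matlas (F i)"
    unfolding matlas_product by blast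
  have "openin (mtop M) (preimage_factor i W \<inter> V)"
    by (intro openin_Int openin_preimage_factor[OF i o] product.chart_open[OF V])
  then show "C_infinity (mindex M) (\<Phi> ` (preimage_factor i W \<inter> V)) (\<lambda>x. h (snd (inv_into V \<Phi> x) i))"
    unfolding mindex_product *(1,2) by (intro C_infinity_pullback_factor[OF bspec[OF *(3)] i o h]) auto
qed

lemma snd_topspace: "i \<in> J \<Longrightarrow> p \<in> topspace (mtop M) \<Longrightarrow> snd p i \<in> topspace (mtop (F i))"
  by (auto simp: topspace_product)

lemma smooth_at_pullback:
  assumes "i \<in> J" "p \<in> topspace (mtop M)" "smooth_at (F i) (snd p i) h"
  shows "smooth_at M p (\<lambda>q. h (snd q i))"
proof -
  obtain W where W: "openin (mtop (F i)) W" "snd p i \<in> W" "smooth_fun (F i) W h"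
    using assms(3) unfolding smooth_at_def by blast
  show ?thesis
    by (rule product.smooth_atI[OF openin_preimage_factor[OF assms(1) W(1)] _ smooth_pullback[OF assms(1) W(1,3)]])
       (use assms(2) W(2) in \<open>auto simp: preimage_factor_def\<close>)
qed

lemma pushforward_apply: "smooth_at N (\<pi> p) f \<Longrightarrow> pushforward N \<pi> p v f = v (\<lambda>q. f (\<pi> q))"
  by (simp add: pushforward_def)

lemma pushforward_lin:
  "pushforward N \<pi> p (\<lambda>f. a * u f + c * v f) = (\<lambda>f. a * pushforward N \<pi> p u f + c * pushforward N \<pi> p v f)"
  by (auto simp: pushforward_def fun_eq_iff)

lemma pushforward_tangent:
  assumes i: "i \<in> J" and p: "p \<in> topspace (mtop M)" and v: "v \<in> tangent_space M p"
  shows "pushforward (F i) (\<lambda>q. snd q i) p v \<in> tangent_space (F i) (snd p i)"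
proof -
  interpret Fi: charted_space "F i" by (rule factor_charted[OF i])
  let ?v = "pushforward (F i) (\<lambda>q. snd q i) p v" and ?x = "snd p i"
  have xt: "?x \<in> topspace (mtop (F i))" by (rule snd_topspace[OF i p])
  note sp = smooth_at_pullback[OF i p]
  note ap = pushforward_apply[of "F i" "\<lambda>q. snd q i" p]
  show ?thesis
    unfolding tangent_space_def
  proof (intro CollectI conjI allI impI)
    show "?v f = 0" if "\<not> smooth_at (F i) ?x f" for f using that by (simp add: pushforward_def)
    fix f h
    show "?v f = ?v h"
      if *: "smooth_at (F i) ?x f \<and> smooth_at (F i) ?x h \<and> (\<exists>U. openin (mtop (F i)) U \<and> ?x \<in> U \<and> (\<forall>q\<in>U. f q = h q))"
    proof -
      from * obtain U where fh: "smooth_at (F i) ?x f" "smooth_at (F i) ?x h"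
        and U: "openin (mtop (F i)) U" "?x \<in> U" "\<forall>q\<in>U. f q = h q" by (elim conjE exE)
      have "p \<in> preimage_factor i U" using U(2) p by (simp add: preimage_factor_def)
      then have "v (\<lambda>q. f (snd q i)) = v (\<lambda>q. h (snd q i))"
        by (rule product.tangent_cong[OF v sp[OF fh(1)] sp[OF fh(2)] openin_preimage_factor[OF i U(1)]])
           (rule bspec[OF U(3)], simp add: preimage_factor_def)
      then show ?thesis using fh by (simp add: ap)
    qed
    show "?v (\<lambda>q. a * f q + c * h q) = a * ?v f + c * ?v h" if "smooth_at (F i) ?x f \<and> smooth_at (F i) ?x h" for a c
    proof -
      have fh: "smooth_at (F i) ?x f" "smooth_at (F i) ?x h" using that by auto
      have "smooth_at (F i) ?x (\<lambda>q. a * f q + c * h q)"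
        by (intro Fi.smooth_at_add Fi.smooth_at_mult Fi.smooth_at_const xt fh)
      then show ?thesis using fh product.tangent_lin[OF v sp[OF fh(1)] sp[OF fh(2)]] by (simp add: ap)
    qed
    show "?v (\<lambda>q. f q * h q) = ?v f * h ?x + f ?x * ?v h" if "smooth_at (F i) ?x f \<and> smooth_at (F i) ?x h"
    proof -
      have fh: "smooth_at (F i) ?x f" "smooth_at (F i) ?x h" using that by auto
      have "smooth_at (F i) ?x (\<lambda>q. f q * h q)" by (intro Fi.smooth_at_mult fh)
      then show ?thesis using fh product.tangent_mult[OF v sp[OF fh(1)] sp[OF fh(2)]] by (simp add: ap)
    qed
  qed
qed

lemma smooth_fst_compose:
  assumes "openin (mtop M) V" "\<And>n t. t \<in> I \<Longrightarrow> (deriv ^^ n) u differentiable (at t)"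
  shows "smooth_fun M V (\<lambda>q. u (fst q))"
proof (rule product.smooth_fun_compose_real[OF assms(1) smooth_fst[OF assms(1)]])
  fix n p assume "p \<in> V"
  then have "fst p \<in> I" using openin_subset[OF assms(1)] by (auto simp: topspace_product)
  then show "(deriv ^^ n) u differentiable (at (fst p))" by (rule assms(2))
qed

end

section \<open>Coordinate fields and lifts in a product chart\<close>

locale product_chart_at = charted_factors I m F
  for I :: "real set" and m and F :: "nat \<Rightarrow> ('a, 'k) manifold" +
  fixes U :: "nat \<Rightarrow> 'a set" and \<phi> :: "nat \<Rightarrow> 'a \<Rightarrow> 'k \<Rightarrow> real"
  assumes charts: "i \<in> {1..m} \<Longrightarrow> (U i, \<phi> i) \<in> matlas (F i)"
begin

abbreviation "QU \<equiv> product_dom I m U"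
abbreviation "Q\<phi> \<equiv> product_chart m F \<phi>"
abbreviation "cvf \<equiv> coord_vf M QU Q\<phi>"

lemma product_atlas: "(QU, Q\<phi>) \<in> matlas M"
  unfolding matlas_product using charts by blast

lemma PU_open: "openin (mtop M) QU"
  by (rule product.chart_open[OF product_atlas])

lemma PU_top: "p \<in> QU \<Longrightarrow> p \<in> topspace (mtop M)"
  by (rule product.openin_topspace_subset[OF PU_open])

lemma PU_snd: "p \<in> QU \<Longrightarrow> i \<in> J \<Longrightarrow> snd p i \<in> U i"
  by (auto simp: product_dom_def)

lemma coord_partial:
  assumes p: "p \<in> QU" and j: "j \<in> KM" and f: "smooth_at M p f"
  shows "cvf j p f = partial_deriv j (\<lambda>y. f (chart_inverse U \<phi> y)) (Q\<phi> p)"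
proof -
  have "partial_deriv j (\<lambda>y. f (inv_into QU Q\<phi> y)) (Q\<phi> p) = partial_deriv j (\<lambda>y. f (chart_inverse U \<phi> y)) (Q\<phi> p)"
    by (rule partial_deriv_cong[OF finite_product_index openin_product_chart_image[OF charts] _ j])
       (use p inv_product_chart[OF charts] in auto)
  then show ?thesis using f by (simp add: coord_vf_def)
qed

lemma chart_inverse_simps:
  "fst (chart_inverse U \<phi> y) = y None"
  "i \<in> J \<Longrightarrow> snd (chart_inverse U \<phi> y) i = inv_into (U i) (\<phi> i) (factor_coords F i y)"
  using chart_inverse_def[OF charts, of y] by simp_all

lemma coord_None_fst:
  assumes "p \<in> QU" "smooth_at M p (\<lambda>q. u (fst q))"
  shows "cvf None p (\<lambda>q. u (fst q)) = deriv u (fst p)"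
  using coord_partial[OF assms(1) _ assms(2), of None]
  by (simp add: chart_inverse_simps partial_deriv_def)

lemma coord_Some_fst:
  assumes "p \<in> QU" "smooth_at M p (\<lambda>q. u (fst q))" "i \<in> J" "k \<in> mindex (F i)"
  shows "cvf (Some (i, k)) p (\<lambda>q. u (fst q)) = 0"
  using coord_partial[OF assms(1) _ assms(2), of "Some (i, k)"] assms(3,4)
  by (simp add: chart_inverse_simps partial_deriv_def)

lemma coord_None_pullback:
  assumes "p \<in> QU" "i \<in> J" "smooth_at (F i) (snd p i) h"
  shows "cvf None p (\<lambda>q. h (snd q i)) = 0"
  using coord_partial[OF assms(1) _ smooth_at_pullback[OF assms(2) PU_top[OF assms(1)] assms(3)], of None] assms(2)
  by (simp add: chart_inverse_simps partial_deriv_def factor_coords_def)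

lemma coord_Some_pullback:
  assumes p: "p \<in> QU" and i: "i \<in> J" and h: "smooth_at (F i) (snd p i) h" and j: "j \<in> J" "k \<in> mindex (F j)"
  shows "cvf (Some (j, k)) p (\<lambda>q. h (snd q i)) = (if i = j then coord_vf (F i) (U i) (\<phi> i) k (snd p i) h else 0)"
proof -
  note * = coord_partial[OF p _ smooth_at_pullback[OF i PU_top[OF p] h], of "Some (j, k)"]
  have fc: "factor_coords F i (Q\<phi> p) = \<phi> i (snd p i)" by (rule factor_coords_chart[OF charts i p])
  show ?thesis
  proof (cases "i = j")
    case True
    have "factor_coords F i ((Q\<phi> p)(Some (j, k) := s)) = (\<phi> i (snd p i))(k := s)" for s
    proof
      fix l show "factor_coords F i ((Q\<phi> p)(Some (j, k) := s)) l = ((\<phi> i (snd p i))(k := s)) l"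
        using fun_cong[OF fc, of l] True j by (auto simp: factor_coords_def)
    qed
    then show ?thesis
      using * i j True h coord_vf_def[of "F i"] by (simp add: chart_inverse_simps partial_deriv_def)
  next
    case False
    have "factor_coords F i ((Q\<phi> p)(Some (j, k) := s)) = factor_coords F i (Q\<phi> p)" for s
      using False by (auto simp: factor_coords_def)
    then show ?thesis
      using * i j False by (simp add: chart_inverse_simps partial_deriv_def)
  qed
qed

text \<open>The coordinates of a product chart are \<open>fst\<close> and pulled-back coordinates of
  the factors, and a tangent vector is determined by its values on coordinates. Brackets of frame
  fields are compared in this way.\<close>

lemma tangent_eqI:
  assumes p: "p \<in> QU" and v: "v \<in> tangent_space M p" and w: "w \<in> tangent_space M p" and "v fst = w fst"
    and eq: "\<And>i h. i \<in> J \<Longrightarrow> smooth_at (F i) (snd p i) h \<Longrightarrow> v (\<lambda>q. h (snd q i)) = w (\<lambda>q. h (snd q i))"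
  shows "v = w"
proof -
  have "v (\<lambda>q. Q\<phi> q j) = w (\<lambda>q. Q\<phi> q j)" if j: "j \<in> KM" for j
  proof (cases j)
    case None
    have "(\<lambda>q. Q\<phi> q None) = fst" by (simp add: fun_eq_iff)
    then show ?thesis using None assms(4) by simp
  next
    case (Some ik)
    then obtain i k where j': "j = Some (i, k)" by (cases ik) auto
    then have ik: "i \<in> J" "k \<in> mindex (F i)" using j by auto
    interpret Fi: charted_space "F i" by (rule factor_charted[OF ik(1)])
    have "smooth_at (F i) (snd p i) (\<lambda>x. \<phi> i x k)"
      by (rule Fi.smooth_atI[OF Fi.chart_open[OF charts[OF ik(1)]] PU_snd[OF p ik(1)] Fi.smooth_fun_coord[OF charts[OF ik(1)] ik(2)]])
    from eq[OF ik(1) this] show ?thesis using ik by (simp add: j')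
  qed
  then have "(\<lambda>f. \<Sum>j\<in>mindex M. v (\<lambda>q. Q\<phi> q j) * cvf j p f) = (\<lambda>f. \<Sum>j\<in>mindex M. w (\<lambda>q. Q\<phi> q j) * cvf j p f)"
    by (simp add: mindex_product)
  then show ?thesis
    using product.tangent_expand[OF product_atlas p v] product.tangent_expand[OF product_atlas p w] by simp
qed

text \<open>Identifies the field \<open>P\<close>, which is defined without charts, with a
  coordinate field, from which it inherits tangency and smoothness.\<close>

lemma d_dt_eq:
  assumes p: "p \<in> QU"
  shows "d_dt I m F p = cvf None p"
proof
  fix f
  show "d_dt I m F p f = cvf None p f"
  proof (cases "smooth_at M p f")
    case True
    \<comment> \<open>As long as \<open>s\<close> stays in \<open>I\<close>, changing the first
      component of \<open>p\<close> stays in the chart domain and runs along the coordinate line of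
      \<open>None\<close>.\<close>
    have "eventually (\<lambda>s. s \<in> I) (nhds (fst p))"
      using I_open p by (intro eventually_nhds_in_open) (auto simp: product_dom_def)
    then have "eventually (\<lambda>s. f (s, snd p) = f (chart_inverse U \<phi> ((Q\<phi> p)(None := s)))) (nhds (fst p))"
    proof eventually_elim
      case (elim s)
      have "(Q\<phi> p)(None := s) = Q\<phi> (s, snd p)"
        by (auto simp: product_chart_def split_beta fun_eq_iff)
      moreover have "(s, snd p) \<in> QU" using p elim by (auto simp: product_dom_def)
      ultimately show ?case using chart_inverse_chart[OF charts, of "(s, snd p)"] by simp
    qed
    then have "deriv (\<lambda>s. f (s, snd p)) (fst p) = deriv (\<lambda>s. f (chart_inverse U \<phi> ((Q\<phi> p)(None := s)))) (fst p)"
      by (intro deriv_cong_ev) auto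
    then show ?thesis
      using True coord_partial[OF p _ True, of None] by (simp add: d_dt_def partial_deriv_def)
  next
    case False
    then show ?thesis by (simp add: d_dt_def coord_vf_def)
  qed
qed

text \<open>The components of \<open>X\<close> in the chart of the factor, pulled back, on the
  coordinate fields of the \<open>i\<close>-th block. The chart only serves the construction: the
  values on functions of t and on pullbacks do not involve it.\<close>

definition lift_vf :: "nat \<Rightarrow> 'a vfield \<Rightarrow> (real \<times> (nat \<Rightarrow> 'a)) vfield" where
  "lift_vf i X = vf_sum (mindex (F i)) (\<lambda>k. vf_scale (\<lambda>q. X (snd q i) (\<lambda>x. \<phi> i x k)) (cvf (Some (i, k))))"

lemma lift_vf_closed:
  assumes i: "i \<in> J" and W: "openin (mtop (F i)) W" "W \<subseteq> U i" and X: "X \<in> vector_fields (F i) W"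
    and V: "openin (mtop M) V" "V \<subseteq> QU" "V \<subseteq> preimage_factor i W"
  shows "lift_vf i X \<in> vector_fields M V"
proof -
  interpret Fi: charted_space "F i" by (rule factor_charted[OF i])
  show ?thesis
    unfolding lift_vf_def
  proof (intro product.vf_sum_closed product.vf_scale_closed V(1) Fi.finite_index)
    fix k assume k: "k \<in> mindex (F i)"
    show "cvf (Some (i, k)) \<in> vector_fields M V"
      by (rule product.vf_subset[OF product.coord_vf_vector_field[OF product_atlas] V(2)])
         (use i k in \<open>simp add: mindex_product\<close>)
    have "smooth_fun (F i) W (\<lambda>x. \<phi> i x k)"
      by (rule Fi.smooth_fun_subset[OF Fi.chart_open[OF charts[OF i]] W Fi.smooth_fun_coord[OF charts[OF i] k]])
    then have "smooth_fun (F i) W (\<lambda>x. X x (\<lambda>x. \<phi> i x k))" by (rule Fi.vf_smooth[OF X W(1) order_refl])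
    from smooth_pullback[OF i W(1) this]
    show "smooth_fun M V (\<lambda>q. X (snd q i) (\<lambda>x. \<phi> i x k))"
      by (rule product.smooth_fun_subset[OF openin_preimage_factor[OF i W(1)] V(1,3)])
  qed
qed

lemma lift_vf_fst:
  assumes "i \<in> J" "p \<in> QU" "smooth_at M p (\<lambda>q. u (fst q))"
  shows "lift_vf i X p (\<lambda>q. u (fst q)) = 0"
  using coord_Some_fst[OF assms(2,3,1)] by (simp add: lift_vf_def vf_sum_apply vf_scale_apply)

lemma lift_vf_pullback:
  assumes i: "i \<in> J" and p: "p \<in> QU" and j: "j \<in> J" and h: "smooth_at (F j) (snd p j) h"
    and X: "X (snd p i) \<in> tangent_space (F i) (snd p i)"
  shows "lift_vf i X p (\<lambda>q. h (snd q j)) = (if i = j then X (snd p i) h else 0)"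
proof -
  interpret Fi: charted_space "F i" by (rule factor_charted[OF i])
  have "lift_vf i X p (\<lambda>q. h (snd q j)) =
      (\<Sum>k\<in>mindex (F i). X (snd p i) (\<lambda>x. \<phi> i x k) * (if j = i then coord_vf (F j) (U j) (\<phi> j) k (snd p j) h else 0))"
    using coord_Some_pullback[OF p j h i] by (simp add: lift_vf_def vf_sum_apply vf_scale_apply)
  also have "\<dots> = (if i = j then X (snd p i) h else 0)"
    using fun_cong[OF Fi.tangent_expand[OF charts[OF i] PU_snd[OF p i] X], of h] by auto
  finally show ?thesis .
qed

end

section \<open>Warped metrics\<close>

locale warped = charted_factors I m F
  for I :: "real set" and m and F :: "nat \<Rightarrow> ('a, 'k) manifold" +
  fixes gF :: "nat \<Rightarrow> 'a metric_field" and b :: "nat \<Rightarrow> real \<Rightarrow> real"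
  assumes factor_metric: "i \<in> {1..m} \<Longrightarrow> charted_metric (F i) (gF i)"
    and b_smooth: "i \<in> {1..m} \<Longrightarrow> smooth_on_interval I (b i)"
    and b_pos: "i \<in> {1..m} \<Longrightarrow> t \<in> I \<Longrightarrow> b i t > 0"
begin

abbreviation "gM \<equiv> warped_metric m F gF b"
abbreviation "push i \<equiv> pushforward (F i) (\<lambda>q. snd q i)"

lemma ex_product_chart:
  assumes "p \<in> topspace (mtop M)"
  obtains U \<phi> where "\<And>i. i \<in> J \<Longrightarrow> (U i, \<phi> i) \<in> matlas (F i)" "p \<in> product_dom I m U"
proof -
  obtain W \<Phi> where W: "(W, \<Phi>) \<in> matlas M" "p \<in> W" using product.charts_cover[OF assms] by blast
  then obtain U \<phi> where *: "W = product_dom I m U" "\<Phi> = product_chart m F \<phi>" "\<forall>i\<in>J. (U i, \<phi> i) \<in> matlas (F i)"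
    unfolding matlas_product by blast
  show ?thesis using that[OF bspec[OF *(3)]] W(2) unfolding *(1) by blast
qed

lemma smooth_b:
  assumes "i \<in> J" "openin (mtop M) V"
  shows "smooth_fun M V (\<lambda>q. b i (fst q))" "smooth_fun M V (\<lambda>q. deriv (b i) (fst q))"
proof -
  have *: "(deriv ^^ n) (b i) differentiable (at t)" if "t \<in> I" for n t
    using b_smooth[OF assms(1)] that by (simp add: smooth_on_interval_def)
  show "smooth_fun M V (\<lambda>q. b i (fst q))" by (rule smooth_fst_compose[OF assms(2) *])
  have "(deriv ^^ n) (deriv (b i)) differentiable (at t)" if "t \<in> I" for n t
    using *[OF that, of "Suc n"] by (simp add: funpow_swap1)
  then show "smooth_fun M V (\<lambda>q. deriv (b i) (fst q))" by (rule smooth_fst_compose[OF assms(2)])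
qed

lemma fst_I: "openin (mtop M) V \<Longrightarrow> q \<in> V \<Longrightarrow> fst q \<in> I"
  using openin_subset[of "mtop M" V] by (auto simp: topspace_product)

text \<open>Smoothness is the delicate axiom. The push-forward of a field on the product varies with
  the other components and is no field on the factor, so \<open>g_smooth\<close> of the factor
  cannot be applied to it. Expansion in coordinate fields of the factor separates coefficients
  smooth on the product from pulled-back metric coefficients.\<close>

sublocale warped_product: charted_metric M gM
proof
  fix p u v assume p: "p \<in> topspace (mtop M)" and u: "u \<in> tangent_space M p" and v: "v \<in> tangent_space M p"
  have sy: "gF i (snd p i) (push i p u) (push i p v) = gF i (snd p i) (push i p v) (push i p u)" if "i \<in> J" for i
    by (intro charted_metric.g_sym[OF factor_metric[OF that]] snd_topspace[OF that p] pushforward_tangent[OF that p] u v)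
  show "gM p u v = gM p v u"
    unfolding warped_metric_def using sy by (simp add: mult.commute)
  fix a c w assume w: "w \<in> tangent_space M p"
  have li: "gF i (snd p i) (push i p (\<lambda>f. a * u f + c * v f)) (push i p w) =
      a * gF i (snd p i) (push i p u) (push i p w) + c * gF i (snd p i) (push i p v) (push i p w)" if "i \<in> J" for i
    unfolding pushforward_lin
    by (intro charted_metric.g_lin[OF factor_metric[OF that]] snd_topspace[OF that p] pushforward_tangent[OF that p] u v w)
  have "(\<Sum>i=1..m. (b i (fst p))\<^sup>2 * gF i (snd p i) (push i p (\<lambda>f. a * u f + c * v f)) (push i p w)) =
      (\<Sum>i=1..m. a * ((b i (fst p))\<^sup>2 * gF i (snd p i) (push i p u) (push i p w)) +
        c * ((b i (fst p))\<^sup>2 * gF i (snd p i) (push i p v) (push i p w)))"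
    using li by (intro sum.cong refl) (simp add: algebra_simps)
  also have "\<dots> = a * (\<Sum>i=1..m. (b i (fst p))\<^sup>2 * gF i (snd p i) (push i p u) (push i p w)) +
      c * (\<Sum>i=1..m. (b i (fst p))\<^sup>2 * gF i (snd p i) (push i p v) (push i p w))"
    by (simp only: sum.distrib sum_distrib_left)
  finally show "gM p (\<lambda>f. a * u f + c * v f) w = a * gM p u w + c * gM p v w"
    unfolding warped_metric_def by (simp add: algebra_simps)
next
  fix V X Y assume V: "openin (mtop M) V" and X: "X \<in> vector_fields M V" and Y: "Y \<in> vector_fields M V"
  show "smooth_fun M V (\<lambda>p. gM p (X p) (Y p))"
  proof (rule product.smooth_fun_local[OF V])
    fix p assume p: "p \<in> V"
    obtain U \<phi> where ch: "\<And>i. i \<in> J \<Longrightarrow> (U i, \<phi> i) \<in> matlas (F i)" and pU: "p \<in> product_dom I m U"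
      using ex_product_chart[OF product.openin_topspace_subset[OF V p]] by blast
    interpret product_chart_at I m F U \<phi> by unfold_locales (rule ch)
    define W where "W = V \<inter> QU"
    have W: "openin (mtop M) W" "W \<subseteq> V" "W \<subseteq> QU" "p \<in> W" using V PU_open p pU by (auto simp: W_def)
    have XW: "X \<in> vector_fields M W" and YW: "Y \<in> vector_fields M W"
      using product.vf_subset[OF X W(2)] product.vf_subset[OF Y W(2)] by auto
    let ?c = "\<lambda>i. coord_vf (F i) (U i) (\<phi> i)" and ?x = "\<lambda>Z i k q. Z q (\<lambda>q. \<phi> i (snd q i) k)"
    have push: "push i q (Z q) = (\<lambda>f. \<Sum>k\<in>mindex (F i). ?x Z i k q * ?c i k (snd q i) f)"
      if i: "i \<in> J" and q: "q \<in> W" and Z: "Z \<in> vector_fields M W" for i q Z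
    proof -
      interpret Fi: charted_space "F i" by (rule factor_charted[OF i])
      have qU: "snd q i \<in> U i" using PU_snd[OF _ i] q W(3) by blast
      have "push i q (Z q) \<in> tangent_space (F i) (snd q i)"
        by (rule pushforward_tangent[OF i product.openin_topspace_subset[OF W(1) q] product.vfD[OF Z q]])
      from Fi.tangent_expand[OF ch[OF i] qU this]
      have "push i q (Z q) = (\<lambda>f. \<Sum>k\<in>mindex (F i). push i q (Z q) (\<lambda>x. \<phi> i x k) * ?c i k (snd q i) f)" .
      moreover have "push i q (Z q) (\<lambda>x. \<phi> i x k) = ?x Z i k q" if "k \<in> mindex (F i)" for k
        by (rule pushforward_apply) (rule Fi.smooth_atI[OF Fi.chart_open[OF ch[OF i]] qU Fi.smooth_fun_coord[OF ch[OF i] that]])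
      ultimately show ?thesis by simp
    qed
    have eq: "- (X q fst * Y q fst) + (\<Sum>i=1..m. (b i (fst q) * b i (fst q)) *
        (\<Sum>k\<in>mindex (F i). ?x X i k q * (\<Sum>l\<in>mindex (F i). ?x Y i l q * gF i (snd q i) (?c i k (snd q i)) (?c i l (snd q i))))) =
        gM q (X q) (Y q)" if q: "q \<in> W" for q
    proof -
      have "gF i (snd q i) (push i q (X q)) (push i q (Y q)) =
          (\<Sum>k\<in>mindex (F i). ?x X i k q * (\<Sum>l\<in>mindex (F i). ?x Y i l q * gF i (snd q i) (?c i k (snd q i)) (?c i l (snd q i))))"
        if i: "i \<in> J" for i
      proof -
        interpret Fi: charted_metric "F i" "gF i" by (rule factor_metric[OF i])
        have qt: "snd q i \<in> topspace (mtop (F i))" by (rule snd_topspace[OF i product.openin_topspace_subset[OF W(1) q]])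
        have qU: "snd q i \<in> U i" using PU_snd[OF _ i] q W(3) by blast
        have cT: "?c i k (snd q i) \<in> tangent_space (F i) (snd q i)" if "k \<in> mindex (F i)" for k
          by (rule Fi.coord_vf_tangent[OF ch[OF i] that qU])
        have sT: "(\<lambda>f. \<Sum>k\<in>mindex (F i). ?x Y i k q * ?c i k (snd q i) f) \<in> tangent_space (F i) (snd q i)"
          by (intro Fi.tangent_space_sum cT)
        show ?thesis
          unfolding push[OF i q XW] push[OF i q YW]
          by (rule trans[OF Fi.g_sum[OF qt sT cT]], assumption,
              intro sum.cong refl arg_cong2[of _ _ _ _ "(*)"] Fi.g_sum_right[OF qt cT cT])
      qed
      then show ?thesis unfolding warped_metric_def by (simp add: power2_eq_square)
    qed
    have sm: "smooth_fun M W (\<lambda>q. - (X q fst * Y q fst) + (\<Sum>i=1..m. (b i (fst q) * b i (fst q)) *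
        (\<Sum>k\<in>mindex (F i). ?x X i k q * (\<Sum>l\<in>mindex (F i). ?x Y i l q * gF i (snd q i) (?c i k (snd q i)) (?c i l (snd q i))))))"
    proof (intro product.smooth_fun_add product.smooth_fun_minus product.smooth_fun_mult product.smooth_fun_sum W(1)
        product.vf_smooth[OF XW W(1) order_refl] product.vf_smooth[OF YW W(1) order_refl] smooth_fst smooth_b)
      fix i k assume i: "i \<in> J" and k: "k \<in> mindex (F i)"
      interpret Fi: charted_metric "F i" "gF i" by (rule factor_metric[OF i])
      have sub: "W \<subseteq> preimage_factor i (U i)"
        using PU_snd[OF subsetD[OF W(3)] i] PU_top[OF subsetD[OF W(3)]] by (auto simp: preimage_factor_def)
      note oi = Fi.chart_open[OF ch[OF i]]
      show 1: "smooth_fun M W (\<lambda>q. \<phi> i (snd q i) k)"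
        by (rule product.smooth_fun_subset[OF openin_preimage_factor[OF i oi] W(1) sub
              smooth_pullback[OF i oi Fi.smooth_fun_coord[OF ch[OF i] k]]])
      then show "smooth_fun M W (\<lambda>q. \<phi> i (snd q i) k)" .
      show "smooth_fun M W (\<lambda>q. gF i (snd q i) (?c i k (snd q i)) (?c i l (snd q i)))" if l: "l \<in> mindex (F i)" for l
        by (rule product.smooth_fun_subset[OF openin_preimage_factor[OF i oi] W(1) sub
              smooth_pullback[OF i oi Fi.g_smooth[OF oi Fi.coord_vf_vector_field[OF ch[OF i] k] Fi.coord_vf_vector_field[OF ch[OF i] l]]]])
    qed
    have "smooth_fun M W (\<lambda>p. gM p (X p) (Y p))"
      by (rule product.smooth_fun_cong[OF W(1) _ sm]) (rule eq)
    then show "\<exists>W. openin (mtop M) W \<and> p \<in> W \<and> smooth_fun M W (\<lambda>p. gM p (X p) (Y p))" using W by blast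
  qed
qed

end

lemma sum_product_index:
  assumes "\<And>i. i \<in> {1..m} \<Longrightarrow> finite (mindex (F i))"
  shows "(\<Sum>c\<in>product_index m F. f c) = f None + (\<Sum>i=1..m. \<Sum>k\<in>mindex (F i). f (Some (i, k)) :: real)"
proof -
  have fin: "finite (SIGMA i:{1..m}. mindex (F i))" using assms by (intro finite_SigmaI) auto
  have "(\<Sum>c\<in>product_index m F. f c) = f None + (\<Sum>c\<in>Some ` (SIGMA i:{1..m}. mindex (F i)). f c)"
    unfolding product_index_def using fin by (subst sum.insert) auto
  also have "(\<Sum>c\<in>Some ` (SIGMA i:{1..m}. mindex (F i)). f c) = (\<Sum>ik\<in>(SIGMA i:{1..m}. mindex (F i)). f (Some ik))"
    by (subst sum.reindex) auto
  also have "\<dots> = (\<Sum>i=1..m. \<Sum>k\<in>mindex (F i). f (Some (i, k)))"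
    using assms by (subst sum.Sigma) (auto simp: split_beta)
  finally show ?thesis .
qed

section \<open>The lifted frame: metric and brackets\<close>

locale warped_frame = warped I m F gF b + product_chart_at I m F U \<phi>
  for I :: "real set" and m and F :: "nat \<Rightarrow> ('a, 'k) manifold" and gF b U \<phi> +
  fixes V :: "nat \<Rightarrow> 'a set" and e :: "nat \<Rightarrow> 'k \<Rightarrow> 'a vfield" and \<epsilon> :: "nat \<Rightarrow> 'k \<Rightarrow> real"
  assumes V_open: "i \<in> {1..m} \<Longrightarrow> openin (mtop (F i)) (V i)"
    and V_sub: "i \<in> {1..m} \<Longrightarrow> V i \<subseteq> U i"
    and e_vf: "i \<in> {1..m} \<Longrightarrow> k \<in> mindex (F i) \<Longrightarrow> e i k \<in> vector_fields (F i) (V i)"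
    and eps: "i \<in> {1..m} \<Longrightarrow> k \<in> mindex (F i) \<Longrightarrow> \<epsilon> i k = 1 \<or> \<epsilon> i k = - 1"
    and e_orth: "i \<in> {1..m} \<Longrightarrow> x \<in> V i \<Longrightarrow> k \<in> mindex (F i) \<Longrightarrow> l \<in> mindex (F i) \<Longrightarrow>
      gF i x (e i k x) (e i l x) = (if k = l then \<epsilon> i k else 0)"
begin

definition "W = product_dom I m V"

lemma W_open: "openin (mtop M) W"
  unfolding W_def by (rule openin_product_dom[OF V_open])

lemma W_sub: "W \<subseteq> QU"
  using V_sub by (fastforce simp: W_def product_dom_def PiE_iff)

lemma W_QU: "q \<in> W \<Longrightarrow> q \<in> QU"
  using W_sub by blast

lemma W_top: "q \<in> W \<Longrightarrow> q \<in> topspace (mtop M)"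
  by (rule product.openin_topspace_subset[OF W_open])

lemma W_fst: "q \<in> W \<Longrightarrow> fst q \<in> I"
  by (rule fst_I[OF W_open])

lemma W_snd: "q \<in> W \<Longrightarrow> i \<in> J \<Longrightarrow> snd q i \<in> V i"
  by (auto simp: W_def product_dom_def)

lemma W_pre: "i \<in> J \<Longrightarrow> W \<subseteq> preimage_factor i (V i)"
  using W_top W_snd by (auto simp: preimage_factor_def)

lemma smooth_pullback_W:
  "i \<in> J \<Longrightarrow> smooth_fun (F i) (V i) h \<Longrightarrow> smooth_fun M W (\<lambda>q. h (snd q i))"
  by (rule product.smooth_fun_subset[OF openin_preimage_factor[OF _ V_open] W_open W_pre smooth_pullback[OF _ V_open]])

text \<open>The lifts are not divided by \<open>b i\<close>: since \<open>b i\<close> varies with t,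
  the quotients would in general fail to commute with \<open>d_dt\<close>.\<close>

definition B :: "(nat \<times> 'k) option \<Rightarrow> (real \<times> (nat \<Rightarrow> 'a)) vfield" where
  "B a = (case a of None \<Rightarrow> d_dt I m F | Some (i, k) \<Rightarrow> lift_vf i (e i k))"

lemma index_cases [consumes 1, case_names None Some]:
  assumes "a \<in> KM" "a = None \<Longrightarrow> P" "\<And>i k. a = Some (i, k) \<Longrightarrow> i \<in> J \<Longrightarrow> k \<in> mindex (F i) \<Longrightarrow> P"
  shows P
  using assms by (auto simp: product_index_def)

lemma e_tangent: "i \<in> J \<Longrightarrow> k \<in> mindex (F i) \<Longrightarrow> x \<in> V i \<Longrightarrow> e i k x \<in> tangent_space (F i) x"
  using charted_space.vfD[OF factor_charted e_vf] .

lemma B_closed: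
  assumes "a \<in> KM"
  shows "B a \<in> vector_fields M W"
  using assms
proof (cases rule: index_cases)
  case None
  have "cvf None \<in> vector_fields M W"
    by (rule product.vf_subset[OF product.coord_vf_vector_field[OF product_atlas] W_sub]) (simp add: mindex_product)
  then have "d_dt I m F \<in> vector_fields M W"
    by (rule product.vf_cong[OF W_open]) (use d_dt_eq W_sub in auto)
  then show ?thesis using None by (simp add: B_def)
next
  case (Some i k)
  then show ?thesis
    using lift_vf_closed[OF Some(2) V_open V_sub e_vf W_open W_sub W_pre] by (simp add: B_def)
qed

lemma B_tangent: "a \<in> KM \<Longrightarrow> q \<in> W \<Longrightarrow> B a q \<in> tangent_space M q"
  by (rule product.vfD[OF B_closed])

lemma B_fst:
  assumes "q \<in> W" "a \<in> KM" "smooth_at M q (\<lambda>q. u (fst q))"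
  shows "B a q (\<lambda>q. u (fst q)) = (if a = None then deriv u (fst q) else 0)"
  using assms(2)
proof (cases rule: index_cases)
  case None
  then show ?thesis using coord_None_fst[OF W_QU[OF assms(1)] assms(3)] d_dt_eq[OF W_QU[OF assms(1)]] by (simp add: B_def)
next
  case (Some i k)
  then show ?thesis using lift_vf_fst[OF Some(2) W_QU[OF assms(1)] assms(3)] by (simp add: B_def)
qed

lemma B_pullback:
  assumes "q \<in> W" "a \<in> KM" "j \<in> J" "smooth_at (F j) (snd q j) h"
  shows "B a q (\<lambda>q. h (snd q j)) =
    (case a of None \<Rightarrow> 0 | Some (i, k) \<Rightarrow> if i = j then e i k (snd q i) h else 0)"
  using assms(2)
proof (cases rule: index_cases)
  case None
  then show ?thesis
    using coord_None_pullback[OF W_QU[OF assms(1)] assms(3,4)] d_dt_eq[OF W_QU[OF assms(1)]] by (simp add: B_def)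
next
  case (Some i k)
  then show ?thesis
    using lift_vf_pullback[where X = "e i k", OF Some(2) W_QU[OF assms(1)] assms(3,4) e_tangent[OF Some(2,3) W_snd[OF assms(1) Some(2)]]]
    by (simp add: B_def)
qed

lemma B_const: "q \<in> W \<Longrightarrow> a \<in> KM \<Longrightarrow> B a q (\<lambda>_. c) = 0"
  by (rule product.tangent_const[OF B_tangent W_top])

lemma B_fst': "q \<in> W \<Longrightarrow> a \<in> KM \<Longrightarrow> B a q fst = (if a = None then 1 else 0)"
  using B_fst[of q a "\<lambda>t. t"] product.smooth_atI[OF W_open _ smooth_fst[OF W_open], of q] by simp

lemma push_B:
  assumes q: "q \<in> W" and a: "a \<in> KM" and j: "j \<in> J"
  shows "push j q (B a q) = (case a of None \<Rightarrow> (\<lambda>f. 0) | Some (i, k) \<Rightarrow> if i = j then e i k (snd q i) else (\<lambda>f. 0))"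
proof
  fix h
  interpret Fj: charted_space "F j" by (rule factor_charted[OF j])
  show "push j q (B a q) h = (case a of None \<Rightarrow> (\<lambda>f. 0) | Some (i, k) \<Rightarrow> if i = j then e i k (snd q i) else (\<lambda>f. 0)) h"
  proof (cases "smooth_at (F j) (snd q j) h")
    case True
    then show ?thesis using B_pullback[OF q a j True] by (simp add: pushforward_apply split: option.split)
  next
    \<comment> \<open>Both sides vanish on functions not smooth at the point, the left by the
      definition of \<open>pushforward\<close>, the right by the convention for tangent
      vectors.\<close>
    case False
    have "e j k (snd q j) h = 0" if "k \<in> mindex (F j)" for k
      by (rule Fj.tangent_nonsmooth[OF e_tangent[OF j that W_snd[OF q j]] False])
    with a show ?thesis
      by (cases rule: index_cases) (use False in \<open>auto simp: pushforward_def\<close>)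
  qed
qed

definition G :: "(nat \<times> 'k) option \<Rightarrow> real \<times> (nat \<Rightarrow> 'a) \<Rightarrow> real" where
  "G a q = (case a of None \<Rightarrow> - 1 | Some (i, k) \<Rightarrow> (b i (fst q))\<^sup>2 * \<epsilon> i k)"

lemma gM_B:
  assumes q: "q \<in> W" and a: "a \<in> KM" and a': "a' \<in> KM"
  shows "gM q (B a q) (B a' q) = (if a = a' then G a q else 0)"
proof -
  have z: "gF i (snd q i) (\<lambda>f. 0) v = 0" "gF i (snd q i) v (\<lambda>f. 0) = 0"
    if i: "i \<in> J" and v: "v \<in> tangent_space (F i) (snd q i)" for i v
  proof -
    interpret Fi: charted_metric "F i" "gF i" by (rule factor_metric[OF i])
    have xt: "snd q i \<in> topspace (mtop (F i))" by (rule snd_topspace[OF i W_top[OF q]])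
    show "gF i (snd q i) (\<lambda>f. 0) v = 0" by (rule Fi.g_0[OF xt v])
    then show "gF i (snd q i) v (\<lambda>f. 0) = 0" using Fi.g_sym[OF xt v Fi.tangent_space_0] by simp
  qed
  have z0: "gF i (snd q i) (\<lambda>f. 0) (\<lambda>f. 0) = 0" if "i \<in> J" for i
    by (rule z[OF that charted_space.tangent_space_0[OF factor_charted[OF that]]])
  have eT: "e i k (snd q i) \<in> tangent_space (F i) (snd q i)" if "i \<in> J" "k \<in> mindex (F i)" for i k
    by (rule e_tangent[OF that W_snd[OF q that(1)]])
  \<comment> \<open>Only the factor to which \<open>a\<close> belongs can contribute, and none does
    for \<open>a = None\<close>.\<close>
  have s: "(\<Sum>i=1..m. (b i (fst q))\<^sup>2 * gF i (snd q i) (push i q (B a q)) (push i q (B a' q))) =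
     (\<Sum>i=1..m. case a of None \<Rightarrow> 0 | Some (j, k) \<Rightarrow> if i = j then (if a = a' then G a q else 0) else 0)"
  proof (rule sum.cong[OF refl])
    fix i assume i: "i \<in> {1..m}"
    from a show "(b i (fst q))\<^sup>2 * gF i (snd q i) (push i q (B a q)) (push i q (B a' q)) =
      (case a of None \<Rightarrow> 0 | Some (j, k) \<Rightarrow> if i = j then (if a = a' then G a q else 0) else 0)"
    proof (cases rule: index_cases)
      case None
      from a' show ?thesis
        unfolding push_B[OF q a i] push_B[OF q a' i]
        by (cases rule: index_cases) (use None i z0 z eT in auto)
    next
      case (Some j k)
      note a_Some = Some
      from a' show ?thesis
      proof (cases rule: index_cases)
        case None
        then show ?thesis unfolding push_B[OF q a i] push_B[OF q a' i] using a_Some i z0 z eT by auto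
      next
        case (Some n l)
        then show ?thesis unfolding push_B[OF q a i] push_B[OF q a' i]
          using a_Some i z0 z eT e_orth[OF i W_snd[OF q i]] by (auto simp: G_def)
      qed
    qed
  qed
  from a show ?thesis
  proof (cases rule: index_cases)
    case None
    then show ?thesis unfolding warped_metric_def s B_fst'[OF q a] B_fst'[OF q a'] by (auto simp: G_def)
  next
    case (Some j k)
    then show ?thesis unfolding warped_metric_def s B_fst'[OF q a] B_fst'[OF q a'] by auto
  qed
qed

lemma b_nz: "q \<in> W \<Longrightarrow> i \<in> J \<Longrightarrow> b i (fst q) \<noteq> 0"
  using b_pos[of i "fst q"] W_fst[of q] by auto

lemma eps_nz: "i \<in> J \<Longrightarrow> k \<in> mindex (F i) \<Longrightarrow> \<epsilon> i k \<noteq> 0"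
  using eps by force

lemma G_nz: "q \<in> W \<Longrightarrow> a \<in> KM \<Longrightarrow> G a q \<noteq> 0"
  by (erule index_cases) (auto simp: G_def b_nz eps_nz)

lemma orthogonal_B: "q \<in> W \<Longrightarrow> warped_product.orthogonal_at KM q (\<lambda>a. B a q) (\<lambda>a. G a q)"
  unfolding warped_product.orthogonal_at_def by (simp add: B_tangent G_nz gM_B)

lemma orthogonal_e: "i \<in> J \<Longrightarrow> x \<in> V i \<Longrightarrow> charted_metric.orthogonal_at (F i) (gF i) (mindex (F i)) x (\<lambda>k. e i k x) (\<epsilon> i)"
  unfolding charted_metric.orthogonal_at_def[OF factor_metric] by (simp add: e_tangent eps_nz e_orth)

text \<open>\<open>\<epsilon> i r\<close> is its own inverse, so the quotients of the general
  expansion become products, whose smoothness is immediate.\<close>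

lemma e_expand:
  assumes i: "i \<in> J" and x: "x \<in> V i" and v: "v \<in> tangent_space (F i) x"
  shows "v f = (\<Sum>r\<in>mindex (F i). (\<epsilon> i r * gF i x v (e i r x)) * e i r x f)"
proof -
  interpret Fi: charted_metric "F i" "gF i" by (rule factor_metric[OF i])
  have "v f = (\<Sum>r\<in>mindex (F i). (gF i x v (e i r x) / \<epsilon> i r) * e i r x f)"
    by (rule fun_cong[OF Fi.orthogonal_expand[OF Fi.openin_topspace_subset[OF V_open[OF i] x] orthogonal_e[OF i x] v]])
  also have "\<dots> = (\<Sum>r\<in>mindex (F i). (\<epsilon> i r * gF i x v (e i r x)) * e i r x f)"
    by (intro sum.cong refl) (use eps[OF i] in fastforce)
  finally show ?thesis .
qed

text \<open>The structure functions of the factor frame: the coefficient of \<open>e i r\<close> in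
  the bracket of \<open>e i k\<close> and \<open>e i l\<close>.\<close>

definition cc :: "nat \<Rightarrow> 'k \<Rightarrow> 'k \<Rightarrow> 'k \<Rightarrow> 'a \<Rightarrow> real" where
  "cc i k l r x = \<epsilon> i r * gF i x (lie_bracket (F i) (e i k) (e i l) x) (e i r x)"

definition C :: "(nat \<times> 'k) option \<Rightarrow> (nat \<times> 'k) option \<Rightarrow> (nat \<times> 'k) option \<Rightarrow> real \<times> (nat \<Rightarrow> 'a) \<Rightarrow> real" where
  "C a a' c q = (case a of None \<Rightarrow> 0 | Some (i, k) \<Rightarrow> (case a' of None \<Rightarrow> 0 | Some (j, l) \<Rightarrow>
     (case c of None \<Rightarrow> 0 | Some (n, r) \<Rightarrow> if i = j \<and> i = n then cc i k l r (snd q i) else 0)))"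

lemma bracket_e:
  assumes i: "i \<in> J" and k: "k \<in> mindex (F i)" "l \<in> mindex (F i)" and x: "x \<in> V i"
  shows "lie_bracket (F i) (e i k) (e i l) x f = (\<Sum>r\<in>mindex (F i). cc i k l r x * e i r x f)"
proof -
  interpret Fi: charted_metric "F i" "gF i" by (rule factor_metric[OF i])
  show ?thesis
    unfolding cc_def
    by (rule e_expand[OF i x Fi.lie_bracket_tangent[OF V_open[OF i] e_vf[OF i k(1)] e_vf[OF i k(2)] x]])
qed

lemma cc_smooth:
  assumes i: "i \<in> J" and k: "k \<in> mindex (F i)" "l \<in> mindex (F i)" "r \<in> mindex (F i)"
  shows "smooth_fun (F i) (V i) (cc i k l r)"
proof -
  interpret Fi: charted_metric "F i" "gF i" by (rule factor_metric[OF i])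
  show ?thesis
    unfolding cc_def
    by (intro Fi.smooth_fun_mult Fi.smooth_fun_const Fi.g_smooth Fi.lie_bracket_closed V_open[OF i] e_vf[OF i] k)
qed

text \<open>Near \<open>q\<close> a frame field turns the pullback of \<open>h\<close> into 0 or
  into the pullback of \<open>e j l\<close> applied to \<open>h\<close>, so the second derivative is
  a first derivative of a pullback again. The set \<open>T\<close> is where \<open>h\<close> stays
  smooth, as the inner derivative is needed at all nearby points.\<close>

lemma B_B_pullback:
  assumes q: "q \<in> W" and a: "a \<in> KM" "a' \<in> KM" and j: "j \<in> J" and h: "smooth_at (F j) (snd q j) h"
  shows "B a q (\<lambda>p. B a' p (\<lambda>q. h (snd q j))) =
    (case a of None \<Rightarrow> 0 | Some (i, k) \<Rightarrow> (case a' of None \<Rightarrow> 0 | Some (n, l) \<Rightarrow>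
      if i = j \<and> n = j then e j k (snd q j) (\<lambda>x. e j l x h) else 0))"
proof -
  interpret Fj: charted_space "F j" by (rule factor_charted[OF j])
  obtain S where S: "openin (mtop (F j)) S" "snd q j \<in> S" "smooth_fun (F j) S h"
    using h unfolding smooth_at_def by blast
  define T where "T = W \<inter> preimage_factor j S"
  have T: "openin (mtop M) T" "q \<in> T"
    using W_open openin_preimage_factor[OF j S(1)] q S(2) W_top[OF q] by (auto simp: T_def preimage_factor_def)
  have sB: "smooth_at M q (\<lambda>p. B a' p (\<lambda>q. h (snd q j)))"
    by (rule product.vf_smooth_at[OF W_open B_closed[OF a(2)] q smooth_at_pullback[OF j W_top[OF q] h]])
  have Bp: "B a' p (\<lambda>q. h (snd q j)) = (case a' of None \<Rightarrow> 0 | Some (i, k) \<Rightarrow> if i = j then e i k (snd p i) h else 0)"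
    if "p \<in> T" for p
    by (rule B_pullback[OF _ a(2) j Fj.smooth_atI[OF S(1) _ S(3)]]) (use that in \<open>auto simp: T_def preimage_factor_def\<close>)
  show ?thesis
  proof (cases "\<exists>l. a' = Some (j, l)")
    case False
    have z: "B a' p (\<lambda>q. h (snd q j)) = 0" if "p \<in> T" for p
      using Bp[OF that] False by (auto split: option.splits)
    have "B a q (\<lambda>p. B a' p (\<lambda>q. h (snd q j))) = B a q (\<lambda>_. 0)"
      by (rule product.tangent_cong[OF B_tangent[OF a(1) q] sB product.smooth_at_const[OF W_top[OF q]] T z])
    then show ?thesis using B_const[OF q a(1)] False by (auto split: option.splits)
  next
    case True
    then obtain l where l: "a' = Some (j, l)" by blast
    then have lK: "l \<in> mindex (F j)" using a(2) by simp
    have se: "smooth_at (F j) (snd q j) (\<lambda>x. e j l x h)"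
      by (rule Fj.vf_smooth_at[OF V_open[OF j] e_vf[OF j lK] W_snd[OF q j] h])
    have z: "B a' p (\<lambda>q. h (snd q j)) = e j l (snd p j) h" if "p \<in> T" for p
      using Bp[OF that] l by simp
    have "B a q (\<lambda>p. B a' p (\<lambda>q. h (snd q j))) = B a q (\<lambda>p. e j l (snd p j) h)"
      by (rule product.tangent_cong[OF B_tangent[OF a(1) q] sB smooth_at_pullback[OF j W_top[OF q] se] T z])
    also have "\<dots> = (case a of None \<Rightarrow> 0 | Some (i, k) \<Rightarrow> if i = j then e i k (snd q i) (\<lambda>x. e j l x h) else 0)"
      by (rule B_pullback[OF q a(1) j se])
    finally show ?thesis using l by (auto split: option.splits)
  qed
qed

lemma finite_factor_index: "i \<in> J \<Longrightarrow> finite (mindex (F i))"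
  by (rule charted_space.finite_index[OF factor_charted])

lemma sum_KM: "(\<Sum>c\<in>KM. f c) = f None + (\<Sum>i=1..m. \<Sum>k\<in>mindex (F i). f (Some (i, k)) :: real)"
  by (rule sum_product_index[OF finite_factor_index])

lemma sum_pick: "j \<in> J \<Longrightarrow> (\<Sum>i=1..m. \<Sum>k\<in>mindex (F i). if i = j then f i k else 0) = (\<Sum>k\<in>mindex (F j). f j k :: real)"
proof -
  assume j: "j \<in> J"
  have "(\<Sum>i=1..m. \<Sum>k\<in>mindex (F i). if i = j then f i k else 0) = (\<Sum>i=1..m. if i = j then (\<Sum>k\<in>mindex (F i). f i k) else 0)"
    by (intro sum.cong) auto
  then show ?thesis using j by simp
qed

lemma bracket_B:
  assumes q: "q \<in> W" and a: "a \<in> KM" "a' \<in> KM"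
  shows "lie_bracket M (B a) (B a') q f = (\<Sum>c\<in>KM. C a a' c q * B c q f)"
proof -
  have "lie_bracket M (B a) (B a') q = (\<lambda>f. \<Sum>c\<in>KM. C a a' c q * B c q f)"
  proof (rule tangent_eqI[OF W_QU[OF q]])
    show "lie_bracket M (B a) (B a') q \<in> tangent_space M q"
      by (rule product.lie_bracket_tangent[OF W_open B_closed[OF a(1)] B_closed[OF a(2)] q])
    show "(\<lambda>f. \<Sum>c\<in>KM. C a a' c q * B c q f) \<in> tangent_space M q"
      by (intro product.tangent_space_sum B_tangent q)
    have sf: "smooth_at M q fst" by (rule product.smooth_atI[OF W_open q smooth_fst[OF W_open]])
    \<comment> \<open>dt is constant on each frame field, so second derivatives of
      \<open>fst\<close> vanish.\<close>
    have z: "B x q (\<lambda>p. B y p fst) = 0" if "x \<in> KM" "y \<in> KM" for x y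
    proof -
      have "B x q (\<lambda>p. B y p fst) = B x q (\<lambda>_. if y = None then 1 else 0)"
        by (rule product.tangent_cong[OF B_tangent[OF that(1) q] product.vf_smooth_at[OF W_open B_closed[OF that(2)] q sf]
              product.smooth_at_const[OF W_top[OF q]] W_open q]) (rule B_fst'[OF _ that(2)])
      then show ?thesis using B_const[OF q that(1)] by simp
    qed
    have "(\<Sum>c\<in>KM. C a a' c q * B c q fst) = 0"
      by (rule sum.neutral) (auto simp: B_fst'[OF q] C_def split: option.splits)
    then show "lie_bracket M (B a) (B a') q fst = (\<Sum>c\<in>KM. C a a' c q * B c q fst)"
      using z[OF a] z[OF a(2,1)] sf by (simp add: lie_bracket_def)
  next
    fix j h assume j: "j \<in> J" and h: "smooth_at (F j) (snd q j) h"
    have L: "lie_bracket M (B a) (B a') q (\<lambda>q. h (snd q j)) =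
      (case a of None \<Rightarrow> 0 | Some (i, k) \<Rightarrow> (case a' of None \<Rightarrow> 0 | Some (n, l) \<Rightarrow>
      if i = j \<and> n = j then lie_bracket (F j) (e j k) (e j l) (snd q j) h else 0))"
      using B_B_pullback[OF q a j h] B_B_pullback[OF q a(2,1) j h] smooth_at_pullback[OF j W_top[OF q] h] h
      by (auto simp: lie_bracket_def split: option.splits)
    have "(\<Sum>c\<in>KM. C a a' c q * B c q (\<lambda>q. h (snd q j))) =
        (\<Sum>i=1..m. \<Sum>k\<in>mindex (F i). C a a' (Some (i, k)) q * B (Some (i, k)) q (\<lambda>q. h (snd q j)))"
      unfolding sum_KM by (simp add: C_def split: option.split)
    also have "\<dots> = (\<Sum>i=1..m. \<Sum>k\<in>mindex (F i). if i = j then C a a' (Some (i, k)) q * e i k (snd q i) h else 0)"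
      by (intro sum.cong refl) (simp add: B_pullback[OF q _ j h])
    also have "\<dots> = (\<Sum>r\<in>mindex (F j). C a a' (Some (j, r)) q * e j r (snd q j) h)"
      by (rule sum_pick[OF j])
    also have "\<dots> = (case a of None \<Rightarrow> 0 | Some (i, k) \<Rightarrow> (case a' of None \<Rightarrow> 0 | Some (n, l) \<Rightarrow>
      if i = j \<and> n = j then lie_bracket (F j) (e j k) (e j l) (snd q j) h else 0))"
    proof (cases "\<exists>k l. a = Some (j, k) \<and> a' = Some (j, l)")
      case True
      then obtain k l where kl: "a = Some (j, k)" "a' = Some (j, l)" by blast
      then show ?thesis using bracket_e[OF j _ _ W_snd[OF q j], of k l h] a by (simp add: C_def)
    next
      case False
      then show ?thesis by (auto simp: C_def split: option.splits intro!: sum.neutral)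
    qed
    finally show "lie_bracket M (B a) (B a') q (\<lambda>q. h (snd q j)) = (\<Sum>c\<in>KM. C a a' c q * B c q (\<lambda>q. h (snd q j)))"
      using L by simp
  qed
  then show ?thesis by simp
qed

lemma C_smooth:
  assumes "a \<in> KM" "a' \<in> KM" "c \<in> KM"
  shows "smooth_fun M W (C a a' c)"
proof (cases "\<exists>i k l r. a = Some (i, k) \<and> a' = Some (i, l) \<and> c = Some (i, r)")
  case True
  then obtain i k l r where *: "a = Some (i, k)" "a' = Some (i, l)" "c = Some (i, r)" by blast
  have "smooth_fun M W (\<lambda>q. cc i k l r (snd q i))"
    by (rule smooth_pullback_W[OF _ cc_smooth]) (use assms * in auto)
  moreover have "C a a' c = (\<lambda>q. cc i k l r (snd q i))" by (simp add: * C_def fun_eq_iff)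
  ultimately show ?thesis by simp
next
  case False
  then have "C a a' c = (\<lambda>q. 0)" by (auto simp: C_def fun_eq_iff split: option.splits)
  then show ?thesis using product.smooth_fun_const[OF W_open, of 0] by simp
qed

end

context warped
begin

definition H :: "nat \<Rightarrow> real \<Rightarrow> real" where
  "H i t = deriv (b i) t / b i t"

text \<open>
  \<open>mixed_trace\<close> and \<open>mixed_trace'\<close> are the contributions to the scalar curvature of \<open>R(T, X)T\<close> (up to the sign
  \<open>g(T, T) = - 1\<close>) and \<open>R(X, T)X\<close> for one frame vector \<open>X\<close> of the factor; they differ since the connection is
  not metric.  The last sum in \<open>base_term\<close> is what \<open>R(X, Y)X\<close> adds to the curvature of the factors.
\<close>

definition mixed_trace :: "real \<Rightarrow> real \<Rightarrow> nat \<Rightarrow> real \<Rightarrow> real" where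
  "mixed_trace l1 l2 j t = deriv (\<lambda>t. H j t - l1) t + (H j t - l1) * H j t - (l2 - l1) * (H j t - l1)"

definition mixed_trace' :: "real \<Rightarrow> real \<Rightarrow> nat \<Rightarrow> real \<Rightarrow> real" where
  "mixed_trace' l1 l2 i t = - deriv (\<lambda>t. (H i t - l2) * (b i t)\<^sup>2) t / (b i t)\<^sup>2 + (H i t - (l2 - l1)) * (H i t - l2)"

definition base_term :: "real \<Rightarrow> real \<Rightarrow> real \<Rightarrow> real" where
  "base_term l1 l2 t =
     - (\<Sum>j=1..m. \<Sum>l\<in>mindex (F j). mixed_trace l1 l2 j t) + (\<Sum>i=1..m. \<Sum>k\<in>mindex (F i). mixed_trace' l1 l2 i t) +
     (\<Sum>i=1..m. \<Sum>k\<in>mindex (F i). \<Sum>j=1..m. \<Sum>l\<in>mindex (F j).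
       (if i = j \<and> k = l then (H i t - l2) * (H i t - l1) else 0) - (H i t - l2) * (H j t - l1))"

end

section \<open>Connection coefficients in the lifted frame\<close>

locale warped_connection = warped_frame I m F gF b U \<phi> V e \<epsilon>
  for I :: "real set" and m and F :: "nat \<Rightarrow> ('a, 'k) manifold" and gF b U \<phi> V e \<epsilon> +
  fixes D :: "(real \<times> (nat \<Rightarrow> 'a)) connection" and DF :: "nat \<Rightarrow> 'a connection"
  assumes LC_M: "levi_civita (product_manifold I m F) (warped_metric m F gF b) D"
    and LC_F: "i \<in> {1..m} \<Longrightarrow> levi_civita (F i) (gF i) (DF i)"
begin

definition gam :: "nat \<Rightarrow> 'k \<Rightarrow> 'k \<Rightarrow> 'k \<Rightarrow> 'a \<Rightarrow> real" where
  "gam i k l r x = \<epsilon> i r * gF i x (DF i (e i k) (e i l) x) (e i r x)"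

lemma factor_connection:
  assumes "i \<in> J" "openin (mtop (F i)) S"
  shows "connection_on (F i) S (DF i)"
  using LC_F[OF assms(1)] assms(2) unfolding levi_civita_def affine_connection_iff by blast

lemma DF_closed: "i \<in> J \<Longrightarrow> k \<in> mindex (F i) \<Longrightarrow> l \<in> mindex (F i) \<Longrightarrow> DF i (e i k) (e i l) \<in> vector_fields (F i) (V i)"
proof -
  assume i: "i \<in> J" and k: "k \<in> mindex (F i)" "l \<in> mindex (F i)"
  interpret Fi: charted_space "F i" by (rule factor_charted[OF i])
  interpret local_connection "F i" "V i" "DF i"
    by unfold_locales (intro V_open[OF i] factor_connection[OF i])+
  show ?thesis by (rule D_closed[OF e_vf[OF i k(1)] e_vf[OF i k(2)]])
qed

lemma DF_expand:
  assumes i: "i \<in> J" and k: "k \<in> mindex (F i)" "l \<in> mindex (F i)" and x: "x \<in> V i"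
  shows "DF i (e i k) (e i l) x f = (\<Sum>r\<in>mindex (F i). gam i k l r x * e i r x f)"
  unfolding gam_def by (rule e_expand[OF i x charted_space.vfD[OF factor_charted[OF i] DF_closed[OF i k] x]])

lemma gam_smooth:
  assumes i: "i \<in> J" and k: "k \<in> mindex (F i)" "l \<in> mindex (F i)" "r \<in> mindex (F i)"
  shows "smooth_fun (F i) (V i) (gam i k l r)"
proof -
  interpret Fi: charted_metric "F i" "gF i" by (rule factor_metric[OF i])
  show ?thesis
    unfolding gam_def
    by (intro Fi.smooth_fun_mult Fi.smooth_fun_const Fi.g_smooth DF_closed[OF i] V_open[OF i] e_vf[OF i] k)
qed

lemma eps_sq: "i \<in> J \<Longrightarrow> k \<in> mindex (F i) \<Longrightarrow> \<epsilon> i k * \<epsilon> i k = 1"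
  using eps[of i k] by auto

text \<open>The metric is constant on an orthonormal frame, so all derivatives drop out of Koszul's
  formula. What is left consists of structure functions, which the lifted frame shares.\<close>

lemma gam_koszul:
  assumes i: "i \<in> J" and k: "k \<in> mindex (F i)" "l \<in> mindex (F i)" "r \<in> mindex (F i)" and x: "x \<in> V i"
  shows "2 * (gam i k l r x * \<epsilon> i r) = cc i k l r x * \<epsilon> i r - cc i k r l x * \<epsilon> i l - cc i l r k x * \<epsilon> i k"
proof -
  interpret Fi: charted_metric "F i" "gF i" by (rule factor_metric[OF i])
  note ev = e_vf[OF i]
  have xt: "x \<in> topspace (mtop (F i))" by (rule Fi.openin_topspace_subset[OF V_open[OF i] x])
  have z: "e i j x (\<lambda>q. gF i q (e i j' q) (e i j'' q)) = 0"
    if "j \<in> mindex (F i)" "j' \<in> mindex (F i)" "j'' \<in> mindex (F i)" for j j' j''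
  proof -
    have "e i j x (\<lambda>q. gF i q (e i j' q) (e i j'' q)) = e i j x (\<lambda>_. if j' = j'' then \<epsilon> i j' else 0)"
      by (rule Fi.tangent_cong[OF e_tangent[OF i that(1) x]
            Fi.smooth_atI[OF V_open[OF i] x Fi.g_smooth[OF V_open[OF i] ev[OF that(2)] ev[OF that(3)]]]
            Fi.smooth_at_const[OF xt] V_open[OF i] x]) (rule e_orth[OF i _ that(2,3)])
    then show ?thesis using Fi.tangent_const[OF e_tangent[OF i that(1) x] xt] by simp
  qed
  have br: "gF i x (lie_bracket (F i) (e i j) (e i j') x) (e i j'' x) = cc i j j' j'' x * \<epsilon> i j''"
    if "j'' \<in> mindex (F i)" for j j' j''
    using eps_sq[OF i that] by (simp add: cc_def mult.commute mult.left_commute)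
  have "2 * gF i x (DF i (e i k) (e i l) x) (e i r x) =
      cc i k l r x * \<epsilon> i r - cc i k r l x * \<epsilon> i l - cc i l r k x * \<epsilon> i k"
    using Fi.koszul[OF LC_F[OF i] V_open[OF i] ev[OF k(1)] ev[OF k(2)] ev[OF k(3)] x]
    unfolding z[OF k] z[OF k(2,1,3)] z[OF k(3,1,2)] br[OF k(1)] br[OF k(2)] br[OF k(3)] by simp
  moreover have "gam i k l r x * \<epsilon> i r = gF i x (DF i (e i k) (e i l) x) (e i r x)"
    using eps_sq[OF i k(3)] by (simp add: gam_def mult.commute mult.left_commute)
  ultimately show ?thesis by simp
qed

text \<open>
  Connection coefficients in the frame \<open>B\<close>: those of the quarter-symmetric connection with parameters \<open>l1\<close>, \<open>l2\<close>,
  so that \<open>Gam 0 0\<close> belongs to the Levi-Civita connection.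
\<close>

definition Gam :: "real \<Rightarrow> real \<Rightarrow> (nat \<times> 'k) option \<Rightarrow> (nat \<times> 'k) option \<Rightarrow> (nat \<times> 'k) option \<Rightarrow>
    real \<times> (nat \<Rightarrow> 'a) \<Rightarrow> real" where
  "Gam l1 l2 a a' c q = (case a of
     None \<Rightarrow> (case a' of None \<Rightarrow> if c = None then l2 - l1 else 0
       | Some (j, l) \<Rightarrow> if c = a' then H j (fst q) else 0)
   | Some (i, k) \<Rightarrow> (case a' of None \<Rightarrow> if c = a then H i (fst q) - l1 else 0
       | Some (j, l) \<Rightarrow> (case c of None \<Rightarrow> if a = a' then (H i (fst q) - l2) * G a q else 0
         | Some (n, r) \<Rightarrow> if i = j \<and> i = n then gam i k l r (snd q i) else 0)))"

lemma b_deriv: "i \<in> J \<Longrightarrow> t \<in> I \<Longrightarrow> (b i has_real_derivative deriv (b i) t) (at t)"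
proof -
  assume "i \<in> J" "t \<in> I"
  then have "(deriv ^^ 0) (b i) differentiable (at t)"
    using b_smooth unfolding smooth_on_interval_def by blast
  then show ?thesis by (simp add: DERIV_deriv_iff_real_differentiable)
qed

lemma smooth_H:
  assumes "i \<in> J" "openin (mtop M) S"
  shows "smooth_fun M S (\<lambda>q. H i (fst q))"
proof -
  have "smooth_fun M S (\<lambda>q. deriv (b i) (fst q) * (1 / b i (fst q)))"
    by (intro product.smooth_fun_mult product.smooth_fun_inverse smooth_b assms)
       (use b_pos[OF assms(1) fst_I[OF assms(2)]] in force)
  then show ?thesis by (simp add: H_def)
qed

text \<open>The squares \<open>G a\<close> depend on t alone, so only \<open>B None\<close>
  differentiates them; (b^2)' = 2 b b' = 2 H b^2.\<close>

lemma B_metric_deriv: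
  assumes q: "q \<in> W" and a: "a \<in> KM" "a' \<in> KM" "c \<in> KM"
  shows "B a q (\<lambda>p. gM p (B a' p) (B c p)) =
    (if a' = c \<and> a = None then (case a' of None \<Rightarrow> 0 | Some (i, k) \<Rightarrow> 2 * H i (fst q) * G a' q) else 0)"
proof -
  have sg: "smooth_at M q (\<lambda>p. gM p (B a' p) (B c p))"
    by (rule product.smooth_atI[OF W_open q warped_product.g_smooth[OF W_open B_closed[OF a(2)] B_closed[OF a(3)]]])
  show ?thesis
  proof (cases "\<exists>i k. a' = c \<and> c = Some (i, k)")
    case False
    have "B a q (\<lambda>p. gM p (B a' p) (B c p)) = B a q (\<lambda>_. if a' = c then - 1 else 0)"
      by (rule product.tangent_cong[OF B_tangent[OF a(1) q] sg product.smooth_at_const[OF W_top[OF q]] W_open q])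
         (use gM_B[OF _ a(2,3)] False in \<open>auto simp: G_def split: option.splits\<close>)
    then show ?thesis using B_const[OF q a(1)] False by (auto split: option.splits)
  next
    case True
    then obtain i k where c: "a' = c" "c = Some (i, k)" by blast
    then have i: "i \<in> J" using a(3) by simp
    let ?u = "\<lambda>t. (b i t)\<^sup>2 * \<epsilon> i k"
    have su: "smooth_at M q (\<lambda>p. ?u (fst p))"
      unfolding power2_eq_square
      by (rule product.smooth_atI[OF W_open q]) (intro product.smooth_fun_mult product.smooth_fun_const smooth_b W_open i)
    have "B a q (\<lambda>p. gM p (B a' p) (B c p)) = B a q (\<lambda>p. ?u (fst p))"
      by (rule product.tangent_cong[OF B_tangent[OF a(1) q] sg su W_open q])
         (use gM_B[OF _ a(2,3)] c in \<open>simp add: G_def\<close>)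
    also have "\<dots> = (if a = None then deriv ?u (fst q) else 0)" by (rule B_fst[OF q a(1) su])
    also have "deriv ?u (fst q) = 2 * H i (fst q) * ?u (fst q)"
    proof (rule DERIV_imp_deriv)
      have "(?u has_real_derivative 2 * b i (fst q) * deriv (b i) (fst q) * \<epsilon> i k) (at (fst q))"
        by (rule derivative_eq_intros b_deriv[OF i W_fst[OF q]] refl | simp)+
      moreover have "2 * b i (fst q) * deriv (b i) (fst q) * \<epsilon> i k = 2 * H i (fst q) * ?u (fst q)"
        using b_nz[OF q i] by (simp add: H_def power2_eq_square)
      ultimately show "(?u has_real_derivative 2 * H i (fst q) * ?u (fst q)) (at (fst q))" by simp
    qed
    finally show ?thesis using c by (simp add: G_def)
  qed
qed

lemma M_connection: "openin (mtop M) S \<Longrightarrow> connection_on M S D"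
  using LC_M unfolding levi_civita_def affine_connection_iff by blast

lemma bracket_metric:
  assumes q: "q \<in> W" and a: "a \<in> KM" "a' \<in> KM" "c \<in> KM"
  shows "gM q (lie_bracket M (B a) (B a') q) (B c q) = C a a' c q * G c q"
proof -
  have "lie_bracket M (B a) (B a') q = (\<lambda>f. \<Sum>c\<in>KM. C a a' c q * B c q f)"
    by (rule ext) (rule bracket_B[OF q a(1,2)])
  then have "gM q (lie_bracket M (B a) (B a') q) (B c q) = (\<Sum>d\<in>KM. C a a' d q * gM q (B d q) (B c q))"
    using warped_product.g_sum[OF W_top[OF q] B_tangent[OF a(3) q], of KM "\<lambda>d. B d q" "\<lambda>d. C a a' d q"] B_tangent[OF _ q]
    by simp
  also have "\<dots> = (\<Sum>d\<in>KM. if d = c then C a a' d q * G d q else 0)"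
    by (intro sum.cong refl) (simp add: gM_B[OF q _ a(3)])
  also have "\<dots> = C a a' c q * G c q" using a(3) finite_product_index by simp
  finally show ?thesis .
qed

text \<open>Two cases exhaust Koszul's formula. For three indices of one factor it is b^2 times the
  formula of the factor, as the squares are constant along it. Otherwise all structure functions
  vanish, and only t-derivatives of the squares remain.\<close>

lemma D_metric:
  assumes q: "q \<in> W" and a: "a \<in> KM" "a' \<in> KM" "c \<in> KM"
  shows "gM q (D (B a) (B a') q) (B c q) = Gam 0 0 a a' c q * G c q"
proof -
  have K: "2 * gM q (D (B a) (B a') q) (B c q) =
      (if a' = c \<and> a = None then (case a' of None \<Rightarrow> 0 | Some (i, k) \<Rightarrow> 2 * H i (fst q) * G a' q) else 0) +
      (if a = c \<and> a' = None then (case a of None \<Rightarrow> 0 | Some (i, k) \<Rightarrow> 2 * H i (fst q) * G a q) else 0) -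
      (if a = a' \<and> c = None then (case a of None \<Rightarrow> 0 | Some (i, k) \<Rightarrow> 2 * H i (fst q) * G a q) else 0) +
      C a a' c q * G c q - C a c a' q * G a' q - C a' c a q * G a q"
    unfolding warped_product.koszul[OF LC_M W_open B_closed[OF a(1)] B_closed[OF a(2)] B_closed[OF a(3)] q]
      B_metric_deriv[OF q a] B_metric_deriv[OF q a(2,1,3)] B_metric_deriv[OF q a(3,1,2)]
      bracket_metric[OF q a] bracket_metric[OF q a(1,3,2)] bracket_metric[OF q a(2,3,1)] ..
  show ?thesis
  proof (cases "\<exists>i k l r. a = Some (i, k) \<and> a' = Some (i, l) \<and> c = Some (i, r)")
    case True
    then obtain i k l r where *: "a = Some (i, k)" "a' = Some (i, l)" "c = Some (i, r)" by blast
    then have i: "i \<in> J" and k: "k \<in> mindex (F i)" "l \<in> mindex (F i)" "r \<in> mindex (F i)" using a by auto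
    have "2 * gM q (D (B a) (B a') q) (B c q) = (b i (fst q))\<^sup>2 *
        (cc i k l r (snd q i) * \<epsilon> i r - cc i k r l (snd q i) * \<epsilon> i l - cc i l r k (snd q i) * \<epsilon> i k)"
      unfolding K by (simp add: * C_def G_def algebra_simps)
    also have "\<dots> = (b i (fst q))\<^sup>2 * (2 * (gam i k l r (snd q i) * \<epsilon> i r))"
      by (simp only: gam_koszul[OF i k W_snd[OF q i]])
    finally show ?thesis by (simp add: * Gam_def G_def)
  next
    case False
    have C0: "C a a' c q = 0" "C a c a' q = 0" "C a' c a q = 0"
      using False by (auto simp: C_def split: option.splits)
    have "2 * gM q (D (B a) (B a') q) (B c q) = 2 * (Gam 0 0 a a' c q * G c q)"
      unfolding K C0 using False
      by (cases a; cases a'; cases c) (auto simp: Gam_def G_def)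
    then show ?thesis by simp
  qed
qed

lemma D_frame:
  assumes q: "q \<in> W" and a: "a \<in> KM" "a' \<in> KM"
  shows "D (B a) (B a') q f = (\<Sum>c\<in>KM. Gam 0 0 a a' c q * B c q f)"
proof -
  interpret local_connection M W D
    by unfold_locales (intro W_open M_connection)+
  have T: "D (B a) (B a') q \<in> tangent_space M q"
    by (rule product.vfD[OF D_closed[OF B_closed[OF a(1)] B_closed[OF a(2)]] q])
  have "D (B a) (B a') q f = (\<Sum>c\<in>KM. (gM q (D (B a) (B a') q) (B c q) / G c q) * B c q f)"
    using fun_cong[OF warped_product.orthogonal_expand[OF W_top[OF q] orthogonal_B[OF q, folded mindex_product[of I]] T], of f]
    by (simp add: mindex_product)
  also have "\<dots> = (\<Sum>c\<in>KM. Gam 0 0 a a' c q * B c q f)"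
    by (intro sum.cong refl) (simp add: D_metric[OF q a] G_nz[OF q])
  finally show ?thesis .
qed

abbreviation "Dq l1 l2 \<equiv> quarter_symmetric gM D (d_dt I m F) l1 l2"

lemma B_None: "B None = d_dt I m F"
  by (simp add: B_def)

text \<open>The signs come from g(T, T) = -1: it gives \<pi>(T) = -1, hence the \<open>- l1\<close>
  in the derivatives of T, and along T itself the term \<open>- l2 * G a q\<close> turns into
  \<open>+ l2\<close>.\<close>

lemma Gam_quarter:
  assumes "q \<in> W" "a \<in> KM" "a' \<in> KM" "c \<in> KM"
  shows "Gam l1 l2 a a' c q = Gam 0 0 a a' c q +
    (if c = a then l1 * (if a' = None then - 1 else 0) else 0) - (if c = None then l2 * (if a = a' then G a q else 0) else 0)"
  by (cases a; cases a'; cases c) (auto simp: Gam_def G_def algebra_simps)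

lemma Dq_frame:
  assumes q: "q \<in> W" and a: "a \<in> KM" "a' \<in> KM"
  shows "Dq l1 l2 (B a) (B a') q f = (\<Sum>c\<in>KM. Gam l1 l2 a a' c q * B c q f)"
proof -
  have "Dq l1 l2 (B a) (B a') q f = (\<Sum>c\<in>KM. Gam 0 0 a a' c q * B c q f) +
      l1 * gM q (B a' q) (B None q) * B a q f - l2 * gM q (B a q) (B a' q) * B None q f"
    unfolding quarter_symmetric_def by (simp add: D_frame[OF q a] B_None)
  also have "gM q (B a' q) (B None q) = (if a' = None then - 1 else 0)"
    using gM_B[OF q a(2), of None] by (simp add: G_def)
  also have "gM q (B a q) (B a' q) = (if a = a' then G a q else 0)" by (rule gM_B[OF q a])
  \<comment> \<open>The added multiples of \<open>B a\<close> and \<open>B None\<close> are written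
    as sums over the frame, so that coefficients can be compared index by index.\<close>
  also have "(\<Sum>c\<in>KM. Gam 0 0 a a' c q * B c q f) + l1 * (if a' = None then - 1 else 0) * B a q f -
      l2 * (if a = a' then G a q else 0) * B None q f = (\<Sum>c\<in>KM. Gam 0 0 a a' c q * B c q f) +
      (\<Sum>c\<in>KM. if c = a then l1 * (if a' = None then - 1 else 0) * B c q f else 0) -
      (\<Sum>c\<in>KM. if c = None then l2 * (if a = a' then G a q else 0) * B c q f else 0)"
    using a(1) finite_product_index by simp
  also have "\<dots> = (\<Sum>c\<in>KM. Gam l1 l2 a a' c q * B c q f)"
    unfolding sum.distrib[symmetric] sum_subtractf[symmetric]
    by (intro sum.cong refl) (simp add: Gam_quarter[OF q a, of _ l1 l2] algebra_simps)
  finally show ?thesis .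
qed

lemma smooth_G:
  assumes "a \<in> KM"
  shows "smooth_fun M W (G a)"
  using assms
proof (cases rule: index_cases)
  case None
  then have "G a = (\<lambda>_. - 1)" by (simp add: G_def fun_eq_iff)
  then show ?thesis using product.smooth_fun_const[OF W_open, of "- 1"] by simp
next
  case (Some i k)
  then have "G a = (\<lambda>q. b i (fst q) * b i (fst q) * \<epsilon> i k)" by (simp add: G_def fun_eq_iff power2_eq_square)
  moreover have "smooth_fun M W (\<lambda>q. b i (fst q) * b i (fst q) * \<epsilon> i k)"
    by (intro product.smooth_fun_mult product.smooth_fun_const smooth_b W_open Some)
  ultimately show ?thesis by simp
qed

lemma Gam_smooth:
  assumes a: "a \<in> KM" "a' \<in> KM" "c \<in> KM"
  shows "smooth_fun M W (Gam l1 l2 a a' c)"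
proof -
  note const = product.smooth_fun_const[OF W_open]
  from a(1) show ?thesis
  proof (cases rule: index_cases)
    case None
    note a_None = this
    from a(2) show ?thesis
    proof (cases rule: index_cases)
      case None
      then have "Gam l1 l2 a a' c = (\<lambda>q. if c = None then l2 - l1 else 0)" using a_None by (simp add: Gam_def fun_eq_iff)
      then show ?thesis using const by simp
    next
      case (Some j l)
      then have "Gam l1 l2 a a' c = (if c = a' then (\<lambda>q. H j (fst q)) else (\<lambda>q. 0))"
        using a_None by (auto simp: Gam_def fun_eq_iff)
      then show ?thesis using const[of 0] smooth_H[OF Some(2) W_open] by simp
    qed
  next
    case (Some i k)
    note a_Some = this
    have sH: "smooth_fun M W (\<lambda>q. H i (fst q) - z)" for z
      by (intro product.smooth_fun_diff smooth_H const W_open Some)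
    from a(2) show ?thesis
    proof (cases rule: index_cases)
      case None
      then have "Gam l1 l2 a a' c = (if c = a then (\<lambda>q. H i (fst q) - l1) else (\<lambda>q. 0))"
        using a_Some by (auto simp: Gam_def fun_eq_iff)
      then show ?thesis using const[of 0] sH by simp
    next
      case (Some j l)
      note a'_Some = this
      from a(3) show ?thesis
      proof (cases rule: index_cases)
        case None
        then have "Gam l1 l2 a a' c = (if a = a' then (\<lambda>q. (H i (fst q) - l2) * G a q) else (\<lambda>q. 0))"
          using a_Some a'_Some by (auto simp: Gam_def fun_eq_iff)
        then show ?thesis using const[of 0] product.smooth_fun_mult[OF W_open sH smooth_G[OF a(1)]]
          by (cases "a = a'") simp_all
      next
        case (Some n r)
        show ?thesis
        proof (cases "i = j \<and> i = n")
          case True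
          then have "Gam l1 l2 a a' c = (\<lambda>q. gam i k l r (snd q i))"
            using a_Some a'_Some Some by (auto simp: Gam_def fun_eq_iff)
          moreover have "smooth_fun M W (\<lambda>q. gam i k l r (snd q i))"
            by (rule smooth_pullback_W[OF a_Some(2) gam_smooth[OF a_Some(2,3)]]) (use True a'_Some Some in auto)
          ultimately show ?thesis by simp
        next
          case False
          then have "Gam l1 l2 a a' c = (\<lambda>q. 0)"
            using a_Some a'_Some Some by (auto simp: Gam_def fun_eq_iff)
          then show ?thesis using const by simp
        qed
      qed
    qed
  qed
qed

end

section \<open>Curvature components in the lifted frame and their trace\<close>

context warped_connection
begin

abbreviation "R l1 l2 \<equiv> curvature_coeff KM B (Gam l1 l2) C"

lemma B_smooth_fst:
  assumes "q \<in> W" "a \<in> KM" "smooth_fun M W (\<lambda>q. u (fst q))"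
  shows "B a q (\<lambda>q. u (fst q)) = (if a = None then deriv u (fst q) else 0)"
  by (rule B_fst[OF assms(1,2) product.smooth_atI[OF W_open assms(1,3)]])

lemma R_None_None: "q \<in> W \<Longrightarrow> R l1 l2 None None None None q = 0"
  using B_const[of q None "l2 - l1"] by (simp add: curvature_coeff_def Gam_def C_def)

lemma R_None_Some:
  assumes q: "q \<in> W" and j: "j \<in> J" "l \<in> mindex (F j)"
  shows "R l1 l2 None (Some (j, l)) None (Some (j, l)) q = mixed_trace l1 l2 j (fst q)"
proof -
  let ?b = "Some (j, l)"
  have b: "?b \<in> KM" using j by simp
  have s: "smooth_fun M W (\<lambda>q. H j (fst q) - l1)"
    by (intro product.smooth_fun_diff smooth_H product.smooth_fun_const W_open j)
  have 1: "B None q (Gam l1 l2 ?b None ?b) = deriv (\<lambda>t. H j t - l1) (fst q)"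
  proof -
    have "Gam l1 l2 ?b None ?b = (\<lambda>q. H j (fst q) - l1)" by (simp add: Gam_def fun_eq_iff)
    then show ?thesis using B_smooth_fst[OF q _ s, of None] by simp
  qed
  have 2: "B ?b q (Gam l1 l2 None None ?b) = 0"
  proof -
    have "Gam l1 l2 None None ?b = (\<lambda>q. 0)" by (simp add: Gam_def fun_eq_iff)
    then show ?thesis using B_const[OF q b, of 0] by simp
  qed
  \<comment> \<open>Of the intermediate index only \<open>e = ?b\<close> survives in the first
    product and only \<open>e = None\<close> in the second.\<close>
  have "(\<Sum>e\<in>KM. Gam l1 l2 ?b None e q * Gam l1 l2 None e ?b q - Gam l1 l2 None None e q * Gam l1 l2 ?b e ?b q) =
    (\<Sum>e\<in>KM. (if e = ?b then (H j (fst q) - l1) * H j (fst q) else 0) -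
      (if e = None then (l2 - l1) * (H j (fst q) - l1) else 0))"
    by (intro sum.cong refl) (auto simp: Gam_def split: option.split)
  also have "\<dots> = (H j (fst q) - l1) * H j (fst q) - (l2 - l1) * (H j (fst q) - l1)"
    unfolding sum_subtractf using b finite_product_index by simp
  finally show ?thesis
    unfolding curvature_coeff_def 1 2 mixed_trace_def by (simp add: C_def)
qed

lemma R_Some_None:
  assumes q: "q \<in> W" and i: "i \<in> J" "k \<in> mindex (F i)"
  shows "R l1 l2 (Some (i, k)) None (Some (i, k)) None q / G (Some (i, k)) q = mixed_trace' l1 l2 i (fst q)"
proof -
  let ?a = "Some (i, k)"
  let ?w = "\<lambda>t. (H i t - l2) * (b i t)\<^sup>2"
  have a: "?a \<in> KM" using i by simp
  have s: "smooth_fun M W (\<lambda>q. ?w (fst q))"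
    unfolding power2_eq_square
    by (intro product.smooth_fun_mult product.smooth_fun_diff smooth_H product.smooth_fun_const smooth_b W_open i)
  have 1: "B ?a q (Gam l1 l2 None ?a None) = 0"
  proof -
    have "Gam l1 l2 None ?a None = (\<lambda>q. 0)" by (simp add: Gam_def fun_eq_iff)
    then show ?thesis using B_const[OF q a, of 0] by simp
  qed
  \<comment> \<open>The coefficient \<open>(H i t - l2) * G ?a\<close> is not constant in t because
    \<open>G ?a\<close> contains b^2. Differentiating it as the constant
    \<open>\<epsilon> i k\<close> times \<open>?w\<close> produces the first term of
    \<open>mixed_trace'\<close>, where \<open>\<epsilon> i k\<close> cancels against
    \<open>G ?a\<close>.\<close>
  have "Gam l1 l2 ?a ?a None = (\<lambda>q. \<epsilon> i k * ?w (fst q))" by (simp add: Gam_def G_def fun_eq_iff)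
  then have 2: "B None q (Gam l1 l2 ?a ?a None) = \<epsilon> i k * deriv ?w (fst q)"
    using product.tangent_cmult[OF B_tangent[OF _ q] product.smooth_atI[OF W_open q s], of None "\<epsilon> i k"]
      B_smooth_fst[OF q _ s, of None] by simp
  have "(\<Sum>e\<in>KM. Gam l1 l2 None ?a e q * Gam l1 l2 ?a e None q - Gam l1 l2 ?a ?a e q * Gam l1 l2 None e None q) =
    (\<Sum>e\<in>KM. (if e = ?a then H i (fst q) * ((H i (fst q) - l2) * G ?a q) else 0) -
      (if e = None then (H i (fst q) - l2) * G ?a q * (l2 - l1) else 0))"
    by (intro sum.cong refl) (auto simp: Gam_def split: option.split)
  also have "\<dots> = H i (fst q) * ((H i (fst q) - l2) * G ?a q) - (H i (fst q) - l2) * G ?a q * (l2 - l1)"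
    unfolding sum_subtractf using a finite_product_index by simp
  finally have "R l1 l2 ?a None ?a None q =
      - (\<epsilon> i k * deriv ?w (fst q)) + (H i (fst q) - (l2 - l1)) * (H i (fst q) - l2) * G ?a q"
    unfolding curvature_coeff_def 1 2 by (simp add: C_def algebra_simps)
  then have "R l1 l2 ?a None ?a None q / G ?a q =
      - (\<epsilon> i k * deriv ?w (fst q)) / G ?a q + (H i (fst q) - (l2 - l1)) * (H i (fst q) - l2)"
    using G_nz[OF q a] by (simp add: diff_divide_distrib)
  also have "- (\<epsilon> i k * deriv ?w (fst q)) / G ?a q = - deriv ?w (fst q) / (b i (fst q))\<^sup>2"
    using eps_nz[OF i] b_nz[OF q i(1)] by (simp add: G_def)
  finally show ?thesis unfolding mixed_trace'_def .
qed

abbreviation "RF i \<equiv> curvature_coeff (mindex (F i)) (e i) (gam i) (cc i)"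

text \<open>Besides the quadratic terms of a single factor the sum over the intermediate index has
  only the passage through \<open>d_dt\<close>, that is \<open>e = None\<close>. It couples all
  pairs of factors through -(H_i - l2)(H_j - l1) and is compensated exactly when the two frame
  vectors coincide. Dividing by \<open>G\<close> gives the factor's component its weight
  1/b^2.\<close>

lemma R_Some_Some:
  assumes q: "q \<in> W" and i: "i \<in> J" "k \<in> mindex (F i)" and j: "j \<in> J" "l \<in> mindex (F j)"
  shows "R l1 l2 (Some (i, k)) (Some (j, l)) (Some (i, k)) (Some (j, l)) q / G (Some (i, k)) q =
    (if i = j then RF i k l k l (snd q i) / \<epsilon> i k / (b i (fst q))\<^sup>2 else 0) +
    ((if i = j \<and> k = l then (H i (fst q) - l2) * (H i (fst q) - l1) else 0) - (H i (fst q) - l2) * (H j (fst q) - l1))"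
proof -
  let ?a = "Some (i, k)" and ?b = "Some (j, l)" and ?x = "snd q i"
  let ?Ki = "mindex (F i)"
  have a: "?a \<in> KM" and b: "?b \<in> KM" using i j by auto
  have sm: "smooth_at (F i) ?x (gam i k' l' r')" if "k' \<in> ?Ki" "l' \<in> ?Ki" "r' \<in> ?Ki" for k' l' r'
    by (rule charted_space.smooth_atI[OF factor_charted[OF i(1)] V_open[OF i(1)] W_snd[OF q i(1)] gam_smooth[OF i(1) that]])
  have 1: "B ?a q (Gam l1 l2 ?b ?a ?b) = (if i = j then e i k ?x (gam i l k l) else 0)"
  proof (cases "i = j")
    case True
    then have "Gam l1 l2 ?b ?a ?b = (\<lambda>q. gam i l k l (snd q i))" by (simp add: Gam_def fun_eq_iff)
    then show ?thesis using B_pullback[OF q a i(1) sm[of l k l]] True i j by simp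
  next
    case False
    then have "Gam l1 l2 ?b ?a ?b = (\<lambda>q. 0)" by (auto simp: Gam_def fun_eq_iff)
    then show ?thesis using B_const[OF q a, of 0] False by simp
  qed
  have 2: "B ?b q (Gam l1 l2 ?a ?a ?b) = (if i = j then e i l ?x (gam i k k l) else 0)"
  proof (cases "i = j")
    case True
    then have "Gam l1 l2 ?a ?a ?b = (\<lambda>q. gam i k k l (snd q i))" by (simp add: Gam_def fun_eq_iff)
    then show ?thesis using B_pullback[OF q b i(1) sm[of k k l]] True i j by simp
  next
    case False
    then have "Gam l1 l2 ?a ?a ?b = (\<lambda>q. 0)" by (auto simp: Gam_def fun_eq_iff)
    then show ?thesis using B_const[OF q b, of 0] False by simp
  qed
  have 3: "(\<Sum>e\<in>KM. Gam l1 l2 ?b ?a e q * Gam l1 l2 ?a e ?b q - Gam l1 l2 ?a ?a e q * Gam l1 l2 ?b e ?b q) =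
      ((if i = j \<and> k = l then (H i (fst q) - l2) * (H i (fst q) - l1) else 0) - (H i (fst q) - l2) * (H j (fst q) - l1)) * G ?a q +
      (if i = j then (\<Sum>r\<in>?Ki. gam i l k r ?x * gam i k r l ?x - gam i k k r ?x * gam i l r l ?x) else 0)"
  proof -
    have "(\<Sum>n=1..m. \<Sum>r\<in>mindex (F n). Gam l1 l2 ?b ?a (Some (n, r)) q * Gam l1 l2 ?a (Some (n, r)) ?b q -
          Gam l1 l2 ?a ?a (Some (n, r)) q * Gam l1 l2 ?b (Some (n, r)) ?b q) =
        (\<Sum>n=1..m. \<Sum>r\<in>mindex (F n). if n = i then (if i = j then gam i l k r ?x * gam i k r l ?x - gam i k k r ?x * gam i l r l ?x else 0) else 0)"
      by (intro sum.cong refl) (auto simp: Gam_def)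
    also have "\<dots> = (\<Sum>r\<in>?Ki. if i = j then gam i l k r ?x * gam i k r l ?x - gam i k k r ?x * gam i l r l ?x else 0)"
      by (rule sum_pick[OF i(1)])
    also have "\<dots> = (if i = j then (\<Sum>r\<in>?Ki. gam i l k r ?x * gam i k r l ?x - gam i k k r ?x * gam i l r l ?x) else 0)"
      by simp
    finally show ?thesis
      unfolding sum_KM by (auto simp: Gam_def G_def algebra_simps)
  qed
  have 4: "(\<Sum>e\<in>KM. C ?a ?b e q * Gam l1 l2 e ?a ?b q) =
      (if i = j then (\<Sum>r\<in>?Ki. cc i k l r ?x * gam i r k l ?x) else 0)"
  proof -
    have "(\<Sum>n=1..m. \<Sum>r\<in>mindex (F n). C ?a ?b (Some (n, r)) q * Gam l1 l2 (Some (n, r)) ?a ?b q) =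
        (\<Sum>n=1..m. \<Sum>r\<in>mindex (F n). if n = i then (if i = j then cc i k l r ?x * gam i r k l ?x else 0) else 0)"
      by (intro sum.cong refl) (auto simp: Gam_def C_def)
    also have "\<dots> = (\<Sum>r\<in>?Ki. if i = j then cc i k l r ?x * gam i r k l ?x else 0)"
      by (rule sum_pick[OF i(1)])
    also have "\<dots> = (if i = j then (\<Sum>r\<in>?Ki. cc i k l r ?x * gam i r k l ?x) else 0)" by simp
    finally show ?thesis unfolding sum_KM by (simp add: C_def)
  qed
  have "R l1 l2 ?a ?b ?a ?b q = (if i = j then RF i k l k l ?x else 0) +
    ((if i = j \<and> k = l then (H i (fst q) - l2) * (H i (fst q) - l1) else 0) - (H i (fst q) - l2) * (H j (fst q) - l1)) * G ?a q"
    unfolding curvature_coeff_def[of KM] 1 2 3 4 by (cases "i = j") (simp_all add: curvature_coeff_def)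
  then have "R l1 l2 ?a ?b ?a ?b q / G ?a q = (if i = j then RF i k l k l ?x / G ?a q else 0) +
    ((if i = j \<and> k = l then (H i (fst q) - l2) * (H i (fst q) - l1) else 0) - (H i (fst q) - l2) * (H j (fst q) - l1))"
    using G_nz[OF q a] by (simp add: add_divide_distrib)
  then show ?thesis by (simp add: G_def mult.commute)
qed

text \<open>Without an orthonormal frame on the product the choice in \<open>frame_around\<close>
  would be arbitrary. Dividing each lift by \<open>b i\<close> provides one; its brackets are never
  computed.\<close>

lemma ex_frame_B:
  assumes q: "q \<in> W"
  shows "\<exists>U E. openin (mtop M) U \<and> q \<in> U \<and> orthonormal_frame M gM U E"
proof -
  define s where "s a p = (case a of None \<Rightarrow> 1 | Some (i, k :: 'k) \<Rightarrow> 1 / b i (fst p))" for a and p :: "real \<times> (nat \<Rightarrow> 'a)"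
  define E where "E a = vf_scale (s a) (B a)" for a
  define \<delta> where "\<delta> a = (case a of None \<Rightarrow> - 1 | Some (i, k) \<Rightarrow> \<epsilon> i k)" for a
  have ss: "smooth_fun M W (s a)" if "a \<in> KM" for a
    using that
  proof (cases rule: index_cases)
    case None
    then show ?thesis using product.smooth_fun_const[OF W_open, of 1] by (simp add: s_def[abs_def])
  next
    case (Some i k)
    then have "smooth_fun M W (\<lambda>p. 1 / b i (fst p))"
      by (intro product.smooth_fun_inverse smooth_b W_open b_nz)
    then show ?thesis using Some by (simp add: s_def[abs_def])
  qed
  have "orthonormal_frame M gM W E"
    unfolding orthonormal_frame_def mindex_product
  proof (intro conjI exI[of _ \<delta>] ballI)
    show "E a \<in> vector_fields M W" if "a \<in> KM" for a
      unfolding E_def by (intro product.vf_scale_closed W_open B_closed ss that)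
    show "\<delta> a = 1 \<or> \<delta> a = - 1" if "a \<in> KM" for a
      using that by (cases rule: index_cases) (use eps in \<open>auto simp: \<delta>_def\<close>)
    show "gM p (E a p) (E a' p) = (if a = a' then \<delta> a else 0)" if p: "p \<in> W" and a: "a \<in> KM" "a' \<in> KM" for p a a'
    proof -
      have Ea: "E a p = (\<lambda>f. s a p * B a p f)" for a by (simp add: E_def vf_scale_def)
      have "gM p (E a p) (E a' p) = s a p * gM p (B a p) (E a' p)"
        unfolding Ea[of a] by (rule warped_product.g_scale[OF W_top[OF p] B_tangent[OF a(1) p]])
          (simp add: Ea product.tangent_space_scale[OF B_tangent[OF a(2) p]])
      also have "gM p (B a p) (E a' p) = s a' p * gM p (B a p) (B a' p)"
        unfolding Ea[of a'] by (rule warped_product.g_scale_right[OF W_top[OF p] B_tangent[OF a(2) p] B_tangent[OF a(1) p]])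
      also have "gM p (B a p) (B a' p) = (if a = a' then G a p else 0)" by (rule gM_B[OF p a])
      also have "s a p * (s a' p * (if a = a' then G a p else 0)) = (if a = a' then \<delta> a else 0)"
        using a(1) by (cases rule: index_cases) (use b_nz[OF p] in \<open>auto simp: s_def G_def \<delta>_def power2_eq_square\<close>)
      finally show ?thesis .
    qed
  qed
  then show ?thesis using W_open q by blast
qed

lemma Dq_connection: "openin (mtop M) S \<Longrightarrow> S \<subseteq> W \<Longrightarrow> connection_on M S (Dq l1 l2)"
  using warped_product.quarter_symmetric_connection[OF _ M_connection product.vf_subset[OF B_closed[of None]]]
  by (simp add: B_None)

lemma scalar_curvature_factor:
  assumes i: "i \<in> J" and x: "x \<in> V i"
    and ex: "\<exists>U E. openin (mtop (F i)) U \<and> x \<in> U \<and> orthonormal_frame (F i) (gF i) U E"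
  shows "scalar_curvature (F i) (gF i) (DF i) x = (\<Sum>k\<in>mindex (F i). \<Sum>l\<in>mindex (F i). RF i k l k l x / \<epsilon> i k)"
proof -
  interpret Fi: charted_metric "F i" "gF i" by (rule factor_metric[OF i])
  show ?thesis
    by (rule Fi.scalar_curvature_frame[OF x V_open[OF i] factor_connection[OF i] e_vf[OF i] orthogonal_e[OF i]
          gam_smooth[OF i] DF_expand[OF i] cc_smooth[OF i] bracket_e[OF i] ex])
qed

text \<open>Both frame indices are split into \<open>None\<close> and indices of factors. The
  curvature of a factor appears only when both lie in that factor, and there \<open>1 / G\<close>
  supplies the \<open>1 / \<epsilon>\<close> of the factor's own trace together with the power of
  \<open>b\<close>. Everything else depends on \<open>fst q\<close> alone and is collected in
  \<open>base_term\<close>.\<close>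

lemma scalar_curvature_warped:
  assumes q: "q \<in> W"
    and ex: "\<And>i. i \<in> J \<Longrightarrow> \<exists>U E. openin (mtop (F i)) U \<and> snd q i \<in> U \<and> orthonormal_frame (F i) (gF i) U E"
  shows "scalar_curvature M gM (Dq l1 l2) q =
    base_term l1 l2 (fst q) + (\<Sum>i=1..m. scalar_curvature (F i) (gF i) (DF i) (snd q i) / (b i (fst q))\<^sup>2)"
proof -
  let ?t = "fst q"
  have "scalar_curvature M gM (Dq l1 l2) q = (\<Sum>a\<in>KM. \<Sum>c\<in>KM. R l1 l2 a c a c q / G a q)"
    by (rule warped_product.scalar_curvature_frame[where B = B and G = G and \<Gamma> = "Gam l1 l2" and C = C, unfolded mindex_product,
        OF q W_open Dq_connection B_closed orthogonal_B Gam_smooth Dq_frame C_smooth bracket_B ex_frame_B[OF q]])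
  also have "\<dots> = (R l1 l2 None None None None q / G None q +
        (\<Sum>j=1..m. \<Sum>l\<in>mindex (F j). R l1 l2 None (Some (j, l)) None (Some (j, l)) q / G None q)) +
      (\<Sum>i=1..m. \<Sum>k\<in>mindex (F i). R l1 l2 (Some (i, k)) None (Some (i, k)) None q / G (Some (i, k)) q +
        (\<Sum>j=1..m. \<Sum>l\<in>mindex (F j). R l1 l2 (Some (i, k)) (Some (j, l)) (Some (i, k)) (Some (j, l)) q / G (Some (i, k)) q))"
    by (simp only: sum_KM)
  also have "\<dots> = - (\<Sum>j=1..m. \<Sum>l\<in>mindex (F j). mixed_trace l1 l2 j ?t) +
      (\<Sum>i=1..m. \<Sum>k\<in>mindex (F i). mixed_trace' l1 l2 i ?t +
        ((\<Sum>j=1..m. \<Sum>l\<in>mindex (F j). if j = i then RF i k l k l (snd q i) / \<epsilon> i k / (b i ?t)\<^sup>2 else 0) +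
         (\<Sum>j=1..m. \<Sum>l\<in>mindex (F j). (if i = j \<and> k = l then (H i ?t - l2) * (H i ?t - l1) else 0) - (H i ?t - l2) * (H j ?t - l1))))"
  proof (intro arg_cong2[of _ _ _ _ "(+)"] sum.cong refl)
    show "R l1 l2 None None None None q / G None q +
        (\<Sum>j=1..m. \<Sum>l\<in>mindex (F j). R l1 l2 None (Some (j, l)) None (Some (j, l)) q / G None q) =
        - (\<Sum>j=1..m. \<Sum>l\<in>mindex (F j). mixed_trace l1 l2 j ?t)"
      by (simp add: R_None_None[OF q] R_None_Some[OF q] G_def sum_negf)
    fix i k assume i: "i \<in> {1..m}" "k \<in> mindex (F i)"
    show "R l1 l2 (Some (i, k)) None (Some (i, k)) None q / G (Some (i, k)) q = mixed_trace' l1 l2 i ?t"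
      by (rule R_Some_None[OF q i])
    show "(\<Sum>j=1..m. \<Sum>l\<in>mindex (F j). R l1 l2 (Some (i, k)) (Some (j, l)) (Some (i, k)) (Some (j, l)) q / G (Some (i, k)) q) =
        (\<Sum>j=1..m. \<Sum>l\<in>mindex (F j). if j = i then RF i k l k l (snd q i) / \<epsilon> i k / (b i ?t)\<^sup>2 else 0) +
         (\<Sum>j=1..m. \<Sum>l\<in>mindex (F j). (if i = j \<and> k = l then (H i ?t - l2) * (H i ?t - l1) else 0) - (H i ?t - l2) * (H j ?t - l1))"
      unfolding sum.distrib[symmetric]
      by (intro sum.cong refl) (simp only: R_Some_Some[OF q i] eq_commute[of i])
  qed
  also have "\<dots> = base_term l1 l2 ?t + (\<Sum>i=1..m. \<Sum>k\<in>mindex (F i). \<Sum>l\<in>mindex (F i). RF i k l k l (snd q i) / \<epsilon> i k / (b i ?t)\<^sup>2)"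
  proof -
    have pick: "(\<Sum>i=1..m. \<Sum>k\<in>mindex (F i). \<Sum>j=1..m. \<Sum>l\<in>mindex (F j).
          if j = i then RF i k l k l (snd q i) / \<epsilon> i k / (b i ?t)\<^sup>2 else 0) =
        (\<Sum>i=1..m. \<Sum>k\<in>mindex (F i). \<Sum>l\<in>mindex (F i). RF i k l k l (snd q i) / \<epsilon> i k / (b i ?t)\<^sup>2)"
    proof (rule sum.cong[OF refl], rule sum.cong[OF refl])
      fix i k assume "i \<in> {1..m}"
      then show "(\<Sum>j=1..m. \<Sum>l\<in>mindex (F j). if j = i then RF i k l k l (snd q i) / \<epsilon> i k / (b i ?t)\<^sup>2 else 0) =
        (\<Sum>l\<in>mindex (F i). RF i k l k l (snd q i) / \<epsilon> i k / (b i ?t)\<^sup>2)" by (rule sum_pick)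
    qed
    show ?thesis unfolding base_term_def sum.distrib pick by (simp only: add_ac)
  qed
  also have "(\<Sum>i=1..m. \<Sum>k\<in>mindex (F i). \<Sum>l\<in>mindex (F i). RF i k l k l (snd q i) / \<epsilon> i k / (b i ?t)\<^sup>2) =
      (\<Sum>i=1..m. scalar_curvature (F i) (gF i) (DF i) (snd q i) / (b i ?t)\<^sup>2)"
    by (intro sum.cong refl) (simp add: scalar_curvature_factor[OF _ W_snd[OF q] ex] sum_divide_distrib)
  finally show ?thesis .
qed

end

section \<open>Choice of local data, and the conclusion\<close>

lemma (in charted_space) orthonormal_frame_restrictE:
  assumes "orthonormal_frame M g U E" "V \<subseteq> U"
  obtains \<epsilon> where "\<forall>k\<in>mindex M. E k \<in> vector_fields M V" "\<forall>k\<in>mindex M. \<epsilon> k = 1 \<or> \<epsilon> k = - 1"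
    "\<forall>x\<in>V. \<forall>k\<in>mindex M. \<forall>l\<in>mindex M. g x (E k x) (E l x) = (if k = l then \<epsilon> k else 0)"
proof -
  from assms(1)[unfolded orthonormal_frame_def] obtain \<epsilon> where *: "\<forall>k\<in>mindex M. E k \<in> vector_fields M U"
    "\<forall>k\<in>mindex M. \<epsilon> k = 1 \<or> \<epsilon> k = - 1"
    "\<forall>x\<in>U. \<forall>k\<in>mindex M. \<forall>l\<in>mindex M. g x (E k x) (E l x) = (if k = l then \<epsilon> k else 0)"
    by (elim conjE exE)
  show ?thesis
  proof (rule that[OF _ *(2)])
    show "\<forall>k\<in>mindex M. E k \<in> vector_fields M V"
      by (intro ballI vf_subset[OF bspec[OF *(1)] assms(2)])
    show "\<forall>x\<in>V. \<forall>k\<in>mindex M. \<forall>l\<in>mindex M. g x (E k x) (E l x) = (if k = l then \<epsilon> k else 0)"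
      by (intro ballI) (rule *(3)[THEN bspec, OF subsetD[OF assms(2)], THEN bspec, THEN bspec])
  qed
qed

text \<open>Charts and frames around the components of \<open>q\<close> are chosen for all factors
  at once, the frames cut down to the chart domains. They instantiate
  \<open>warped_connection\<close> and do not occur in its trace formula, which therefore holds at
  every point.\<close>

lemma (in warped) scalar_curvature_quarter_symmetric:
  assumes pm: "\<And>i. i \<in> J \<Longrightarrow> pseudo_metric (F i) (gF i)"
    and LC: "levi_civita M gM D" "\<And>i. i \<in> J \<Longrightarrow> levi_civita (F i) (gF i) (DF i)"
    and q: "q \<in> topspace (mtop M)"
  shows "scalar_curvature M gM (quarter_symmetric gM D (d_dt I m F) l1 l2) q =
    base_term l1 l2 (fst q) + (\<Sum>i=1..m. scalar_curvature (F i) (gF i) (DF i) (snd q i) / (b i (fst q))\<^sup>2)"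
proof -
  obtain U \<phi> where ch: "\<And>i. i \<in> J \<Longrightarrow> (U i, \<phi> i) \<in> matlas (F i)" and qU: "q \<in> product_dom I m U"
    using ex_product_chart[OF q] by blast
  have ex: "\<exists>V E. openin (mtop (F i)) V \<and> snd q i \<in> V \<and> orthonormal_frame (F i) (gF i) V E" if i: "i \<in> J" for i
    by (rule pseudo_metric.ex_orthonormal_frame[OF pm[OF i] snd_topspace[OF i q]])
  have "\<exists>V E \<epsilon>. openin (mtop (F i)) V \<and> snd q i \<in> V \<and> V \<subseteq> U i \<and> (\<forall>k\<in>mindex (F i). E k \<in> vector_fields (F i) V) \<and>
      (\<forall>k\<in>mindex (F i). \<epsilon> k = 1 \<or> \<epsilon> k = - 1) \<and>
      (\<forall>x\<in>V. \<forall>k\<in>mindex (F i). \<forall>l\<in>mindex (F i). gF i x (E k x) (E l x) = (if k = l then \<epsilon> k else 0))" if i: "i \<in> J" for i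
  proof -
    obtain V E where V: "openin (mtop (F i)) V" "snd q i \<in> V" "orthonormal_frame (F i) (gF i) V E"
      using ex[OF i] by blast
    have "openin (mtop (F i)) (V \<inter> U i)"
      by (intro openin_Int V charted_space.chart_open[OF factor_charted[OF i] ch[OF i]])
    moreover have "snd q i \<in> V \<inter> U i" using V(2) qU i by (auto simp: product_dom_def)
    moreover obtain \<epsilon> where "\<forall>k\<in>mindex (F i). E k \<in> vector_fields (F i) (V \<inter> U i)" "\<forall>k\<in>mindex (F i). \<epsilon> k = 1 \<or> \<epsilon> k = - 1"
      "\<forall>x\<in>V \<inter> U i. \<forall>k\<in>mindex (F i). \<forall>l\<in>mindex (F i). gF i x (E k x) (E l x) = (if k = l then \<epsilon> k else 0)"
      by (rule charted_space.orthonormal_frame_restrictE[OF factor_charted[OF i] V(3) Int_lower1])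
    ultimately show ?thesis
      by (intro exI[of _ "V \<inter> U i"] exI[of _ E] exI[of _ \<epsilon>] conjI Int_lower2)
  qed
  then have "\<forall>i\<in>J. \<exists>V E \<epsilon>. openin (mtop (F i)) V \<and> snd q i \<in> V \<and> V \<subseteq> U i \<and> (\<forall>k\<in>mindex (F i). E k \<in> vector_fields (F i) V) \<and>
      (\<forall>k\<in>mindex (F i). \<epsilon> k = 1 \<or> \<epsilon> k = - 1) \<and>
      (\<forall>x\<in>V. \<forall>k\<in>mindex (F i). \<forall>l\<in>mindex (F i). gF i x (E k x) (E l x) = (if k = l then \<epsilon> k else 0))"
    by (rule ballI)
  from bchoice[OF this] obtain V where "\<forall>i\<in>J. \<exists>E \<epsilon>. openin (mtop (F i)) (V i) \<and> snd q i \<in> V i \<and> V i \<subseteq> U i \<and>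
      (\<forall>k\<in>mindex (F i). E k \<in> vector_fields (F i) (V i)) \<and> (\<forall>k\<in>mindex (F i). \<epsilon> k = 1 \<or> \<epsilon> k = - 1) \<and>
      (\<forall>x\<in>V i. \<forall>k\<in>mindex (F i). \<forall>l\<in>mindex (F i). gF i x (E k x) (E l x) = (if k = l then \<epsilon> k else 0))" ..
  from bchoice[OF this] obtain E where "\<forall>i\<in>J. \<exists>\<epsilon>. openin (mtop (F i)) (V i) \<and> snd q i \<in> V i \<and> V i \<subseteq> U i \<and>
      (\<forall>k\<in>mindex (F i). E i k \<in> vector_fields (F i) (V i)) \<and> (\<forall>k\<in>mindex (F i). \<epsilon> k = 1 \<or> \<epsilon> k = - 1) \<and>
      (\<forall>x\<in>V i. \<forall>k\<in>mindex (F i). \<forall>l\<in>mindex (F i). gF i x (E i k x) (E i l x) = (if k = l then \<epsilon> k else 0))" ..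
  from bchoice[OF this] obtain \<epsilon> where fr: "\<forall>i\<in>J. openin (mtop (F i)) (V i) \<and> snd q i \<in> V i \<and> V i \<subseteq> U i \<and>
      (\<forall>k\<in>mindex (F i). E i k \<in> vector_fields (F i) (V i)) \<and> (\<forall>k\<in>mindex (F i). \<epsilon> i k = 1 \<or> \<epsilon> i k = - 1) \<and>
      (\<forall>x\<in>V i. \<forall>k\<in>mindex (F i). \<forall>l\<in>mindex (F i). gF i x (E i k x) (E i l x) = (if k = l then \<epsilon> i k else 0))" ..
  interpret warped_connection I m F gF b U \<phi> V E \<epsilon> D DF
    by unfold_locales (use ch fr LC in simp_all)
  have "q \<in> W" using qU fr unfolding W_def product_dom_def by (auto simp: PiE_iff)
  then show ?thesis by (rule scalar_curvature_warped[OF _ ex])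
qed

theorem theorem4p13:
  fixes I :: "real set" and m :: nat
    and F :: "nat \<Rightarrow> ('a, 'k) manifold" and gF :: "nat \<Rightarrow> 'a metric_field"
    and b :: "nat \<Rightarrow> real \<Rightarrow> real"
    and l1 l2 :: real
    and D :: "(real \<times> (nat \<Rightarrow> 'a)) connection" and DF :: "nat \<Rightarrow> 'a connection"
  assumes "open I" and "is_interval I" and "I \<noteq> {}"
    and "\<forall>i\<in>{1..m}. pseudo_riemannian (F i) (gF i)"
    and "\<forall>i\<in>{1..m}. smooth_on_interval I (b i) \<and> (\<forall>t\<in>I. b i t > 0)"
    and "l1 \<noteq> 0" and "l2 \<noteq> 0"
    and "levi_civita (product_manifold I m F) (warped_metric m F gF b) D"
    and "\<forall>i\<in>{1..m}. levi_civita (F i) (gF i) (DF i)"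
    and "constant_scalar_curvature (product_manifold I m F) (warped_metric m F gF b)
           (quarter_symmetric (warped_metric m F gF b) D (d_dt I m F) l1 l2)"
  shows "\<forall>i\<in>{1..m}. constant_scalar_curvature (F i) (gF i) (DF i)"
proof -
  let ?M = "product_manifold I m F" and ?g = "warped_metric m F gF b"
  let ?Dq = "quarter_symmetric ?g D (d_dt I m F) l1 l2"
  let ?S = "\<lambda>i. scalar_curvature (F i) (gF i) (DF i)"
  have pm: "pseudo_metric (F i) (gF i)" if "i \<in> {1..m}" for i
    using assms(4) that by (intro pseudo_riemannian_pseudo_metric) blast
  have cm: "charted_metric (F i) (gF i)" if "i \<in> {1..m}" for i
    by (rule pseudo_metric.axioms(1)[OF pm[OF that]])
  have "warped I m F gF b"
    by (intro warped.intro charted_factors.intro warped_axioms.intro cm charted_metric.axioms(1)[OF cm])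
       (use assms(1,5) in blast)+
  then interpret warped I m F gF b .
  note S = scalar_curvature_quarter_symmetric[OF pm assms(8) bspec[OF assms(9)]]
  obtain c where c: "\<forall>q\<in>topspace (mtop ?M). scalar_curvature ?M ?g ?Dq q = c"
    using assms(10) unfolding constant_scalar_curvature_def by (elim exE)
  obtain t where t: "t \<in> I" using assms(3) by blast
  \<comment> \<open>Base points at which the other factors are frozen; a manifold is nonempty by
    definition.\<close>
  have "\<forall>j\<in>{1..m}. \<exists>y. y \<in> topspace (mtop (F j))"
  proof
    fix j assume "j \<in> {1..m}"
    with assms(4) have "pseudo_riemannian (F j) (gF j)" by (rule bspec)
    then have "smooth_manifold (F j)" unfolding pseudo_riemannian_def by (rule conjunct1)
    then have "topspace (mtop (F j)) \<noteq> {}" unfolding smooth_manifold_def by (rule conjunct1)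
    then show "\<exists>y. y \<in> topspace (mtop (F j))" by blast
  qed
  from bchoice[OF this] obtain y where y: "\<forall>j\<in>{1..m}. y j \<in> topspace (mtop (F j))" ..
  show ?thesis
  proof
    fix i assume i: "i \<in> {1..m}"
    \<comment> \<open>The curvature formula at the fixed \<open>t\<close> and \<open>y\<close>,
      solved for the scalar curvature of the \<open>i\<close>-th factor; \<open>x\<close> does not
      occur in it.\<close>
    define c' where "c' = (c - base_term l1 l2 t - (\<Sum>j\<in>{1..m} - {i}. ?S j (y j) / (b j t)\<^sup>2)) * (b i t)\<^sup>2"
    have "?S i x = c'" if x: "x \<in> topspace (mtop (F i))" for x
    proof -
      \<comment> \<open>Only the \<open>i\<close>-th component varies with \<open>x\<close>. The
        restriction to \<open>{1..m}\<close> makes the second component a member of the dependent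
        product.\<close>
      let ?q = "(t, \<lambda>j\<in>{1..m}. if j = i then x else y j)"
      have q: "?q \<in> topspace (mtop ?M)" using t x y by (auto simp: topspace_product)
      have "c = base_term l1 l2 t + (\<Sum>j=1..m. ?S j (snd ?q j) / (b j t)\<^sup>2)"
        using S[OF _ _ q] bspec[OF c q] by simp
      also have "(\<Sum>j=1..m. ?S j (snd ?q j) / (b j t)\<^sup>2) =
          ?S i (snd ?q i) / (b i t)\<^sup>2 + (\<Sum>j\<in>{1..m} - {i}. ?S j (snd ?q j) / (b j t)\<^sup>2)"
        using i by (intro sum.remove) auto
      also have "(\<Sum>j\<in>{1..m} - {i}. ?S j (snd ?q j) / (b j t)\<^sup>2) = (\<Sum>j\<in>{1..m} - {i}. ?S j (y j) / (b j t)\<^sup>2)"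
        by (intro sum.cong refl) auto
      also have "snd ?q i = x" using i by simp
      finally have "?S i x / (b i t)\<^sup>2 = c - base_term l1 l2 t - (\<Sum>j\<in>{1..m} - {i}. ?S j (y j) / (b j t)\<^sup>2)" by simp
      then show ?thesis using b_pos[OF i t] by (simp add: c'_def field_simps)
    qed
    then show "constant_scalar_curvature (F i) (gF i) (DF i)"
      unfolding constant_scalar_curvature_def by blast
  qed
qed

end
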